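(* Let $C$ be an $n$-dimensional connected complex manifold holomorphically embedded in a complex manifold $M$ of dimension $n+1$. Assume that $H^0(C,\mathcal O_C)=\mathbb C$. Suppose that the normal bundle $N_{C/M}$ admits transition functions that are locally constant unitary matrices (i.e. $N_{C/M}$ is Hermitian flat). Assume that there exists a connected finite étale Galois cover $p:\hat C\to C$ of complex manifolds such that the induced neighborhood of $\hat C$ in $\hat M$ associated with $p$ admits a vertical linearisation. Assume that the short exact sequence $$0\to N^*_{\hat C/\hat M}\to\Omega^1_{\hat M}|_{\hat C}\to\Omega^1_{\hat C}\to0$$ splits and that, for all $k\ge1$, $$H^0(\hat C,N^{-k}_{\hat C/\hat M})=H^1(\hat C,N^{-k}_{\hat C/\hat M})=0,$$ $$H^0(\hat C,\Omega^1_{\hat C}\otimes N^{-k}_{\hat C/\hat M})=H^1(\hat C,\Omega^1_{\hat C}\otimes N^{-k}_{\hat C/\hat M})=0.$$ Assume furthermore that $$H^0(\hat C,\Omega^1_{\hat C}\otimes N_{\hat C/\hat M})=0.$$ Then a neighborhood of $C$ in $M$ admits a regular holomorphic foliation with $C$ as a leaf.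
   Context: Induced neighborhood: given a finite étale Galois cover $p:\hat C\to C$, after shrinking $M$ around $C$ there is a smooth retraction $\pi:M\to C$ with $\pi|_C=\mathrm{id}_C$. Set $\hat M:=M\times_C\hat C$ (via $\pi$ and $p$), with the unique complex structure making the covering $\hat p:\hat M\to M$ locally biholomorphic. Then $\hat C$ is holomorphically embedded in $\hat M$ via $x\mapsto(p(x),x)$, $\hat p|_{\hat C}=p$, and $N_{\hat C/\hat M}=p^*N_{C/M}$ (again Hermitian flat). $\hat M$ is considered as a germ along $\hat C$. $N^{-k}:=(N^* )^{\otimes k}$. Vertical linearisation: $\hat C\subset\hat M$ admits a vertical linearisation if a neighborhood of $\hat C$ in $\hat M$ can be covered by holomorphic charts $(h_j,v_j)$ on open sets $V_j$, with $h_j$ valued in $\mathbb C^n$ and $v_j$ valued in $\mathbb C^{\operatorname{codim}\hat C}$ (here $\mathbb C$), such that $\hat C\cap V_j=\{v_j=0\}$ and the coordinate changes have the form $$(h_k,v_k)=\bigl(\varphi_{kj}(h_j)+\hat\phi^h_{kj}(h_j,v_j),\ t_{kj}v_j\bigr),\qquad \hat\phi^h_{kj}(h_j,0)=0,$$ where $\varphi_{kj}$ are the transition functions of $\hat C$ and $t_{kj}$ are the transition functions of $N_{\hat C/\hat M}$, which are locally constant and unitary. A regular holomorphic foliation on a complex manifold is a holomorphic subbundle $\mathcal F$ of its tangent bundle with $[\mathcal F,\mathcal F]\subset\mathcal F$; here $\mathcal F$ has rank $n$. Its leaves are the maximal connected integral submanifolds. *)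

theory Defs
  imports "HOL-Analysis.Analysis"
begin

text \<open>Holomorphic maps between open subsets of complex coordinate spaces: complex
  Frechet differentiability at every point (a complex matrix acts complex-linearly).\<close>

definition holo_on :: "(complex^'a \<Rightarrow> complex^'b) \<Rightarrow> (complex^'a) set \<Rightarrow> bool"
    (infixl "holo'_on" 50) where
  "f holo_on S \<longleftrightarrow>
     open S \<and> (\<forall>z\<in>S. \<exists>A :: complex^'a^'b. (f has_derivative (\<lambda>h. A *v h)) (at z))"

definition jac :: "(complex^'a \<Rightarrow> complex^'b) \<Rightarrow> complex^'a \<Rightarrow> complex^'a^'b" where
  "jac f z = matrix (frechet_derivative f (at z))"

text \<open>Real differentiability classes; \<open>smooth_on\<close> is \<open>C\<close>-infinity.\<close>

primrec Ck_on ::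
    "nat \<Rightarrow> ('a::real_normed_vector \<Rightarrow> 'b::real_normed_vector) \<Rightarrow> 'a set \<Rightarrow> bool" where
  "Ck_on 0 f S \<longleftrightarrow> continuous_on S f"
| "Ck_on (Suc k) f S \<longleftrightarrow>
     (\<forall>z\<in>S. f differentiable (at z)) \<and> (\<forall>v. Ck_on k (\<lambda>z. frechet_derivative f (at z) v) S)"

definition smooth_on ::
    "('a::real_normed_vector \<Rightarrow> 'b::real_normed_vector) \<Rightarrow> 'a set \<Rightarrow> bool" where
  "smooth_on f S \<longleftrightarrow> open S \<and> (\<forall>k. Ck_on k f S)"


section \<open>Complex manifolds\<close>

text \<open>The complex dimension is the cardinality of the index type of the coordinate space.
  An atlas need not be maximal; \<open>charts\<close> is the maximal one.\<close>

type_synonym ('a, 'n) chart = "'a set \<times> ('a \<Rightarrow> complex^'n)"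

record ('a, 'n) cspace =
  top_of :: "'a topology"
  atlas :: "('a, 'n) chart set"

abbreviation points :: "('a, 'n::finite) cspace \<Rightarrow> 'a set" where
  "points M \<equiv> topspace (top_of M)"

abbreviation chart_inv :: "('a, 'n::finite) chart \<Rightarrow> complex^'n \<Rightarrow> 'a" where
  "chart_inv c \<equiv> inv_into (fst c) (snd c)"

definition is_chart :: "'a topology \<Rightarrow> ('a, 'n::finite) chart \<Rightarrow> bool" where
  "is_chart X c \<longleftrightarrow> openin X (fst c) \<and> open (snd c ` fst c) \<and>
     homeomorphic_map (subtopology X (fst c)) (top_of_set (snd c ` fst c)) (snd c)"

definition compatible :: "('a, 'n::finite) chart \<Rightarrow> ('a, 'n) chart \<Rightarrow> bool" where
  "compatible c d \<longleftrightarrow>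
     (snd c \<circ> chart_inv d) holo_on (snd d ` (fst c \<inter> fst d)) \<and>
     (snd d \<circ> chart_inv c) holo_on (snd c ` (fst c \<inter> fst d))"

definition complex_manifold :: "('a, 'n::finite) cspace \<Rightarrow> bool" where
  "complex_manifold M \<longleftrightarrow>
     Hausdorff_space (top_of M) \<and> second_countable (top_of M) \<and>
     (\<forall>c\<in>atlas M. is_chart (top_of M) c) \<and>
     (\<Union>c\<in>atlas M. fst c) = points M \<and>
     (\<forall>c\<in>atlas M. \<forall>d\<in>atlas M. compatible c d)"

definition charts :: "('a, 'n::finite) cspace \<Rightarrow> ('a, 'n) chart set" where
  "charts M = {c. is_chart (top_of M) c \<and> (\<forall>d\<in>atlas M. compatible c d)}"

definition connected_manifold :: "('a, 'n::finite) cspace \<Rightarrow> bool" where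
  "connected_manifold M \<longleftrightarrow>
     complex_manifold M \<and> connected_space (top_of M) \<and> points M \<noteq> {}"

definition open_sub :: "('a, 'n::finite) cspace \<Rightarrow> 'a set \<Rightarrow> ('a, 'n) cspace" where
  "open_sub M W = \<lparr>top_of = subtopology (top_of M) W,
                   atlas = (\<lambda>c. (fst c \<inter> W, snd c)) ` atlas M\<rparr>"

definition holo_map ::
    "('a, 'm::finite) cspace \<Rightarrow> ('b, 'n::finite) cspace \<Rightarrow> ('a \<Rightarrow> 'b) \<Rightarrow> bool" where
  "holo_map M N f \<longleftrightarrow> continuous_map (top_of M) (top_of N) f \<and>
     (\<forall>c\<in>atlas M. \<forall>d\<in>atlas N.
        (snd d \<circ> f \<circ> chart_inv c) holo_on (snd c ` (fst c \<inter> f -` fst d)))"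

definition smooth_map ::
    "('a, 'm::finite) cspace \<Rightarrow> ('b, 'n::finite) cspace \<Rightarrow> ('a \<Rightarrow> 'b) \<Rightarrow> bool" where
  "smooth_map M N f \<longleftrightarrow> continuous_map (top_of M) (top_of N) f \<and>
     (\<forall>c\<in>atlas M. \<forall>d\<in>atlas N.
        smooth_on (snd d \<circ> f \<circ> chart_inv c) (snd c ` (fst c \<inter> f -` fst d)))"

text \<open>Vector-valued holomorphic functions on an open subset \<open>W\<close> of \<open>M\<close>.\<close>

definition holo_fun ::
    "('a, 'n::finite) cspace \<Rightarrow> 'a set \<Rightarrow> ('a \<Rightarrow> complex^'r) \<Rightarrow> bool" where
  "holo_fun M W f \<longleftrightarrow> (\<forall>c\<in>atlas M. (f \<circ> chart_inv c) holo_on (snd c ` (fst c \<inter> W)))"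

definition biholomorphism ::
    "('a, 'm::finite) cspace \<Rightarrow> ('b, 'n::finite) cspace \<Rightarrow> ('a \<Rightarrow> 'b) \<Rightarrow> bool" where
  "biholomorphism M N f \<longleftrightarrow> holo_map M N f \<and>
     (\<exists>g. holo_map N M g \<and> (\<forall>x\<in>points M. g (f x) = x) \<and> (\<forall>y\<in>points N. f (g y) = y))"

definition locally_biholomorphic ::
    "('a, 'm::finite) cspace \<Rightarrow> ('b, 'n::finite) cspace \<Rightarrow> ('a \<Rightarrow> 'b) \<Rightarrow> bool" where
  "locally_biholomorphic M N f \<longleftrightarrow>
     (\<forall>x\<in>points M. \<exists>V. openin (top_of M) V \<and> x \<in> V \<and> openin (top_of N) (f ` V) \<and>
        biholomorphism (open_sub M V) (open_sub N (f ` V)) f)"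

definition immersion ::
    "('a, 'm::finite) cspace \<Rightarrow> ('b, 'n::finite) cspace \<Rightarrow> ('a \<Rightarrow> 'b) \<Rightarrow> bool" where
  "immersion M N f \<longleftrightarrow> holo_map M N f \<and>
     (\<forall>c\<in>charts M. \<forall>d\<in>charts N. \<forall>x\<in>fst c. f x \<in> fst d \<longrightarrow>
        inj ((*v) (jac (snd d \<circ> f \<circ> chart_inv c) (snd c x))))"

definition holo_embedding ::
    "('a, 'm::finite) cspace \<Rightarrow> ('b, 'n::finite) cspace \<Rightarrow> ('a \<Rightarrow> 'b) \<Rightarrow> bool" where
  "holo_embedding M N f \<longleftrightarrow> immersion M N f \<and> embedding_map (top_of M) (top_of N) f"

text \<open>The space of global holomorphic functions consists of the constants.\<close>

definition only_constant_functions :: "('a, 'n::finite) cspace \<Rightarrow> bool" where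
  "only_constant_functions M \<longleftrightarrow>
     (\<forall>f :: 'a \<Rightarrow> complex. holo_fun M (points M) (\<lambda>x. vec (f x) :: complex^1) \<longrightarrow>
        (\<exists>a. \<forall>x\<in>points M. f x = a))"

definition locally_constant_on :: "'a topology \<Rightarrow> 'a set \<Rightarrow> ('a \<Rightarrow> 'b) \<Rightarrow> bool" where
  "locally_constant_on X S t \<longleftrightarrow>
     (\<forall>x\<in>S. \<exists>T. openin X T \<and> x \<in> T \<and> T \<subseteq> S \<and> (\<forall>y\<in>T. t y = t x))"


section \<open>Holomorphic vector bundles and their cohomology\<close>

text \<open>A bundle of rank \<open>CARD('r)\<close> over \<open>C\<close> is given by trivialising open sets
  \<open>bdom E i\<close>, \<open>i \<in> bidx E\<close>, covering \<open>C\<close>, and holomorphic transition matrices, with the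
  convention that a section with components \<open>s i\<close> satisfies \<open>s i = btrans E i j *v s j\<close>.
  Values of \<open>btrans E i j\<close> outside \<open>bdom E i \<inter> bdom E j\<close> are irrelevant, and so are
  values of sections outside their domain.\<close>

record ('c, 'i, 'r) vbundle =
  bidx :: "'i set"
  bdom :: "'i \<Rightarrow> 'c set"
  btrans :: "'i \<Rightarrow> 'i \<Rightarrow> 'c \<Rightarrow> complex^'r^'r"

definition bundle_section ::
    "('c, 'n::finite) cspace \<Rightarrow> ('c, 'i, 'r::finite) vbundle \<Rightarrow> 'c set
       \<Rightarrow> ('i \<Rightarrow> 'c \<Rightarrow> complex^'r) \<Rightarrow> bool" where
  "bundle_section C E W s \<longleftrightarrow>
     (\<forall>i\<in>bidx E. holo_fun C (W \<inter> bdom E i) (s i)) \<and>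
     (\<forall>i\<in>bidx E. \<forall>j\<in>bidx E. \<forall>x\<in>W \<inter> bdom E i \<inter> bdom E j. s i x = btrans E i j x *v s j x)"

definition H0_vanishes ::
    "('c, 'n::finite) cspace \<Rightarrow> ('c, 'i, 'r::finite) vbundle \<Rightarrow> bool" where
  "H0_vanishes C E \<longleftrightarrow>
     (\<forall>s. bundle_section C E (points C) s \<longrightarrow> (\<forall>i\<in>bidx E. \<forall>x\<in>bdom E i. s i x = 0))"

text \<open>First cohomology is Cech cohomology, the direct limit over open covers (on the
  paracompact spaces considered here it agrees with sheaf cohomology): it vanishes iff every
  1-cocycle becomes a coboundary on some refinement of the cover.\<close>

definition open_cover :: "('c, 'n::finite) cspace \<Rightarrow> 'c set set \<Rightarrow> bool" where
  "open_cover C \<U> \<longleftrightarrow> (\<forall>U\<in>\<U>. openin (top_of C) U) \<and> \<Union>\<U> = points C"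

definition cech_cocycle1 ::
    "('c, 'n::finite) cspace \<Rightarrow> ('c, 'i, 'r::finite) vbundle \<Rightarrow> 'c set set
       \<Rightarrow> ('c set \<Rightarrow> 'c set \<Rightarrow> 'i \<Rightarrow> 'c \<Rightarrow> complex^'r) \<Rightarrow> bool" where
  "cech_cocycle1 C E \<U> z \<longleftrightarrow>
     (\<forall>U\<in>\<U>. \<forall>V\<in>\<U>. bundle_section C E (U \<inter> V) (z U V)) \<and>
     (\<forall>U\<in>\<U>. \<forall>V\<in>\<U>. \<forall>W\<in>\<U>. \<forall>i\<in>bidx E. \<forall>x\<in>U \<inter> V \<inter> W \<inter> bdom E i.
        z U W i x = z U V i x + z V W i x)"

definition H1_vanishes ::
    "('c, 'n::finite) cspace \<Rightarrow> ('c, 'i, 'r::finite) vbundle \<Rightarrow> bool" where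
  "H1_vanishes C E \<longleftrightarrow>
     (\<forall>\<U> z. open_cover C \<U> \<and> cech_cocycle1 C E \<U> z \<longrightarrow>
        (\<exists>\<V> \<rho> b. open_cover C \<V> \<and>
           (\<forall>V\<in>\<V>. \<rho> V \<in> \<U> \<and> V \<subseteq> \<rho> V \<and> bundle_section C E V (b V)) \<and>
           (\<forall>V\<in>\<V>. \<forall>V'\<in>\<V>. \<forall>i\<in>bidx E. \<forall>x\<in>V \<inter> V' \<inter> bdom E i.
              z (\<rho> V) (\<rho> V') i x = b V' i x - b V i x)))"

definition dual_bundle :: "('c, 'i, 'r::finite) vbundle \<Rightarrow> ('c, 'i, 'r) vbundle" where
  "dual_bundle E = \<lparr>bidx = bidx E, bdom = bdom E,
                    btrans = (\<lambda>i j x. transpose (matrix_inv (btrans E i j x)))\<rparr>"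

text \<open>Tensor powers of a line bundle, and tensor products with a line bundle.\<close>

definition line_power :: "('c, 'i, 1) vbundle \<Rightarrow> nat \<Rightarrow> ('c, 'i, 1) vbundle" where
  "line_power L k = \<lparr>bidx = bidx L, bdom = bdom L,
                     btrans = (\<lambda>i j x. \<chi> a b. (btrans L i j x $ a $ b) ^ k)\<rparr>"

definition tensor_line ::
    "('c, 'i, 'r::finite) vbundle \<Rightarrow> ('c, 'j, 1) vbundle \<Rightarrow> ('c, 'i \<times> 'j, 'r) vbundle" where
  "tensor_line E L = \<lparr>bidx = bidx E \<times> bidx L, bdom = (\<lambda>(i, j). bdom E i \<inter> bdom L j),
     btrans = (\<lambda>(i, j) (i', j') x. \<chi> a b. btrans E i i' x $ a $ b * btrans L j j' x $ 1 $ 1)\<rparr>"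

definition pullback_bundle ::
    "('c, 'n::finite) cspace \<Rightarrow> ('c \<Rightarrow> 'm) \<Rightarrow> ('m, 'i, 'r::finite) vbundle
       \<Rightarrow> ('c, 'i, 'r) vbundle" where
  "pullback_bundle C f E = \<lparr>bidx = bidx E, bdom = (\<lambda>i. points C \<inter> f -` bdom E i),
                            btrans = (\<lambda>i j x. btrans E i j (f x))\<rparr>"

text \<open>Local holomorphic frames: the columns of the invertible matrices \<open>e i x\<close> are sections.
  With respect to two frames related by \<open>e' = e ** t\<close> the transition function is \<open>t\<close>.\<close>

definition local_frame ::
    "('c, 'n::finite) cspace \<Rightarrow> ('c, 'i, 'r::finite) vbundle \<Rightarrow> 'c set
       \<Rightarrow> ('i \<Rightarrow> 'c \<Rightarrow> complex^'r^'r) \<Rightarrow> bool" where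
  "local_frame C E W e \<longleftrightarrow> openin (top_of C) W \<and>
     (\<forall>k. bundle_section C E W (\<lambda>i x. column k (e i x))) \<and>
     (\<forall>i\<in>bidx E. \<forall>x\<in>W \<inter> bdom E i. invertible (e i x))"

definition unitary_matrix :: "complex^'r^'r \<Rightarrow> bool" where
  "unitary_matrix t \<longleftrightarrow>
     map_matrix cnj (transpose t) ** t = mat 1 \<and> t ** map_matrix cnj (transpose t) = mat 1"

definition hermitian_flat ::
    "('c, 'n::finite) cspace \<Rightarrow> ('c, 'i, 'r::finite) vbundle \<Rightarrow> bool" where
  "hermitian_flat C E \<longleftrightarrow>
     (\<exists>\<T>. (\<forall>(W, e)\<in>\<T>. local_frame C E W e) \<and> (\<Union>(W, e)\<in>\<T>. W) = points C \<and>
        (\<forall>(W, e)\<in>\<T>. \<forall>(W', e')\<in>\<T>. \<exists>t.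
           locally_constant_on (top_of C) (W \<inter> W') t \<and>
           (\<forall>x\<in>W \<inter> W'. unitary_matrix (t x)) \<and>
           (\<forall>i\<in>bidx E. \<forall>x\<in>W \<inter> W' \<inter> bdom E i. e' i x = e i x ** t x)))"

text \<open>Bundle morphisms from \<open>E\<close> to \<open>F\<close>: \<open>A j i\<close> is the matrix with respect to the
  trivialisations \<open>i\<close> of \<open>E\<close> and \<open>j\<close> of \<open>F\<close>.\<close>

definition bundle_morphism ::
    "('c, 'n::finite) cspace \<Rightarrow> ('c, 'i, 'e::finite) vbundle \<Rightarrow> ('c, 'j, 'f::finite) vbundle
       \<Rightarrow> ('j \<Rightarrow> 'i \<Rightarrow> 'c \<Rightarrow> complex^'e^'f) \<Rightarrow> bool" where
  "bundle_morphism C E F A \<longleftrightarrow>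
     (\<forall>i\<in>bidx E. \<forall>j\<in>bidx F. \<forall>k. holo_fun C (bdom E i \<inter> bdom F j) (\<lambda>x. column k (A j i x))) \<and>
     (\<forall>i\<in>bidx E. \<forall>i'\<in>bidx E. \<forall>j\<in>bidx F. \<forall>j'\<in>bidx F.
        \<forall>x\<in>bdom E i \<inter> bdom E i' \<inter> bdom F j \<inter> bdom F j'.
          A j' i' x = btrans F j' j x ** A j i x ** btrans E i i' x)"

definition short_exact ::
    "('c, 'n::finite) cspace \<Rightarrow> ('c, 'i, 'e::finite) vbundle \<Rightarrow> ('c, 'j, 'f::finite) vbundle
       \<Rightarrow> ('c, 'k, 'g::finite) vbundle \<Rightarrow> ('j \<Rightarrow> 'i \<Rightarrow> 'c \<Rightarrow> complex^'e^'f)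
       \<Rightarrow> ('k \<Rightarrow> 'j \<Rightarrow> 'c \<Rightarrow> complex^'f^'g) \<Rightarrow> bool" where
  "short_exact C E F G A B \<longleftrightarrow> bundle_morphism C E F A \<and> bundle_morphism C F G B \<and>
     (\<forall>i\<in>bidx E. \<forall>j\<in>bidx F. \<forall>k\<in>bidx G. \<forall>x\<in>bdom E i \<inter> bdom F j \<inter> bdom G k.
        inj ((*v) (A j i x)) \<and> range ((*v) (A j i x)) = {u. B k j x *v u = 0} \<and>
        surj ((*v) (B k j x)))"

definition split_short_exact ::
    "('c, 'n::finite) cspace \<Rightarrow> ('c, 'i, 'e::finite) vbundle \<Rightarrow> ('c, 'j, 'f::finite) vbundle
       \<Rightarrow> ('c, 'k, 'g::finite) vbundle \<Rightarrow> ('j \<Rightarrow> 'i \<Rightarrow> 'c \<Rightarrow> complex^'e^'f)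
       \<Rightarrow> ('k \<Rightarrow> 'j \<Rightarrow> 'c \<Rightarrow> complex^'f^'g) \<Rightarrow> bool" where
  "split_short_exact C E F G A B \<longleftrightarrow> short_exact C E F G A B \<and>
     (\<exists>S. bundle_morphism C G F S \<and>
        (\<forall>j\<in>bidx F. \<forall>k\<in>bidx G. \<forall>x\<in>bdom F j \<inter> bdom G k. B k j x ** S j k x = mat 1))"


section \<open>Tangent, cotangent and normal bundles\<close>

definition tangent_bundle :: "('a, 'n::finite) cspace \<Rightarrow> ('a, ('a, 'n) chart, 'n) vbundle" where
  "tangent_bundle M = \<lparr>bidx = charts M, bdom = fst,
                       btrans = (\<lambda>c d x. jac (snd c \<circ> chart_inv d) (snd d x))\<rparr>"

definition cotangent_bundle :: "('a, 'n::finite) cspace \<Rightarrow> ('a, ('a, 'n) chart, 'n) vbundle" where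
  "cotangent_bundle M = dual_bundle (tangent_bundle M)"

text \<open>From here on \<open>\<iota>\<close> embeds an \<open>n\<close>-dimensional manifold \<open>C\<close> in an \<open>(n+1)\<close>-dimensional
  manifold \<open>M\<close>. The coordinate space of \<open>M\<close> is indexed by \<open>'n option\<close>: the \<open>Some\<close>
  coordinates form the \<open>C^n\<close>-valued function \<open>h\<close> and the \<open>None\<close> coordinate is \<open>v\<close>.\<close>

definition hor :: "complex^(('n::finite) option) \<Rightarrow> complex^'n" where
  "hor z = (\<chi> i. z $ Some i)"

definition ver :: "complex^(('n::finite) option) \<Rightarrow> complex" where
  "ver z = z $ None"

definition adapted_charts ::
    "('m, ('n::finite) option) cspace \<Rightarrow> ('c, 'n) cspace \<Rightarrow> ('c \<Rightarrow> 'm)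
       \<Rightarrow> ('m, 'n option) chart set" where
  "adapted_charts M C \<iota> =
     {c \<in> charts M. \<forall>x\<in>fst c. x \<in> \<iota> ` points C \<longleftrightarrow> ver (snd c x) = 0}"

text \<open>The normal bundle is the quotient of \<open>TM\<close> restricted to \<open>C\<close> by \<open>TC\<close>. Over an adapted
  chart \<open>(h, v)\<close> it is trivialised by the class of \<open>\<partial>/\<partial>v\<close>. The Jacobian of a change of
  adapted charts preserves \<open>TC\<close>, i.e. the vectors with vanishing \<open>None\<close> entry, and acts on
  the quotient by its \<open>(None, None)\<close> entry.\<close>

definition normal_bundle ::
    "('m, ('n::finite) option) cspace \<Rightarrow> ('c, 'n) cspace \<Rightarrow> ('c \<Rightarrow> 'm)
       \<Rightarrow> ('c, ('m, 'n option) chart, 1) vbundle" where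
  "normal_bundle M C \<iota> = \<lparr>bidx = adapted_charts M C \<iota>,
     bdom = (\<lambda>c. points C \<inter> \<iota> -` fst c),
     btrans = (\<lambda>c d x. \<chi> a b. jac (snd c \<circ> chart_inv d) (snd d (\<iota> x)) $ None $ None)\<rparr>"

abbreviation conormal_bundle ::
    "('m, ('n::finite) option) cspace \<Rightarrow> ('c, 'n) cspace \<Rightarrow> ('c \<Rightarrow> 'm)
       \<Rightarrow> ('c, ('m, 'n option) chart, 1) vbundle" where
  "conormal_bundle M C \<iota> \<equiv> dual_bundle (normal_bundle M C \<iota>)"

text \<open>The inclusion of the conormal bundle into the restricted cotangent bundle sends the
  generator over an adapted chart \<open>c = (h, v)\<close> to \<open>dv\<close>, here expressed in the chart \<open>d\<close>.\<close>

definition conormal_inclusion ::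
    "('m, ('n::finite) option) cspace \<Rightarrow> ('c \<Rightarrow> 'm) \<Rightarrow> ('m, 'n option) chart
       \<Rightarrow> ('m, 'n option) chart \<Rightarrow> 'c \<Rightarrow> complex^1^('n option)" where
  "conormal_inclusion M \<iota> d c x =
     (\<chi> a b. btrans (cotangent_bundle M) d c (\<iota> x) $ a $ None)"

text \<open>Restriction (pullback) of 1-forms from \<open>M\<close> to \<open>C\<close>.\<close>

definition form_restriction ::
    "('c \<Rightarrow> 'm) \<Rightarrow> ('c, 'n::finite) chart \<Rightarrow> ('m, 'n option) chart \<Rightarrow> 'c
       \<Rightarrow> complex^('n option)^'n" where
  "form_restriction \<iota> d c x = transpose (jac (snd c \<circ> \<iota> \<circ> chart_inv d) (snd d x))"

definition cotangent_sequence_splits ::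
    "('m, ('n::finite) option) cspace \<Rightarrow> ('c, 'n) cspace \<Rightarrow> ('c \<Rightarrow> 'm) \<Rightarrow> bool" where
  "cotangent_sequence_splits M C \<iota> \<longleftrightarrow>
     split_short_exact C (conormal_bundle M C \<iota>)
       (pullback_bundle C \<iota> (cotangent_bundle M)) (cotangent_bundle C)
       (conormal_inclusion M \<iota>) (form_restriction \<iota>)"


section \<open>Vertical linearisation, Galois covers and induced neighborhoods\<close>

text \<open>With \<open>c = (h_j, v_j)\<close> and \<open>d = (h_k, v_k)\<close>, the coordinate change is
  \<open>h_k = \<phi> h_j + \<phi>' (h_j, v_j)\<close>, \<open>v_k = t * v_j\<close>, where \<open>\<phi>'\<close> vanishes on \<open>C\<close> (so that
  \<open>\<phi>\<close> restricts to the transition function of \<open>C\<close>). \<open>\<phi>\<close> has to be holomorphic where the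
  formula evaluates it, and \<open>t\<close> is a function on the overlap in \<open>M\<close> whose restriction to
  \<open>C\<close> is the transition function of the normal bundle.\<close>

definition vertical_linearisation ::
    "('m, ('n::finite) option) cspace \<Rightarrow> ('c, 'n) cspace \<Rightarrow> ('c \<Rightarrow> 'm) \<Rightarrow> bool" where
  "vertical_linearisation M C \<iota> \<longleftrightarrow>
     (\<exists>\<V> \<subseteq> adapted_charts M C \<iota>. \<iota> ` points C \<subseteq> (\<Union>c\<in>\<V>. fst c) \<and>
        (\<forall>c\<in>\<V>. \<forall>d\<in>\<V>. \<exists>(\<phi> :: complex^'n \<Rightarrow> complex^'n) \<phi>' (t :: 'm \<Rightarrow> complex).
           \<phi> holo_on (hor ` snd c ` (fst c \<inter> fst d)) \<and>
           \<phi>' holo_on (snd c ` (fst c \<inter> fst d)) \<and>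
           (\<forall>z\<in>snd c ` (fst c \<inter> fst d). ver z = 0 \<longrightarrow> \<phi>' z = 0) \<and>
           locally_constant_on (top_of M) (fst c \<inter> fst d) t \<and>
           (\<forall>x\<in>fst c \<inter> fst d. cmod (t x) = 1 \<and>
              hor (snd d x) = \<phi> (hor (snd c x)) + \<phi>' (snd c x) \<and>
              ver (snd d x) = t x * ver (snd c x)) \<and>
           (\<forall>y\<in>points C. \<iota> y \<in> fst c \<inter> fst d \<longrightarrow>
              btrans (normal_bundle M C \<iota>) d c y $ 1 $ 1 = t (\<iota> y))))"

definition finite_etale_cover ::
    "('d, 'n::finite) cspace \<Rightarrow> ('c, 'n) cspace \<Rightarrow> ('d \<Rightarrow> 'c) \<Rightarrow> bool" where
  "finite_etale_cover D C p \<longleftrightarrow> holo_map D C p \<and> locally_biholomorphic D C p \<and>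
     p ` points D = points C \<and>
     (\<forall>x\<in>points C. \<exists>W \<V>. openin (top_of C) W \<and> x \<in> W \<and> finite \<V> \<and> disjoint \<V> \<and>
        (\<forall>V\<in>\<V>. openin (top_of D) V \<and>
           homeomorphic_map (subtopology (top_of D) V) (subtopology (top_of C) W) p) \<and>
        \<Union>\<V> = {y\<in>points D. p y \<in> W})"

text \<open>Galois: the deck transformations act transitively on the fibres.\<close>

definition finite_galois_cover ::
    "('d, 'n::finite) cspace \<Rightarrow> ('c, 'n) cspace \<Rightarrow> ('d \<Rightarrow> 'c) \<Rightarrow> bool" where
  "finite_galois_cover D C p \<longleftrightarrow> finite_etale_cover D C p \<and>
     (\<forall>y\<in>points D. \<forall>y'\<in>points D. p y = p y' \<longrightarrow>
        (\<exists>\<sigma>. biholomorphism D D \<sigma> \<and> (\<forall>u\<in>points D. p (\<sigma> u) = p u) \<and> \<sigma> y = y'))"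

text \<open>\<open>Mhat\<close> is the fibre product of \<open>p\<close> with a smooth retraction \<open>\<pi>\<close> of a neighborhood
  \<open>U\<close> of \<open>C\<close> onto \<open>C\<close>, with the complex structure for which the projection to \<open>U\<close>
  is locally biholomorphic.\<close>

definition induced_neighborhood ::
    "('m, ('n::finite) option) cspace \<Rightarrow> ('c, 'n) cspace \<Rightarrow> ('c \<Rightarrow> 'm) \<Rightarrow> ('d, 'n) cspace
       \<Rightarrow> ('d \<Rightarrow> 'c) \<Rightarrow> ('m \<times> 'd, 'n option) cspace \<Rightarrow> bool" where
  "induced_neighborhood M C \<iota> D p Mhat \<longleftrightarrow>
     (\<exists>U \<pi>. openin (top_of M) U \<and> \<iota> ` points C \<subseteq> U \<and> smooth_map (open_sub M U) C \<pi> \<and>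
        (\<forall>x\<in>points C. \<pi> (\<iota> x) = x) \<and>
        top_of Mhat = subtopology (prod_topology (subtopology (top_of M) U) (top_of D))
                        {(x, y). \<pi> x = p y} \<and>
        complex_manifold Mhat \<and>
        locally_biholomorphic Mhat (open_sub M U) fst)"


section \<open>Regular holomorphic foliations\<close>

text \<open>A family of subspaces of the tangent spaces over an open set \<open>W\<close> is represented by its
  coordinate expressions: \<open>F c x\<close> is the subspace at \<open>x\<close> in the chart \<open>c\<close>.\<close>

type_synonym ('m, 'd) distribution = "('m, 'd) chart \<Rightarrow> 'm \<Rightarrow> (complex^'d) set"

definition holo_subbundle ::
    "nat \<Rightarrow> ('m, 'd::finite) cspace \<Rightarrow> 'm set \<Rightarrow> ('m, 'd) distribution \<Rightarrow> bool" where
  "holo_subbundle r M W F \<longleftrightarrow>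
     (\<forall>c\<in>charts M. \<forall>d\<in>charts M. \<forall>x\<in>W \<inter> fst c \<inter> fst d.
        F c x = (*v) (btrans (tangent_bundle M) c d x) ` F d x) \<and>
     (\<forall>x\<in>W. \<exists>c\<in>charts M. \<exists>T (e :: nat \<Rightarrow> 'm \<Rightarrow> complex^'d).
        openin (top_of M) T \<and> x \<in> T \<and> T \<subseteq> W \<inter> fst c \<and> (\<forall>k<r. holo_fun M T (e k)) \<and>
        (\<forall>y\<in>T. F c y = vec.span ((\<lambda>k. e k y) ` {..<r}) \<and> vec.dim (F c y) = r))"

text \<open>Closure under Lie brackets, with the bracket of vector fields in local coordinates.\<close>

definition involutive ::
    "('m, 'd::finite) cspace \<Rightarrow> 'm set \<Rightarrow> ('m, 'd) distribution \<Rightarrow> bool" where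
  "involutive M W F \<longleftrightarrow>
     (\<forall>c\<in>charts M. \<forall>S X Y. S \<subseteq> snd c ` (fst c \<inter> W) \<and> X holo_on S \<and> Y holo_on S \<and>
        (\<forall>z\<in>S. X z \<in> F c (chart_inv c z) \<and> Y z \<in> F c (chart_inv c z)) \<longrightarrow>
        (\<forall>z\<in>S. jac Y z *v X z - jac X z *v Y z \<in> F c (chart_inv c z)))"

definition regular_foliation ::
    "nat \<Rightarrow> ('m, 'd::finite) cspace \<Rightarrow> 'm set \<Rightarrow> ('m, 'd) distribution \<Rightarrow> bool" where
  "regular_foliation r M W F \<longleftrightarrow>
     openin (top_of M) W \<and> holo_subbundle r M W F \<and> involutive M W F"

text \<open>Connected integral submanifolds are injectively immersed (not necessarily embedded).\<close>

definition integral_submanifold ::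
    "('m, 'd::finite) cspace \<Rightarrow> 'm set \<Rightarrow> ('m, 'd) distribution \<Rightarrow> ('k, 'n::finite) cspace
       \<Rightarrow> ('k \<Rightarrow> 'm) \<Rightarrow> bool" where
  "integral_submanifold M W F K f \<longleftrightarrow>
     connected_manifold K \<and> immersion K M f \<and> inj_on f (points K) \<and> f ` points K \<subseteq> W \<and>
     (\<forall>c\<in>charts M. \<forall>d\<in>charts K. \<forall>y\<in>fst d. f y \<in> fst c \<longrightarrow>
        F c (f y) = range ((*v) (jac (snd c \<circ> f \<circ> chart_inv d) (snd d y))))"

text \<open>Competitors for maximality may be taken to be subsets of \<open>M\<close> with a manifold structure
  of their own, since an injectively immersed manifold can be transported to its image.\<close>

definition is_leaf ::
    "('m, 'd::finite) cspace \<Rightarrow> 'm set \<Rightarrow> ('m, 'd) distribution \<Rightarrow> ('k, 'n::finite) cspace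
       \<Rightarrow> ('k \<Rightarrow> 'm) \<Rightarrow> bool" where
  "is_leaf M W F K f \<longleftrightarrow> integral_submanifold M W F K f \<and>
     (\<forall>L :: ('m, 'n) cspace. integral_submanifold M W F L (\<lambda>x. x) \<and> f ` points K \<subseteq> points L
        \<longrightarrow> points L = f ` points K)"

end

theory Submission
  imports Defs "HOL-Complex_Analysis.Cauchy_Integral_Formula"
begin

text \<open>By the vertical linearisation the modulus of the vertical coordinate \<open>v\<close> is a well defined
  function near \<open>Chat\<close> in \<open>Mhat\<close>. Its geometric mean over the fibres of \<open>p\<close> descends to a function
  \<open>\<rho>\<close> near \<open>C\<close>, which is locally the modulus of a holomorphic function \<open>u\<close> with nowhere vanishing
  differential and zero set \<open>C\<close>. Two such functions have the same modulus, so their differentials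
  have the same kernel: these kernels form the foliation. On an integral submanifold \<open>u\<close> is locally
  constant, hence the points of \<open>C\<close> on it form an open and closed subset.\<close>

section \<open>Holomorphic functions of several variables\<close>

text \<open>Descent shapes the proof. Nothing makes |v| invariant under deck transformations, so by
  itself it need not come from a function near C. The product over all sheets does, but it vanishes
  along C to an order equal to the number of sheets. The root restores order one, so that the
  differential survives on C itself. It is taken holomorphically: each factor is an equation of C
  times a unit, and only the unit needs a logarithm. Branches of the root and the unitary factors of
  the linearisation change u only by constants of modulus one. The modulus is what is canonical, and
  kernels of differentials do not see such constants, so the foliation can be described by the
  modulus alone, with no compatible system of local equations to choose. Holomorphic means complex
  differentiable at every point of an open set; the regularity of gradients that frames, brackets
  and division require is therefore extracted first, from the Cauchy formula on complex lines
  parallel to the axes.\<close>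

definition cdot :: "complex^'a \<Rightarrow> complex^'a \<Rightarrow> complex" where
  "cdot a h = (\<Sum>i\<in>UNIV. a $ i * h $ i)"

text \<open>Scalar functions at single points are the working notion, and \<open>holo_on_iff\<close>
  recovers \<open>holo_on\<close> from it. The pairing \<open>cdot\<close> is bilinear without
  conjugation, so the functionals \<open>cdot a\<close> are exactly the complex-linear ones, in
  contrast to the real inner product.\<close>

definition hol_at :: "(complex^'a \<Rightarrow> complex) \<Rightarrow> complex^'a \<Rightarrow> bool" where
  "hol_at f z \<longleftrightarrow> (\<exists>a. (f has_derivative cdot a) (at z))"

definition grad :: "(complex^'a \<Rightarrow> complex) \<Rightarrow> complex^'a \<Rightarrow> complex^'a" where
  "grad f z = (\<chi> i. frechet_derivative f (at z) (axis i 1))"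

section \<open>Rules of calculus for complex gradients\<close>

lemma cdot_axis [simp]: "cdot a (axis i 1) = a $ i"
  by (simp add: cdot_def axis_def if_distrib cong: if_cong)

lemma cdot_add: "cdot a (x + y) = cdot a x + cdot a y"
  by (simp add: cdot_def distrib_left sum.distrib)

lemma cdot_diff: "cdot a (x - y) = cdot a x - cdot a y"
  by (simp add: cdot_def right_diff_distrib sum_subtractf)

lemma cdot_scale: "cdot a (c *s x) = c * cdot a x"
  by (simp add: cdot_def sum_distrib_left mult_ac)

lemma cdot_zero [simp]: "cdot a 0 = 0" "cdot 0 a = 0"
  by (simp_all add: cdot_def)

lemma bounded_linear_cdot: "bounded_linear (cdot a)"
  unfolding cdot_def
  by (intro bounded_linear_sum bounded_linear_const_mult bounded_linear_vec_nth)

lemma cdot_eq_iff: "cdot a = cdot b \<longleftrightarrow> a = b"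
  by (metis cdot_axis vec_eq_iff)

lemma hol_at_derivative:
  assumes "hol_at f z"
  shows "(f has_derivative cdot (grad f z)) (at z)"
proof -
  obtain a where a: "(f has_derivative cdot a) (at z)"
    using assms hol_at_def by blast
  then have "frechet_derivative f (at z) = cdot a"
    using frechet_derivative_at by metis
  then have "grad f z = a"
    by (simp add: grad_def vec_eq_iff)
  with a show ?thesis by simp
qed

lemma has_derivative_cdotD:
  assumes "(f has_derivative cdot a) (at z)"
  shows "hol_at f z" "grad f z = a"
proof -
  show h: "hol_at f z" using assms hol_at_def by blast
  show "grad f z = a"
    using has_derivative_unique[OF assms hol_at_derivative[OF h]] cdot_eq_iff by metis
qed

lemma hol_at_cong:
  assumes "hol_at f z" "eventually (\<lambda>x. f x = g x) (nhds z)"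
  shows "hol_at g z" "grad g z = grad f z"
proof -
  have "(g has_derivative cdot (grad f z)) (at z)"
    using has_derivative_transform_eventually[OF hol_at_derivative[OF assms(1)], of g] assms(2)
      eventually_nhds_x_imp_x[OF assms(2)]
    by (simp add: eventually_at_filter eventually_mono)
  then show "hol_at g z" "grad g z = grad f z"
    using has_derivative_cdotD by blast+
qed

lemma hol_at_cong_open:
  assumes "open S" "z \<in> S" "\<And>x. x \<in> S \<Longrightarrow> f x = g x" "hol_at f z"
  shows "hol_at g z" "grad g z = grad f z"
proof -
  have e: "eventually (\<lambda>x. f x = g x) (nhds z)"
    unfolding eventually_nhds using assms(1-3) by blast
  show "hol_at g z" "grad g z = grad f z"
    by (rule hol_at_cong[OF assms(4) e])+
qed

lemma hol_at_continuous: "hol_at f z \<Longrightarrow> isCont f z"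
  using hol_at_def has_derivative_continuous by blast

lemma hol_at_continuous_on: "(\<And>z. z \<in> S \<Longrightarrow> hol_at f z) \<Longrightarrow> continuous_on S f"
  using hol_at_continuous continuous_at_imp_continuous_on by blast

lemma hol_at_const [simp]: "hol_at (\<lambda>z. c) z" "grad (\<lambda>z. c) z = 0"
proof -
  have "((\<lambda>z. c) has_derivative cdot 0) (at z)"
    by (rule has_derivative_eq_rhs[OF has_derivative_const]) (simp add: cdot_def fun_eq_iff)
  then show "hol_at (\<lambda>z. c) z" "grad (\<lambda>z. c) z = 0"
    using has_derivative_cdotD by blast+
qed

lemma hol_at_component [simp]: "hol_at (\<lambda>z. z $ i) z" "grad (\<lambda>z. z $ i) z = axis i 1"
proof -
  have "((\<lambda>z. z $ i) has_derivative cdot (axis i 1)) (at z)"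
    by (rule has_derivative_eq_rhs[OF bounded_linear_imp_has_derivative[OF bounded_linear_vec_nth]])
       (simp add: cdot_def axis_def fun_eq_iff if_distrib[of "\<lambda>x. x * _"] cong: if_cong)
  then show "hol_at (\<lambda>z. z $ i) z" "grad (\<lambda>z. z $ i) z = axis i 1"
    using has_derivative_cdotD by blast+
qed

lemma hol_at_add:
  assumes "hol_at f z" "hol_at g z"
  shows "hol_at (\<lambda>z. f z + g z) z" "grad (\<lambda>z. f z + g z) z = grad f z + grad g z"
proof -
  have "((\<lambda>z. f z + g z) has_derivative cdot (grad f z + grad g z)) (at z)"
    by (rule has_derivative_eq_rhs[OF has_derivative_add[OF assms[THEN hol_at_derivative]]])
       (simp add: cdot_def distrib_right sum.distrib fun_eq_iff)
  then show "hol_at (\<lambda>z. f z + g z) z" "grad (\<lambda>z. f z + g z) z = grad f z + grad g z"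
    using has_derivative_cdotD by blast+
qed

lemma hol_at_mult:
  assumes "hol_at f z" "hol_at g z"
  shows "hol_at (\<lambda>z. f z * g z) z" "grad (\<lambda>z. f z * g z) z = f z *s grad g z + g z *s grad f z"
proof -
  have "((\<lambda>z. f z * g z) has_derivative cdot (f z *s grad g z + g z *s grad f z)) (at z)"
    by (rule has_derivative_eq_rhs[OF has_derivative_mult[OF assms[THEN hol_at_derivative]]])
       (simp add: cdot_def distrib_right sum.distrib sum_distrib_left sum_distrib_right fun_eq_iff mult.assoc mult.commute[of "g z"])
  then show "hol_at (\<lambda>z. f z * g z) z" "grad (\<lambda>z. f z * g z) z = f z *s grad g z + g z *s grad f z"
    using has_derivative_cdotD by blast+
qed

lemma hol_at_sum:
  assumes "\<And>i. i \<in> I \<Longrightarrow> hol_at (f i) z"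
  shows "hol_at (\<lambda>z. \<Sum>i\<in>I. f i z) z"
  using assms by (induction I rule: infinite_finite_induct) (auto intro: hol_at_add)

lemma hol_at_field:
  assumes "hol_at f z" "(\<phi> has_field_derivative \<phi>') (at (f z))"
  shows "hol_at (\<lambda>z. \<phi> (f z)) z" "grad (\<lambda>z. \<phi> (f z)) z = \<phi>' *s grad f z"
proof -
  have "((\<lambda>z. \<phi> (f z)) has_derivative cdot (\<phi>' *s grad f z)) (at z)"
    using has_derivative_compose[OF hol_at_derivative[OF assms(1)] assms(2)[unfolded has_field_derivative_def]]
    by (rule has_derivative_eq_rhs) (simp add: cdot_def sum_distrib_left mult_ac fun_eq_iff)
  then show "hol_at (\<lambda>z. \<phi> (f z)) z" "grad (\<lambda>z. \<phi> (f z)) z = \<phi>' *s grad f z"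
    using has_derivative_cdotD by blast+
qed

text \<open>The bridge to one-variable theory: on a complex line the directional derivative is an
  ordinary complex derivative.\<close>

lemma hol_at_line:
  assumes "hol_at f (z + \<zeta> *s w)"
  shows "((\<lambda>\<zeta>. f (z + \<zeta> *s w)) has_field_derivative cdot (grad f (z + \<zeta> *s w)) w) (at \<zeta>)"
proof -
  have bl: "bounded_linear (\<lambda>\<zeta>::complex. \<zeta> *s w)"
    by (simp add: linear_conv_bounded_linear[symmetric] linear_iff vec_eq_iff distrib_right)
  have "((\<lambda>\<zeta>. z + \<zeta> *s w) has_derivative (\<lambda>h. h *s w)) (at \<zeta>)"
    using has_derivative_add[OF has_derivative_const bounded_linear_imp_has_derivative[OF bl]] by simp
  from has_derivative_compose[OF this hol_at_derivative[OF assms]]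
  show ?thesis
    unfolding has_field_derivative_def
    by (rule has_derivative_eq_rhs) (simp add: cdot_scale mult.commute fun_eq_iff)
qed

text \<open>The integral formula is the Cauchy formula for the derivative on the complex line through
  \<open>z\<close> in direction \<open>w\<close>.\<close>

lemma cauchy_directional_derivative:
  fixes f :: "complex^'a \<Rightarrow> complex"
  assumes hol: "\<And>\<zeta>. cmod \<zeta> \<le> r \<Longrightarrow> hol_at f (z + \<zeta> *s w)" and r: "0 < r"
  shows "cdot (grad f z) w =
    integral {0..1} (\<lambda>t. f (z + (r * exp (2 * of_real pi * \<i> * of_real t)) *s w)
      / (r * exp (2 * of_real pi * \<i> * of_real t)))"
proof -
  define \<phi> where "\<phi> \<zeta> = f (z + \<zeta> *s w)" for \<zeta>
  have d: "(\<phi> has_field_derivative cdot (grad f (z + \<zeta> *s w)) w) (at \<zeta>)" if "cmod \<zeta> \<le> r" for \<zeta>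
    unfolding \<phi>_def by (rule hol_at_line[OF hol[OF that]])
  have c: "continuous_on (cball 0 r) \<phi>"
    by (intro continuous_at_imp_continuous_on ballI DERIV_isCont[OF d]) simp
  have h: "\<phi> holomorphic_on ball 0 r"
    unfolding holomorphic_on_open[OF open_ball] using d by (metis less_imp_le mem_ball_0)
  have "cdot (grad f (z + 0 *s w)) w = (1 / (2 * of_real pi * \<i>) * contour_integral(circlepath 0 r) (\<lambda>u. \<phi> u / (u-0)^2))"
    by (rule DERIV_unique[OF d Cauchy_derivative_integral_circlepath(2)[OF c h]]) (use r in simp_all)
  also have "\<dots> = integral {0..1} (\<lambda>t. 1 / (2 * of_real pi * \<i>) * (\<phi> (circlepath 0 r t) / (circlepath 0 r t)^2 * vector_derivative (circlepath 0 r) (at t)))"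
    by (simp only: contour_integral_integral diff_zero integral_mult_right)
  \<comment> \<open>The velocity of the circle cancels the prefactor and one of the two factors in
    the denominator.\<close>
  also have "\<dots> = integral {0..1} (\<lambda>t. \<phi> (r * exp (2 * of_real pi * \<i> * of_real t))
      / (r * exp (2 * of_real pi * \<i> * of_real t)))"
    using r by (intro integral_cong) (simp add: vector_derivative_circlepath, simp add: circlepath power2_eq_square field_simps)
  finally show ?thesis by (simp add: \<phi>_def)
qed

text \<open>Differentiation under the integral sign. \<open>leibniz_rule\<close> asks for a
  derivative that is jointly continuous as a bounded linear map; in finite dimension it is enough
  that each entry of the gradient is continuous.\<close>

lemma hol_at_integral:
  fixes F :: "complex^'a \<Rightarrow> real \<Rightarrow> complex"
  assumes hol: "\<And>z t. z \<in> ball z0 d \<Longrightarrow> t \<in> {0..1} \<Longrightarrow> hol_at (\<lambda>z. F z t) z"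
    and cont: "continuous_on (ball z0 d \<times> {0..1}) (\<lambda>(z, t). F z t)"
    and contg: "\<And>i. continuous_on (ball z0 d \<times> {0..1}) (\<lambda>(z, t). grad (\<lambda>z. F z t) z $ i)"
    and z: "z \<in> ball z0 d"
  shows "hol_at (\<lambda>z. integral {0..1} (F z)) z"
    and "grad (\<lambda>z. integral {0..1} (F z)) z $ i = integral {0..1} (\<lambda>t. grad (\<lambda>z. F z t) z $ i)"
proof -
  define G where "G z t = Blinfun (cdot (grad (\<lambda>z. F z t) z))" for z t
  have G: "blinfun_apply (G z t) = cdot (grad (\<lambda>z. F z t) z)" for z t
    by (simp add: G_def bounded_linear_Blinfun_apply bounded_linear_cdot)
  have cG: "continuous_on (ball z0 d \<times> cbox 0 1) (\<lambda>(z, t). G z t)"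
    using contg
    by (intro continuous_on_blinfun_componentwise)
       (simp add: G cdot_def split_beta continuous_on_sum continuous_on_mult continuous_on_const)
  have pz: "continuous_on {0..1} (Pair z)" "Pair z ` {0..1} \<subseteq> ball z0 d \<times> cbox 0 (1::real)"
    if "z \<in> ball z0 d" for z
    using that by (auto intro!: continuous_on_Pair continuous_on_const continuous_on_id)
  have cGz: "continuous_on {0..1} (G z)"
    using continuous_on_compose2[OF cG pz[OF z]] by simp
  have cz: "continuous_on {0..1} (\<lambda>t. grad (\<lambda>z. F z t) z $ i)" for i
    using continuous_on_compose2[OF contg pz(1)[OF z]] pz(2)[OF z] by simp
  have int: "F z integrable_on cbox 0 1" if "z \<in> ball z0 d" for z
    using continuous_on_compose2[OF cont pz(1)[OF that]] pz(2)[OF that]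
    by (simp add: integrable_continuous_real)
  have "((\<lambda>z. integral (cbox 0 1) (F z)) has_derivative integral (cbox 0 1) (G z)) (at z within ball z0 d)"
    by (rule leibniz_rule[OF _ int cG z convex_ball])
       (use hol in \<open>auto simp: G intro!: has_derivative_at_withinI[OF hol_at_derivative]\<close>)
  then have "((\<lambda>z. integral {0..1} (F z)) has_derivative integral {0..1} (G z)) (at z)"
    using z by (simp add: at_within_open[OF _ open_ball])
  moreover have "blinfun_apply (integral {0..1} (G z)) = cdot (\<chi> i. integral {0..1} (\<lambda>t. grad (\<lambda>z. F z t) z $ i))"
  proof
    fix h
    have "blinfun_apply (integral {0..1} (G z)) h = integral {0..1} (\<lambda>t. \<Sum>i\<in>UNIV. grad (\<lambda>z. F z t) z $ i * h $ i)"
      using blinfun_apply_integral[OF integrable_continuous_real[OF cGz]] by (simp add: G cdot_def)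
    also have "\<dots> = (\<Sum>i\<in>UNIV. integral {0..1} (\<lambda>t. grad (\<lambda>z. F z t) z $ i * h $ i))"
      by (intro integral_sum) (auto intro!: integrable_continuous_real continuous_intros cz)
    finally show "blinfun_apply (integral {0..1} (G z)) h = cdot (\<chi> i. integral {0..1} (\<lambda>t. grad (\<lambda>z. F z t) z $ i)) h"
      by (simp add: cdot_def)
  qed
  ultimately have "((\<lambda>z. integral {0..1} (F z)) has_derivative cdot (\<chi> i. integral {0..1} (\<lambda>t. grad (\<lambda>z. F z t) z $ i))) (at z)"
    by simp
  from has_derivative_cdotD[OF this]
  show "hol_at (\<lambda>z. integral {0..1} (F z)) z"
    "grad (\<lambda>z. integral {0..1} (F z)) z $ i = integral {0..1} (\<lambda>t. grad (\<lambda>z. F z t) z $ i)"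
    by (simp_all only: vec_lambda_beta)
qed

section \<open>Vector-valued maps, Jacobians and the chain rule\<close>

lemma has_derivative_vec_iff:
  fixes f :: "'a::real_normed_vector \<Rightarrow> complex^'b"
  shows "(f has_derivative D) (at z) \<longleftrightarrow> (\<forall>i. ((\<lambda>x. f x $ i) has_derivative (\<lambda>h. D h $ i)) (at z))"
proof
  show "\<forall>i. ((\<lambda>x. f x $ i) has_derivative (\<lambda>h. D h $ i)) (at z)" if "(f has_derivative D) (at z)"
    using bounded_linear.has_derivative[OF bounded_linear_vec_nth that] by blast
next
  assume *: "\<forall>i. ((\<lambda>x. f x $ i) has_derivative (\<lambda>h. D h $ i)) (at z)"
  show "(f has_derivative D) (at z)"
    unfolding has_derivative_componentwise_within[of f]
  proof
    fix b :: "complex^'b" assume "b \<in> Basis"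
    then obtain i u where b: "b = axis i u" "u \<in> Basis" by (auto simp: Basis_vec_def)
    have "((\<lambda>x. f x $ i \<bullet> u) has_derivative (\<lambda>h. D h $ i \<bullet> u)) (at z)"
      using * by (intro has_derivative_inner_left) blast
    then show "((\<lambda>x. f x \<bullet> b) has_derivative (\<lambda>h. D h \<bullet> b)) (at z)"
      by (simp add: b inner_axis)
  qed
qed

lemma matrix_vector_nth_cdot: "(A *v h) $ i = cdot (A $ i) h"
  by (simp add: matrix_vector_mult_def cdot_def)

text \<open>The rows of the complex matrix in \<open>holo_on\<close> are the gradients of the
  components.\<close>

lemma holo_on_iff:
  fixes f :: "complex^'a \<Rightarrow> complex^'b"
  shows "f holo_on S \<longleftrightarrow> open S \<and> (\<forall>z\<in>S. \<forall>i. hol_at (\<lambda>x. f x $ i) z)"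
proof -
  have "(\<exists>A :: complex^'a^'b. (f has_derivative (\<lambda>h. A *v h)) (at z)) \<longleftrightarrow> (\<forall>i. hol_at (\<lambda>x. f x $ i) z)" for z
  proof
    assume "\<exists>A :: complex^'a^'b. (f has_derivative (\<lambda>h. A *v h)) (at z)"
    then show "\<forall>i. hol_at (\<lambda>x. f x $ i) z"
      by (auto simp: has_derivative_vec_iff[of f] matrix_vector_nth_cdot hol_at_def)
  next
    assume "\<forall>i. hol_at (\<lambda>x. f x $ i) z"
    then have "(f has_derivative (\<lambda>h. (\<chi> i. grad (\<lambda>x. f x $ i) z) *v h)) (at z)"
      by (auto simp: has_derivative_vec_iff[of f] matrix_vector_nth_cdot intro: hol_at_derivative)
    then show "\<exists>A :: complex^'a^'b. (f has_derivative (\<lambda>h. A *v h)) (at z)" by blast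
  qed
  then show ?thesis by (simp add: holo_on_def)
qed

lemma jac_works:
  fixes f :: "complex^'a \<Rightarrow> complex^'b"
  assumes "\<And>i. hol_at (\<lambda>x. f x $ i) z"
  shows "(f has_derivative (\<lambda>h. jac f z *v h)) (at z)" "jac f z $ i = grad (\<lambda>x. f x $ i) z"
proof -
  have d: "(f has_derivative (\<lambda>h. (\<chi> i. grad (\<lambda>x. f x $ i) z) *v h)) (at z)"
    using assms by (auto simp: has_derivative_vec_iff[of f] matrix_vector_nth_cdot intro: hol_at_derivative)
  then have "frechet_derivative f (at z) = (\<lambda>h. (\<chi> i. grad (\<lambda>x. f x $ i) z) *v h)"
    using frechet_derivative_at by metis
  then have "jac f z = (\<chi> i. grad (\<lambda>x. f x $ i) z)"
    by (simp add: jac_def)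
  with d show "(f has_derivative (\<lambda>h. jac f z *v h)) (at z)" "jac f z $ i = grad (\<lambda>x. f x $ i) z"
    by simp_all
qed

lemma hol_at_compose:
  fixes \<phi> :: "complex^'a \<Rightarrow> complex^'b"
  assumes g: "hol_at g (\<phi> z)" and \<phi>: "\<And>i. hol_at (\<lambda>z. \<phi> z $ i) z"
  shows "hol_at (\<lambda>z. g (\<phi> z)) z"
    and "cdot (grad (\<lambda>z. g (\<phi> z)) z) h = cdot (grad g (\<phi> z)) (jac \<phi> z *v h)"
    and "grad (\<lambda>z. g (\<phi> z)) z $ j = (\<Sum>i\<in>UNIV. grad g (\<phi> z) $ i * grad (\<lambda>z. \<phi> z $ i) z $ j)"
proof -
  define a where "a = (\<chi> j. \<Sum>i\<in>UNIV. grad g (\<phi> z) $ i * jac \<phi> z $ i $ j)"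
  have a: "cdot (grad g (\<phi> z)) (jac \<phi> z *v h) = cdot a h" for h
    by (simp add: a_def cdot_def matrix_vector_mult_def sum_distrib_left sum_distrib_right mult.assoc)
       (rule sum.swap)
  have "((\<lambda>z. g (\<phi> z)) has_derivative (\<lambda>h. cdot (grad g (\<phi> z)) (jac \<phi> z *v h))) (at z)"
    by (rule has_derivative_compose[OF jac_works(1)[OF \<phi>] hol_at_derivative[OF g]])
  then have "((\<lambda>z. g (\<phi> z)) has_derivative cdot a) (at z)"
    by (simp add: a)
  from has_derivative_cdotD[OF this]
  show "hol_at (\<lambda>z. g (\<phi> z)) z"
    and "cdot (grad (\<lambda>z. g (\<phi> z)) z) h = cdot (grad g (\<phi> z)) (jac \<phi> z *v h)"
    and "grad (\<lambda>z. g (\<phi> z)) z $ j = (\<Sum>i\<in>UNIV. grad g (\<phi> z) $ i * grad (\<lambda>z. \<phi> z $ i) z $ j)"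
    using jac_works(2)[OF \<phi>] by (simp_all only: a) (simp add: a_def)
qed

section \<open>Regularity of the gradient by the Cauchy formula\<close>

lemma hol_at_translate:
  assumes "hol_at f (z + a)"
  shows "hol_at (\<lambda>z. f (z + a)) z" "grad (\<lambda>z. f (z + a)) z = grad f (z + a)"
proof -
  have "((\<lambda>z. f (z + a)) has_derivative cdot (grad f (z + a))) (at z)"
    using hol_at_derivative[OF assms]
    by (intro has_derivative_compose[where f = "\<lambda>z. z + a" and f' = "\<lambda>h. h" and g = f])
       (auto intro!: derivative_eq_intros)
  then show "hol_at (\<lambda>z. f (z + a)) z" "grad (\<lambda>z. f (z + a)) z = grad f (z + a)"
    by (rule has_derivative_cdotD)+
qed

lemma hol_at_mult_const:
  assumes "hol_at f z"
  shows "hol_at (\<lambda>z. f z * c) z" "grad (\<lambda>z. f z * c) z = c *s grad f z"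
  using hol_at_mult[OF assms hol_at_const(1)[of c]] by simp_all

text \<open>The origin of the radii \<open>d\<close> and \<open>2 * d\<close> below: one circle
  radius \<open>d\<close> serves all centres in the small ball, and all these circles stay in the
  large one.\<close>

lemma circle_param_in_ball:
  fixes z :: "complex^'a"
  assumes "z \<in> ball z0 d" "cmod \<zeta> \<le> d"
  shows "z + \<zeta> *s axis i 1 \<in> ball z0 (2 * d)"
proof -
  have "\<zeta> *s axis i (1::complex) = axis i \<zeta>"
    by (simp add: vec_eq_iff axis_def)
  then have "norm (\<zeta> *s axis i (1::complex)) \<le> d"
    using assms by (simp add: norm_vec_def L2_set_def axis_def if_distrib[of cmod] if_distrib[of "\<lambda>x. x^2"] cong: if_cong)
  moreover have "norm (z - z0) < d"
    using assms by (simp add: dist_norm norm_minus_commute)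
  ultimately have "norm ((z - z0) + \<zeta> *s axis i 1) < 2 * d"
    using norm_triangle_ineq[of "z - z0" "\<zeta> *s axis i 1"] by linarith
  then show ?thesis
    by (simp add: dist_norm norm_minus_commute algebra_simps)
qed

text \<open>With the radius of the circle fixed while \<open>z\<close> varies, the gradient becomes
  an integral with parameter whose integrand involves only values of \<open>f\<close>. Its
  dependence on \<open>z\<close> can thus be studied without prior knowledge of the
  gradient.\<close>

lemma grad_cauchy:
  fixes f :: "complex^'a \<Rightarrow> complex"
  assumes "\<And>z. z \<in> ball z0 (2 * d) \<Longrightarrow> hol_at f z" "0 < d" "z \<in> ball z0 d"
  shows "grad f z $ i = integral {0..1} (\<lambda>t. f (z + (d * exp (2 * of_real pi * \<i> * of_real t)) *s axis i 1)
      * (1 / (d * exp (2 * of_real pi * \<i> * of_real t))))"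
  using cauchy_directional_derivative[of d f z "axis i 1"] assms circle_param_in_ball[OF assms(3)]
  by simp

lemma continuous_on_circle_param:
  "continuous_on (A \<times> {0..1::real}) (\<lambda>(z, t). z + (d * exp (2 * of_real pi * \<i> * of_real t)) *s (w :: complex^'a))"
  "0 < d \<Longrightarrow> continuous_on (A \<times> {0..1::real}) (\<lambda>(z :: complex^'a, t). 1 / (complex_of_real d * exp (2 * of_real pi * \<i> * of_real t)))"
  unfolding split_beta vector_scalar_mult_def
  by (intro continuous_intros; simp)+

lemma continuous_on_circle_comp:
  fixes f :: "complex^'a \<Rightarrow> complex"
  assumes "continuous_on (ball z0 (2 * d)) f" "0 < d"
  shows "continuous_on (ball z0 d \<times> {0..1})
    (\<lambda>(z, t). f (z + (d * exp (2 * of_real pi * \<i> * of_real t)) *s axis i 1) * (1 / (d * exp (2 * of_real pi * \<i> * of_real t))))"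
proof -
  have "(\<lambda>(z, t). z + (d * exp (2 * of_real pi * \<i> * of_real t)) *s axis i 1) ` (ball z0 d \<times> {0..1::real}) \<subseteq> ball z0 (2 * d)"
    using circle_param_in_ball[of _ z0 d] assms(2) by (auto simp: norm_mult simp del: mem_ball)
  from continuous_on_mult[OF continuous_on_compose2[OF assms(1) continuous_on_circle_param(1) this]
      continuous_on_circle_param(2)[OF assms(2)]]
  show ?thesis by (simp add: split_beta)
qed

text \<open>Continuity of the parameter integral in \<open>grad_cauchy\<close>, on a ball whose
  double still lies in \<open>S\<close>.\<close>

lemma continuous_on_grad:
  fixes f :: "complex^'a \<Rightarrow> complex"
  assumes "open S" "\<And>z. z \<in> S \<Longrightarrow> hol_at f z"
  shows "continuous_on S (\<lambda>z. grad f z $ i)"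
proof (intro continuous_at_imp_continuous_on ballI)
  fix z0 assume "z0 \<in> S"
  then obtain d where d: "0 < d" "ball z0 (2 * d) \<subseteq> S"
    using assms(1) unfolding open_contains_ball by (metis field_sum_of_halves half_gt_zero mult_2)
  have "continuous_on (ball z0 d) (\<lambda>z. grad f z $ i)"
  proof (rule continuous_on_eq)
    show "continuous_on (ball z0 d) (\<lambda>z. integral (cbox 0 1) (\<lambda>t. f (z + (d * exp (2 * of_real pi * \<i> * of_real t)) *s axis i 1)
      * (1 / (d * exp (2 * of_real pi * \<i> * of_real t)))))"
      using d assms(2)
      by (intro integral_continuous_on_param, unfold box_real)
         (intro continuous_on_circle_comp hol_at_continuous_on, auto)
    fix z assume "z \<in> ball z0 d"
    then have "grad f z $ i = integral {0..1} (\<lambda>t. f (z + (d * exp (2 * of_real pi * \<i> * of_real t)) *s axis i 1)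
      * (1 / (d * exp (2 * of_real pi * \<i> * of_real t))))"
      using d assms(2) by (intro grad_cauchy) auto
    then show "integral (cbox 0 1) (\<lambda>t. f (z + (d * exp (2 * of_real pi * \<i> * of_real t)) *s axis i 1)
      * (1 / (d * exp (2 * of_real pi * \<i> * of_real t)))) = grad f z $ i"
      by (simp only: box_real)
  qed
  then show "isCont (\<lambda>z. grad f z $ i) z0"
    using d(1) by (simp add: continuous_on_eq_continuous_at)
qed

text \<open>\<open>grad_cauchy\<close> is differentiated under the integral sign, which is
  legitimate because the gradient is already known to be continuous. The result has the shape of a
  Cauchy formula again, with a partial derivative of \<open>f\<close> in place of
  \<open>f\<close>.\<close>

lemma grad_of_grad:
  fixes f :: "complex^'a \<Rightarrow> complex"
  assumes d: "0 < d" and hol: "\<And>x. x \<in> ball z (2 * d) \<Longrightarrow> hol_at f x"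
  shows "hol_at (\<lambda>z. grad f z $ i) z"
    and "grad (\<lambda>z. grad f z $ i) z $ j =
      integral {0..1} (\<lambda>t. grad f (z + (d * exp (2 * of_real pi * \<i> * of_real t)) *s axis i 1) $ j
        / (d * exp (2 * of_real pi * \<i> * of_real t)))"
proof -
  define e :: "real \<Rightarrow> complex" where "e t = d * exp (2 * of_real pi * \<i> * of_real t)" for t
  define F where "F x t = f (x + e t *s axis i 1) * (1 / e t)" for x t
  have mem: "x + e t *s axis i 1 \<in> ball z (2 * d)" if "x \<in> ball z d" for x t
    using circle_param_in_ball[OF that, of "e t" i] d by (simp add: e_def norm_mult del: mem_ball)
  have hF: "hol_at (\<lambda>x. F x t) x" "grad (\<lambda>x. F x t) x $ j = grad f (x + e t *s axis i 1) $ j * (1 / e t)"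
    if "x \<in> ball z d" for x t j
    unfolding F_def hol_at_mult_const(2)[OF hol_at_translate(1)[OF hol[OF mem[OF that]]]]
      hol_at_translate(2)[OF hol[OF mem[OF that]]]
    by (rule hol_at_mult_const hol_at_translate hol mem that | simp)+
  have cF: "continuous_on (ball z d \<times> {0..1}) (\<lambda>(x, t). F x t)"
    unfolding F_def e_def
    by (rule continuous_on_circle_comp[OF hol_at_continuous_on[OF hol] d])
  have cgF: "continuous_on (ball z d \<times> {0..1}) (\<lambda>(x, t). grad (\<lambda>x. F x t) x $ j)" for j
    by (rule continuous_on_eq[OF continuous_on_circle_comp[OF continuous_on_grad[OF open_ball hol] d, of z i j]])
       (auto simp: hF e_def)
  have gF: "grad f x $ i = integral {0..1} (F x)" if "x \<in> ball z d" for x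
    unfolding F_def e_def by (rule grad_cauchy[OF hol d that])
  have zb: "z \<in> ball z d" using d by auto
  note * = hol_at_integral[OF hF(1) cF cgF zb]
  note ** = hol_at_cong_open[OF open_ball zb, of "\<lambda>x. integral {0..1} (F x)" "\<lambda>x. grad f x $ i",
    OF gF[symmetric] *(1)]
  show "hol_at (\<lambda>z. grad f z $ i) z" by (rule **(1))
  show "grad (\<lambda>z. grad f z $ i) z $ j =
      integral {0..1} (\<lambda>t. grad f (z + (d * exp (2 * of_real pi * \<i> * of_real t)) *s axis i 1) $ j
        / (d * exp (2 * of_real pi * \<i> * of_real t)))"
    using **(2) *(2)[of j] hF(2)[OF zb] by (simp add: e_def)
qed

lemma hol_at_grad:
  assumes "open S" "\<And>z. z \<in> S \<Longrightarrow> hol_at f z" "z \<in> S"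
  shows "hol_at (\<lambda>z. grad f z $ i) z"
proof -
  obtain d where "0 < d" "ball z (2 * d) \<subseteq> S"
    using assms(1,3) unfolding open_contains_ball by (metis field_sum_of_halves half_gt_zero mult_2)
  then show ?thesis
    using grad_of_grad(1)[of d z f i] assms(2) by blast
qed

text \<open>The integral that \<open>grad_of_grad\<close> gives for the \<open>j\<close>-th
  derivative of the \<open>i\<close>-th partial derivative runs over circles in direction
  \<open>i\<close> and has the \<open>j\<close>-th partial derivative as integrand. It is therefore
  also the Cauchy formula for the \<open>i\<close>-th derivative of the \<open>j\<close>-th partial
  derivative.\<close>

lemma grad_grad_commute:
  assumes S: "open S" and hol: "\<And>z. z \<in> S \<Longrightarrow> hol_at f z" and z: "z \<in> S"
  shows "grad (\<lambda>z. grad f z $ i) z $ j = grad (\<lambda>z. grad f z $ j) z $ i"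
proof -
  obtain d where d: "0 < d" "ball z (2 * d) \<subseteq> S"
    using assms(1,3) unfolding open_contains_ball by (metis field_sum_of_halves half_gt_zero mult_2)
  have "grad (\<lambda>z. grad f z $ i) z $ j = integral {0..1} (\<lambda>t. grad f (z + (d * exp (2 * of_real pi * \<i> * of_real t)) *s axis i 1) $ j
        / (d * exp (2 * of_real pi * \<i> * of_real t)))"
    by (rule grad_of_grad(2)) (use d hol in auto)
  also have "\<dots> = cdot (grad (\<lambda>x. grad f x $ j) z) (axis i 1)"
  proof (rule cauchy_directional_derivative[symmetric, OF _ d(1)])
    fix \<zeta> assume "cmod \<zeta> \<le> d"
    then have "z + \<zeta> *s axis i 1 \<in> S" using circle_param_in_ball[of z z d] d by auto
    then show "hol_at (\<lambda>x. grad f x $ j) (z + \<zeta> *s axis i 1)"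
      using hol_at_grad[OF S hol] by blast
  qed
  finally show ?thesis by simp
qed

text \<open>Hadamard's lemma. The map \<open>\<phi> z t\<close> multiplies the \<open>k\<close>-th
  coordinate by \<open>t\<close>, so the derivative of \<open>g (\<phi> z t)\<close> in
  \<open>t\<close> is \<open>z $ k\<close> times a partial derivative of \<open>g\<close>;
  integrating the latter over \<open>t\<close> gives the quotient, on the hyperplane as
  well.\<close>

lemma divide_by_coordinate:
  fixes g :: "complex^'a \<Rightarrow> complex"
  assumes hol: "\<And>z. z \<in> ball z0 d \<Longrightarrow> hol_at g z" and z0: "z0 $ k = 0"
    and g0: "\<And>z. z \<in> ball z0 d \<Longrightarrow> z $ k = 0 \<Longrightarrow> g z = 0"
  obtains f where "\<And>z. z \<in> ball z0 d \<Longrightarrow> hol_at f z" "\<And>z. z \<in> ball z0 d \<Longrightarrow> g z = z $ k * f z"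
proof -
  define \<phi> :: "complex^'a \<Rightarrow> real \<Rightarrow> complex^'a" where "\<phi> z t = (\<chi> i. if i = k then of_real t * z $ k else z $ i)" for z t
  define F where "F z t = grad g (\<phi> z t) $ k" for z t
  define f where "f z = integral {0..1} (F z)" for z
  \<comment> \<open>Because \<open>z0 $ k = 0\<close>, shrinking the \<open>k\<close>-th coordinate
    does not increase the distance to \<open>z0\<close>.\<close>
  have mem: "\<phi> z t \<in> ball z0 d" if "z \<in> ball z0 d" "t \<in> {0..1}" for z t
  proof -
    have "cmod ((\<phi> z t - z0) $ i) \<le> cmod ((z - z0) $ i)" for i
      using that(2) z0 by (simp add: \<phi>_def norm_mult mult_left_le_one_le)
    then have "norm (\<phi> z t - z0) \<le> norm (z - z0)" by (rule norm_le_componentwise_cart)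
    then show ?thesis using that(1) by (simp add: dist_norm norm_minus_commute)
  qed
  have c\<phi>: "continuous_on (ball z0 d \<times> {0..1}) (\<lambda>(z, t). \<phi> z t)"
    unfolding split_beta \<phi>_def
  proof (rule continuous_on_vec_lambda)
    fix i show "continuous_on (ball z0 d \<times> {0..1}) (\<lambda>x. if i = k then of_real (snd x) * fst x $ k else fst x $ i)"
      by (cases "i = k") (auto intro!: continuous_intros)
  qed
  have h\<phi>: "hol_at (\<lambda>z. \<phi> z t $ i) z" "grad (\<lambda>z. \<phi> z t $ i) z = (if i = k then of_real t else 1) *s axis i 1" for z t i
    using hol_at_mult_const[OF hol_at_component(1)[of k z], of "of_real t"] by (cases "i = k"; simp add: \<phi>_def mult.commute)+
  have hg: "hol_at (\<lambda>z. grad g z $ k) z" if "z \<in> ball z0 d" for z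
    by (rule hol_at_grad[OF open_ball hol that])
  have hF: "hol_at (\<lambda>z. F z t) z"
    "grad (\<lambda>z. F z t) z $ j = grad (\<lambda>z. grad g z $ k) (\<phi> z t) $ j * (if j = k then of_real t else 1)"
    if "z \<in> ball z0 d" "t \<in> {0..1}" for z t j
  proof -
    show "hol_at (\<lambda>z. F z t) z"
      unfolding F_def by (rule hol_at_compose(1)[OF hg[OF mem[OF that]] h\<phi>(1)])
    have "grad (\<lambda>z. F z t) z $ j = (\<Sum>i\<in>UNIV. grad (\<lambda>z. grad g z $ k) (\<phi> z t) $ i * ((if i = k then of_real t else 1) *s axis i 1) $ j)"
      unfolding F_def hol_at_compose(3)[OF hg[OF mem[OF that]] h\<phi>(1)] h\<phi>(2) ..
    also have "\<dots> = (\<Sum>i\<in>UNIV. if i = j then grad (\<lambda>z. grad g z $ k) (\<phi> z t) $ j * (if j = k then of_real t else 1) else 0)"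
      by (rule sum.cong) (auto simp: axis_def)
    finally show "grad (\<lambda>z. F z t) z $ j = grad (\<lambda>z. grad g z $ k) (\<phi> z t) $ j * (if j = k then of_real t else 1)"
      by simp
  qed
  have im: "(\<lambda>(z, t). \<phi> z t) ` (ball z0 d \<times> {0..1}) \<subseteq> ball z0 d"
    using mem by auto
  have cF: "continuous_on (ball z0 d \<times> {0..1}) (\<lambda>(z, t). F z t)"
    using continuous_on_compose2[OF continuous_on_grad[OF open_ball hol] c\<phi> im]
    by (simp add: F_def split_beta)
  have "continuous_on (ball z0 d \<times> {0..1::real}) (\<lambda>x. (if j = k then complex_of_real (snd x) else 1))" for j
    by (cases "j = k") (auto intro!: continuous_intros)
  then have cgF: "continuous_on (ball z0 d \<times> {0..1}) (\<lambda>(z, t). grad (\<lambda>z. F z t) z $ j)" for j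
    using continuous_on_mult[OF continuous_on_compose2[OF continuous_on_grad[OF open_ball hg] c\<phi> im]]
    by (subst continuous_on_cong[OF refl, where g = "\<lambda>(z, t). grad (\<lambda>z. grad g z $ k) (\<phi> z t) $ j * (if j = k then of_real t else 1)"])
       (auto simp: hF split_beta)
  have "hol_at f z" if "z \<in> ball z0 d" for z
    unfolding f_def by (rule hol_at_integral(1)[OF hF(1) cF cgF that])
  moreover have "g z = z $ k * f z" if z: "z \<in> ball z0 d" for z
  proof -
    \<comment> \<open>The path starts on the hyperplane, where \<open>g\<close> vanishes, and ends
      at \<open>z\<close>.\<close>
    have "((\<lambda>t. g (\<phi> z t)) has_vector_derivative z $ k * F z t) (at t within {0..1})" if "t \<in> {0..1}" for t
    proof -
      have "(\<phi> z has_derivative (\<lambda>h. h *\<^sub>R axis k (z $ k))) (at t)"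
        unfolding has_derivative_vec_iff[of "\<phi> z"]
      proof
        fix i
        show "((\<lambda>t. \<phi> z t $ i) has_derivative (\<lambda>h. (h *\<^sub>R axis k (z $ k)) $ i)) (at t)"
          using bounded_linear_imp_has_derivative[OF bounded_linear_scaleR_left, of "z $ k"]
          by (cases "i = k") (simp_all add: \<phi>_def axis_def flip: scaleR_conv_of_real)
      qed
      from has_derivative_compose[OF this hol_at_derivative[OF hol[OF mem[OF z that]]]]
      have "((\<lambda>t. g (\<phi> z t)) has_derivative (\<lambda>h. h *\<^sub>R (z $ k * F z t))) (at t)"
      proof (rule has_derivative_eq_rhs)
        have "cdot a (h *\<^sub>R axis k (z $ k)) = (\<Sum>i\<in>UNIV. if i = k then h *\<^sub>R (z $ k * a $ k) else 0)" for a h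
          unfolding cdot_def by (rule sum.cong) (auto simp: axis_def)
        then show "(\<lambda>h. cdot (grad g (\<phi> z t)) (h *\<^sub>R axis k (z $ k))) = (\<lambda>h. h *\<^sub>R (z $ k * F z t))"
          by (simp add: F_def)
      qed
      then show ?thesis
        by (simp add: has_vector_derivative_def has_derivative_at_withinI)
    qed
    from fundamental_theorem_of_calculus[OF zero_le_one this]
    have "((\<lambda>t. z $ k * F z t) has_integral g (\<phi> z 1) - g (\<phi> z 0)) {0..1}" by simp
    moreover have "\<phi> z 1 = z" by (simp add: \<phi>_def vec_eq_iff)
    moreover have "g (\<phi> z 0) = 0" using g0[OF mem[OF z, of 0]] by (simp add: \<phi>_def)
    ultimately show ?thesis by (simp add: f_def has_integral_iff)
  qed
  ultimately show ?thesis using that by blast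
qed

text \<open>Dividing each \<open>g i\<close> by the coordinate \<open>z $ k\<close> leaves a unit near \<open>z0\<close>, and units have
  holomorphic roots.\<close>

lemma holomorphic_geometric_mean:
  fixes g :: "'i \<Rightarrow> complex^'a \<Rightarrow> complex"
  assumes I: "finite I" "I \<noteq> {}" and S: "open S" "z0 \<in> S" and z0: "z0 $ k = 0"
    and hol: "\<And>i z. i \<in> I \<Longrightarrow> z \<in> S \<Longrightarrow> hol_at (g i) z"
    and g0: "\<And>i z. i \<in> I \<Longrightarrow> z \<in> S \<Longrightarrow> z $ k = 0 \<Longrightarrow> g i z = 0"
    and dg: "\<And>i. i \<in> I \<Longrightarrow> grad (g i) z0 \<noteq> 0"
  shows "\<exists>B u. open B \<and> z0 \<in> B \<and> B \<subseteq> S \<and>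
    (\<forall>z\<in>B. hol_at u z \<and> grad u z \<noteq> 0 \<and> cmod (u z) ^ card I = (\<Prod>i\<in>I. cmod (g i z)) \<and>
      (u z = 0 \<longleftrightarrow> z $ k = 0))"
proof -
  obtain d where d: "0 < d" "ball z0 d \<subseteq> S"
    using S open_contains_ball by blast
  have "\<exists>f. (\<forall>z\<in>ball z0 d. hol_at f z \<and> g i z = z $ k * f z)" if "i \<in> I" for i
    using divide_by_coordinate[of z0 d "g i" k] hol[OF that] g0[OF that] z0 d by (metis subsetD)
  then obtain f where f: "\<And>i z. i \<in> I \<Longrightarrow> z \<in> ball z0 d \<Longrightarrow> hol_at (f i) z"
    "\<And>i z. i \<in> I \<Longrightarrow> z \<in> ball z0 d \<Longrightarrow> g i z = z $ k * f i z"
    by metis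
  have zd: "z0 \<in> ball z0 d" using d by simp
  \<comment> \<open>At \<open>z0\<close> the product rule leaves only
    \<open>f i z0 *s axis k 1\<close>, since \<open>z0 $ k = 0\<close>; a nonzero gradient of
    \<open>g i\<close> thus makes the quotient a unit.\<close>
  have f0: "f i z0 \<noteq> 0" if "i \<in> I" for i
  proof
    assume 0: "f i z0 = 0"
    have "grad (g i) z0 = grad (\<lambda>z. z $ k * f i z) z0"
      by (rule hol_at_cong_open(2)[OF open_ball zd])
         (use f that zd hol_at_mult(1)[OF hol_at_component(1) f(1)[OF that zd]] in auto)
    also have "\<dots> = 0"
      using hol_at_mult(2)[OF hol_at_component(1) f(1)[OF that zd], of k] 0 z0 by simp
    finally show False using dg[OF that] by simp
  qed
  \<comment> \<open>On this set every \<open>f i z / f i z0\<close> has distance less than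
    \<open>1\<close> from \<open>1\<close>, hence positive real part, away from the cut of
    \<open>Ln\<close>.\<close>
  define B1 where "B1 = ball z0 d \<inter> (\<Inter>i\<in>I. ball z0 d \<inter> f i -` ball (f i z0) (cmod (f i z0)))"
  have "open (ball z0 d \<inter> f i -` ball (f i z0) (cmod (f i z0)))" if "i \<in> I" for i
    by (rule continuous_open_preimage[OF hol_at_continuous_on[OF f(1)[OF that]] open_ball open_ball])
  then have "open B1"
    unfolding B1_def using I(1) by (intro open_Int open_ball open_INT) auto
  then have B1: "open B1" "z0 \<in> B1" "B1 \<subseteq> ball z0 d"
    using f0 zd by (auto simp: B1_def)
  define q where "q i z = f i z / f i z0" for i z
  have q: "q i z \<notin> \<real>\<^sub>\<le>\<^sub>0" if "z \<in> B1" "i \<in> I" for i z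
  proof -
    have "cmod (f i z0 - f i z) < cmod (f i z0)"
    proof -
      have "f i z \<in> ball (f i z0) (cmod (f i z0))"
        using that unfolding B1_def by blast
      then show ?thesis by (simp add: dist_norm)
    qed
    moreover have "1 - q i z = (f i z0 - f i z) / f i z0"
      using f0[OF that(2)] by (simp add: q_def diff_divide_distrib)
    ultimately have "cmod (1 - q i z) < 1"
      using f0[OF that(2)] by (simp add: norm_divide)
    then have "0 < Re (q i z)"
      using abs_Re_le_cmod[of "1 - q i z"] by simp
    then show ?thesis by (auto simp: complex_nonpos_Reals_iff)
  qed
  \<comment> \<open>A logarithm of the geometric mean of the units. The constant
    \<open>Ln (f i z0)\<close> undoes the normalisation that keeps \<open>q i\<close> off the
    cut.\<close>
  define s where "s z = (\<Sum>i\<in>I. Ln (q i z) + Ln (f i z0)) * (1 / of_nat (card I))" for z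
  \<comment> \<open>A single factor \<open>z $ k\<close>: the \<open>card I\<close>-th power has the
    order of the product of all \<open>g i\<close>, while \<open>u\<close> itself has a simple
    zero.\<close>
  define u where "u z = z $ k * exp (s z)" for z
  have hs: "hol_at s z" if "z \<in> B1" for z
    unfolding s_def
  proof (intro hol_at_mult_const(1) hol_at_sum)
    fix i assume "i \<in> I"
    then have "hol_at (q i) z"
      unfolding q_def divide_inverse using that B1 f(1) by (intro hol_at_mult_const) auto
    then show "hol_at (\<lambda>z. Ln (q i z) + Ln (f i z0)) z"
      using hol_at_field(1)[where f = "q i" and \<phi> = Ln, OF _ has_field_derivative_Ln[OF q[OF that \<open>i \<in> I\<close>]]]
      by (intro hol_at_add(1) hol_at_const(1))
  qed
  have he: "hol_at (\<lambda>z. exp (s z)) z" if "z \<in> B1" for z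
    by (rule hol_at_field(1)[OF hs[OF that] DERIV_exp])
  have hu: "hol_at u z" if "z \<in> B1" for z
    unfolding u_def by (rule hol_at_mult(1)[OF hol_at_component(1) he[OF that]])
  have "grad u z0 = exp (s z0) *s axis k 1"
    unfolding u_def hol_at_mult(2)[OF hol_at_component(1) he[OF B1(2)]] using z0 by simp
  then have gu: "grad u z0 $ k \<noteq> 0" by simp
  define B where "B = B1 \<inter> (\<lambda>z. grad u z $ k) -` (- {0})"
  have "open B"
    unfolding B_def by (rule continuous_open_preimage[OF continuous_on_grad[OF B1(1) hu] B1(1)]) auto
  moreover have "z0 \<in> B" using gu B1 by (simp add: B_def)
  moreover have "B \<subseteq> S" using B1 d by (auto simp: B_def)
  moreover have "hol_at u z" "grad u z \<noteq> 0" if "z \<in> B" for z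
    using that hu by (auto simp: B_def)
  moreover have "cmod (u z) ^ card I = (\<Prod>i\<in>I. cmod (g i z))" if "z \<in> B" for z
  proof -
    have z: "z \<in> B1" "z \<in> ball z0 d" using that B1 by (auto simp: B_def)
    have "exp (s z) ^ card I = exp (of_nat (card I) * s z)"
      by (simp add: exp_of_nat_mult)
    also have "of_nat (card I) * s z = (\<Sum>i\<in>I. Ln (q i z) + Ln (f i z0))"
      using I by (simp add: s_def)
    also have "exp \<dots> = (\<Prod>i\<in>I. f i z)"
      unfolding exp_sum[OF I(1)]
    proof (rule prod.cong)
      fix i assume i: "i \<in> I"
      have "q i z \<noteq> 0" using q[OF z(1) i] by auto
      then show "exp (Ln (q i z) + Ln (f i z0)) = f i z"
        using f0[OF i] by (simp add: exp_add) (simp add: q_def)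
    qed simp
    finally have "u z ^ card I = (\<Prod>i\<in>I. g i z)"
      using f(2)[OF _ z(2)] by (simp add: u_def power_mult_distrib prod.distrib)
    then show ?thesis by (metis norm_power prod_norm)
  qed
  moreover have "u z = 0 \<longleftrightarrow> z $ k = 0" for z by (simp add: u_def)
  ultimately show ?thesis
    by (intro exI[of _ B] exI[of _ u]) simp
qed

section \<open>Kernels of differentials\<close>

text \<open>Only derivatives at the point \<open>z\<close> are compared. If \<open>g z\<close> is
  nonzero, the real derivatives of the squared moduli agree and determine the kernel. At a common
  zero these derivatives carry no information, and the growth rates of the moduli along the line in
  direction \<open>w\<close> take their place.\<close>

lemma vanishing_grad_of_equal_modulus:
  fixes f g :: "complex^'a \<Rightarrow> complex"
  assumes f: "hol_at f z" and g: "hol_at g z" and eq: "eventually (\<lambda>x. cmod (f x) = cmod (g x)) (nhds z)"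
    and 0: "cdot (grad f z) w = 0"
  shows "cdot (grad g z) w = 0"
proof (cases "g z = 0")
  case False
  have ip: "((\<lambda>x. f x \<bullet> f x) has_derivative (\<lambda>h. 2 * (f z \<bullet> cdot (grad f z) h))) (at z)" if "hol_at f z" for f
    using has_derivative_inner[OF hol_at_derivative[OF that] hol_at_derivative[OF that]]
    by (rule has_derivative_eq_rhs) (simp add: inner_commute fun_eq_iff)
  have e: "eventually (\<lambda>x. f x \<bullet> f x = g x \<bullet> g x) (nhds z)"
    using eq by (simp add: dot_square_norm)
  have "eventually (\<lambda>x. f x \<bullet> f x = g x \<bullet> g x) (at z)"
    unfolding eventually_at_filter using e by (rule eventually_mono) simp
  then have "((\<lambda>x. g x \<bullet> g x) has_derivative (\<lambda>h. 2 * (f z \<bullet> cdot (grad f z) h))) (at z)"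
    using has_derivative_transform_eventually[OF ip[OF f], of "\<lambda>x. g x \<bullet> g x"]
      eventually_nhds_x_imp_x[OF e] by simp
  then have "(\<lambda>h. 2 * (f z \<bullet> cdot (grad f z) h)) = (\<lambda>h. 2 * (g z \<bullet> cdot (grad g z) h))"
    using ip[OF g] has_derivative_unique by blast
  \<comment> \<open>By complex linearity \<open>w\<close> may be replaced by \<open>c *s w\<close>,
    so the real equation holds for all complex multiples. The \<open>c\<close> chosen below turns
    the inner product into \<open>g z \<bullet> g z\<close>.\<close>
  then have *: "g z \<bullet> (c * cdot (grad g z) w) = 0" for c
    using 0 by (auto simp: cdot_scale dest: fun_cong[of _ _ "c *s w"])
  show ?thesis
  proof (rule ccontr)
    assume "cdot (grad g z) w \<noteq> 0"
    then show False using *[of "g z / cdot (grad g z) w"] False by simp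
  qed
next
  case True
  then have "f z = 0" using eventually_nhds_x_imp_x[OF eq] by simp
  \<comment> \<open>At a zero the size of the directional derivative is a limit of difference
    quotients that depends on the modulus of \<open>h\<close> alone.\<close>
  have lim: "((\<lambda>\<zeta>. cmod (h (z + \<zeta> *s w)) / cmod \<zeta>) \<longlongrightarrow> cmod (cdot (grad h z) w)) (at 0)"
    if "hol_at h z" "h z = 0" for h
    using tendsto_norm[OF hol_at_line[of h z 0 w, unfolded DERIV_def]] that by (simp add: norm_divide)
  have "((\<lambda>\<zeta>::complex. z + \<zeta> *s w) \<longlongrightarrow> z + 0 *s w) (at 0)"
    unfolding vector_scalar_mult_def by (intro tendsto_intros)
  then have "eventually (\<lambda>\<zeta>. cmod (f (z + \<zeta> *s w)) = cmod (g (z + \<zeta> *s w))) (at (0::complex))"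
    using eventually_compose_filterlim[OF eq] by simp
  then have "eventually (\<lambda>\<zeta>. cmod (f (z + \<zeta> *s w)) / cmod \<zeta> = cmod (g (z + \<zeta> *s w)) / cmod \<zeta>) (at 0)"
    by eventually_elim simp
  from tendsto_cong[OF this] lim[OF f \<open>f z = 0\<close>]
  have "((\<lambda>\<zeta>. cmod (g (z + \<zeta> *s w)) / cmod \<zeta>) \<longlongrightarrow> 0) (at 0)"
    using 0 by simp
  with lim[OF g True] show ?thesis
    using tendsto_unique[OF trivial_limit_at] by fastforce
qed

text \<open>The vectors \<open>E i\<close> come from solving \<open>cdot a w = 0\<close> for the
  coordinate \<open>j\<close>. Their entries are constants and quotients with denominator
  \<open>a $ j\<close>, which is what later turns them into a holomorphic frame.\<close>

lemma
  fixes a :: "complex^'a"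
  assumes j: "a $ j \<noteq> 0"
  defines "E \<equiv> \<lambda>i. axis i 1 - (a $ i / a $ j) *s axis j 1"
  shows kernel_eq_span: "{w. cdot a w = 0} = vec.span (E ` (UNIV - {j}))"
    and dim_kernel: "vec.dim {w. cdot a w = 0} = CARD('a) - 1"
proof -
  have E0: "cdot a (E i) = 0" for i
    using j by (simp add: E_def cdot_diff cdot_scale)
  have sub: "vec.subspace {w. cdot a w = 0}"
    by (auto simp: vec.subspace_def cdot_add cdot_scale)
  \<comment> \<open>The remainder of the expansion in the \<open>E i\<close> is proportional to
    \<open>cdot a w\<close>. It vanishes on the kernel, and in general the single vector
    \<open>axis j 1\<close> completes the \<open>E i\<close> to a spanning set, whence the
    dimension.\<close>
  have exp: "w = (\<Sum>i\<in>UNIV - {j}. w $ i *s E i) + (cdot a w / a $ j) *s axis j 1" for w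
  proof -
    have "(\<Sum>i\<in>UNIV - {j}. w $ i *s E i) + (cdot a w / a $ j) *s axis j 1 =
      (\<Sum>i\<in>UNIV - {j}. w $ i *s axis i 1) + ((cdot a w - (\<Sum>i\<in>UNIV - {j}. a $ i * w $ i)) / a $ j) *s axis j 1"
      by (simp add: E_def vec.scale_right_diff_distrib sum_subtractf vec.scale_sum_left[symmetric]
          diff_divide_distrib sum_divide_distrib vec.scale_left_diff_distrib mult.commute)
    also have "cdot a w - (\<Sum>i\<in>UNIV - {j}. a $ i * w $ i) = a $ j * w $ j"
      unfolding cdot_def by (subst sum.remove[of UNIV j]) auto
    also have "(\<Sum>i\<in>UNIV - {j}. w $ i *s axis i 1) + (a $ j * w $ j / a $ j) *s axis j 1 = (\<Sum>i\<in>UNIV. w $ i *s axis i 1)"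
      using j by (subst sum.remove[of UNIV j]) auto
    also have "\<dots> = w" by (rule basis_expansion)
    finally show ?thesis by simp
  qed
  show span: "{w. cdot a w = 0} = vec.span (E ` (UNIV - {j}))"
  proof
    show "vec.span (E ` (UNIV - {j})) \<subseteq> {w. cdot a w = 0}"
      by (rule vec.span_minimal[OF _ sub]) (auto simp: E0)
    show "{w. cdot a w = 0} \<subseteq> vec.span (E ` (UNIV - {j}))"
    proof
      fix w assume "w \<in> {w. cdot a w = 0}"
      then have "w = (\<Sum>i\<in>UNIV - {j}. w $ i *s E i)" using exp[of w] by simp
      then show "w \<in> vec.span (E ` (UNIV - {j}))"
        by (metis (no_types, lifting) image_eqI vec.span_base vec.span_scale vec.span_sum)
    qed
  qed
  have "vec.span (insert (axis j 1) (E ` (UNIV - {j}))) = UNIV"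
  proof -
    have "w \<in> vec.span (insert (axis j 1) (E ` (UNIV - {j})))" for w
      by (subst exp[of w]) (intro vec.span_add vec.span_sum vec.span_scale vec.span_base; auto)
    then show ?thesis by auto
  qed
  then have "vec.dim (insert (axis j 1) (E ` (UNIV - {j}))) = CARD('a)"
    by (metis vec.dim_span vec.dim_UNIV vec_dim_card)
  moreover have "axis j 1 \<notin> vec.span (E ` (UNIV - {j}))"
    using j by (simp flip: span)
  ultimately show "vec.dim {w. cdot a w = 0} = CARD('a) - 1"
    by (simp add: span vec.dim_span vec.dim_insert)
qed

section \<open>Holomorphic functions in charts\<close>

lemma is_chart_inj: "is_chart X c \<Longrightarrow> inj_on (snd c) (fst c)"
  using openin_subset[of X "fst c"] homeomorphic_imp_injective_map[of "subtopology X (fst c)" _ "snd c"]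
  by (auto simp: is_chart_def Int_absorb1)

lemma is_chart_inv [simp]: "is_chart X c \<Longrightarrow> x \<in> fst c \<Longrightarrow> chart_inv c (snd c x) = x"
  by (simp add: is_chart_inj)

lemma is_chart_open_image:
  assumes "is_chart X c" "openin X S" "S \<subseteq> fst c"
  shows "open (snd c ` S)"
proof -
  have h: "homeomorphic_map (subtopology X (fst c)) (top_of_set (snd c ` fst c)) (snd c)"
    and o: "open (snd c ` fst c)" "openin X (fst c)"
    using assms(1) by (auto simp: is_chart_def)
  have "openin (subtopology X (fst c)) S"
    using assms o by (simp add: openin_open_subtopology)
  then have "openin (top_of_set (snd c ` fst c)) (snd c ` S)"
    using homeomorphic_imp_open_map[OF h] open_map_def by blast
  then show ?thesis using o openin_open_eq by blast
qed

lemma is_chart_open_vimage: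
  assumes "is_chart X c" "open B"
  shows "openin X {x \<in> fst c. snd c x \<in> B}"
proof -
  have h: "continuous_map (subtopology X (fst c)) (top_of_set (snd c ` fst c)) (snd c)"
    and o: "openin X (fst c)"
    using assms(1) homeomorphic_imp_continuous_map by (auto simp: is_chart_def)
  have t: "topspace (subtopology X (fst c)) = fst c"
    using openin_subset[OF o] by auto
  have "openin (top_of_set (snd c ` fst c)) (snd c ` fst c \<inter> B)"
    using assms(2) by auto
  from openin_continuous_map_preimage[OF h this]
  have "openin (subtopology X (fst c)) {x \<in> fst c. snd c x \<in> snd c ` fst c \<inter> B}"
    unfolding t .
  moreover have "{x \<in> fst c. snd c x \<in> snd c ` fst c \<inter> B} = {x \<in> fst c. snd c x \<in> B}" by auto
  ultimately show ?thesis using o by (simp add: openin_open_subtopology)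
qed

text \<open>Weaker than \<open>complex_manifold\<close>, so that it passes to
  \<open>open_sub\<close> simply by restricting charts, also twice in a row.\<close>

definition charted :: "('a, 'n::finite) cspace \<Rightarrow> bool" where
  "charted M \<longleftrightarrow> (\<forall>c\<in>atlas M. is_chart (top_of M) c) \<and> (\<Union>c\<in>atlas M. fst c) = points M"

definition holo_at :: "('a, 'n::finite) cspace \<Rightarrow> ('a \<Rightarrow> complex) \<Rightarrow> 'a \<Rightarrow> bool" where
  "holo_at M f x \<longleftrightarrow> (\<forall>c\<in>atlas M. x \<in> fst c \<longrightarrow> hol_at (f \<circ> chart_inv c) (snd c x))"

lemma complex_manifold_charted: "complex_manifold M \<Longrightarrow> charted M"
  by (simp add: complex_manifold_def charted_def)

lemma chartsD: "c \<in> charts M \<Longrightarrow> is_chart (top_of M) c"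
  by (simp add: charts_def)

lemma atlas_subset_charts: "complex_manifold M \<Longrightarrow> atlas M \<subseteq> charts M"
  by (auto simp: complex_manifold_def charts_def)

lemma chart_domain_subset: "is_chart (top_of M) c \<Longrightarrow> fst c \<subseteq> points M"
  by (simp add: is_chart_def openin_subset)

lemma chart_at:
  assumes "charted M" "x \<in> points M"
  obtains c where "c \<in> atlas M" "x \<in> fst c" "is_chart (top_of M) c"
proof -
  have "x \<in> (\<Union>c\<in>atlas M. fst c)" using assms by (simp add: charted_def)
  then show ?thesis using that assms(1) unfolding charted_def by blast
qed

lemma hol_at_chart_cong:
  assumes "is_chart X c" "openin X T" "x \<in> T" "x \<in> fst c" "\<And>y. y \<in> T \<Longrightarrow> y \<in> fst c \<Longrightarrow> f y = g y"
    "hol_at (f \<circ> chart_inv c) (snd c x)"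
  shows "hol_at (g \<circ> chart_inv c) (snd c x)" "grad (g \<circ> chart_inv c) (snd c x) = grad (f \<circ> chart_inv c) (snd c x)"
proof -
  have "openin X (T \<inter> fst c)" using assms by (auto simp: is_chart_def)
  then have o: "open (snd c ` (T \<inter> fst c))" using assms(1) is_chart_open_image by blast
  have x: "snd c x \<in> snd c ` (T \<inter> fst c)" using assms by blast
  have e: "(f \<circ> chart_inv c) z = (g \<circ> chart_inv c) z" if "z \<in> snd c ` (T \<inter> fst c)" for z
    using that assms(1,5) by auto
  show "hol_at (g \<circ> chart_inv c) (snd c x)" "grad (g \<circ> chart_inv c) (snd c x) = grad (f \<circ> chart_inv c) (snd c x)"
    by (rule hol_at_cong_open[OF o x e assms(6)], assumption)+
qed

text \<open>\<open>F\<close> is controlled only on the neighborhood \<open>N\<close> of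
  \<open>x\<close>. This form also serves local sections, which are not continuous maps on the whole
  space.\<close>

lemma local_chart_chain_rule:
  assumes c: "is_chart X c" and d: "is_chart Y d"
    and N: "openin X N" "x \<in> N" "N \<subseteq> fst c" "F ` N \<subseteq> fst d"
    and u: "hol_at (u \<circ> chart_inv d) (snd d (F x))"
    and F': "\<And>i. hol_at (\<lambda>z. (snd d \<circ> F \<circ> chart_inv c) z $ i) (snd c x)"
  shows "hol_at (u \<circ> F \<circ> chart_inv c) (snd c x)"
    and "cdot (grad (u \<circ> F \<circ> chart_inv c) (snd c x)) w =
      cdot (grad (u \<circ> chart_inv d) (snd d (F x))) (jac (snd d \<circ> F \<circ> chart_inv c) (snd c x) *v w)"
proof -
  have S: "open (snd c ` N)" "snd c x \<in> snd c ` N"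
    using is_chart_open_image[OF c N(1,3)] N(2) by auto
  have f: "(u \<circ> chart_inv d) ((snd d \<circ> F \<circ> chart_inv c) z) = (u \<circ> F \<circ> chart_inv c) z" if "z \<in> snd c ` N" for z
  proof -
    obtain y where y: "y \<in> N" "z = snd c y" using \<open>z \<in> snd c ` N\<close> by blast
    then have "chart_inv c z = y" "F y \<in> fst d" using N is_chart_inv[OF c] by auto
    then show ?thesis using is_chart_inv[OF d] by simp
  qed
  have e: "(snd d \<circ> F \<circ> chart_inv c) (snd c x) = snd d (F x)"
    using N is_chart_inv[OF c, of x] by (simp add: subsetD)
  have h: "hol_at (u \<circ> chart_inv d) ((snd d \<circ> F \<circ> chart_inv c) (snd c x))"
    unfolding e by (rule u)
  note * = hol_at_compose[OF h F']
  note ** = hol_at_cong_open[OF S f *(1)]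
  show "hol_at (u \<circ> F \<circ> chart_inv c) (snd c x)"
    by (rule **(1))
  show "cdot (grad (u \<circ> F \<circ> chart_inv c) (snd c x)) w =
      cdot (grad (u \<circ> chart_inv d) (snd d (F x))) (jac (snd d \<circ> F \<circ> chart_inv c) (snd c x) *v w)"
    using **(2) *(2)[of w] unfolding e by (simp add: o_def)
qed

lemma chart_chain_rule:
  assumes c: "is_chart X c" and d: "is_chart Y d" and F: "continuous_map X Y F"
    and x: "x \<in> fst c" "F x \<in> fst d"
    and u: "hol_at (u \<circ> chart_inv d) (snd d (F x))"
    and F': "\<And>i. hol_at (\<lambda>z. (snd d \<circ> F \<circ> chart_inv c) z $ i) (snd c x)"
  shows "hol_at (u \<circ> F \<circ> chart_inv c) (snd c x)"
    and "cdot (grad (u \<circ> F \<circ> chart_inv c) (snd c x)) w =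
      cdot (grad (u \<circ> chart_inv d) (snd d (F x))) (jac (snd d \<circ> F \<circ> chart_inv c) (snd c x) *v w)"
proof -
  have fc: "openin X (fst c)" and fd: "openin Y (fst d)"
    using c d by (auto simp: is_chart_def)
  define N where "N = fst c \<inter> {y \<in> topspace X. F y \<in> fst d}"
  have N: "openin X N" "x \<in> N" "N \<subseteq> fst c" "F ` N \<subseteq> fst d"
    unfolding N_def using fc openin_continuous_map_preimage[OF F fd] openin_subset[OF fc] x by auto
  show "hol_at (u \<circ> F \<circ> chart_inv c) (snd c x)"
    and "cdot (grad (u \<circ> F \<circ> chart_inv c) (snd c x)) w =
      cdot (grad (u \<circ> chart_inv d) (snd d (F x))) (jac (snd d \<circ> F \<circ> chart_inv c) (snd c x) *v w)"
    by (rule local_chart_chain_rule[OF c d N u F'])+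
qed

section \<open>Pullbacks and independence of the chart\<close>

lemma holo_at_pullback:
  assumes M: "charted M" and N: "charted N" and F: "holo_map M N F" and x: "x \<in> points M"
    and u: "holo_at N u (F x)"
  shows "holo_at M (u \<circ> F) x"
  unfolding holo_at_def
proof (intro ballI impI)
  fix c assume c: "c \<in> atlas M" "x \<in> fst c"
  have cont: "continuous_map (top_of M) (top_of N) F" using F by (simp add: holo_map_def)
  then have "F x \<in> points N" using x by (meson continuous_map_def PiE funcset_mem)
  then obtain d where d: "d \<in> atlas N" "F x \<in> fst d" "is_chart (top_of N) d"
    using chart_at[OF N] by blast
  have "(snd d \<circ> F \<circ> chart_inv c) holo_on (snd c ` (fst c \<inter> F -` fst d))"
    using F c d by (simp add: holo_map_def)
  then have "hol_at (\<lambda>z. (snd d \<circ> F \<circ> chart_inv c) z $ i) (snd c x)" for i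
    using c d unfolding holo_on_iff by blast
  moreover have "is_chart (top_of M) c" using M c by (simp add: charted_def)
  ultimately show "hol_at (u \<circ> F \<circ> chart_inv c) (snd c x)"
    using chart_chain_rule(1)[OF _ d(3) cont c(2) d(2)] u d unfolding holo_at_def by blast
qed

lemma holo_map_id: "complex_manifold M \<Longrightarrow> holo_map M M (\<lambda>x. x)"
  by (auto simp: complex_manifold_def holo_map_def compatible_def o_def Int_def vimage_def conj_commute)

lemma holo_at_coordinate:
  assumes "d \<in> charts M" "x \<in> fst d"
  shows "holo_at M (\<lambda>y. snd d y $ i) x"
  unfolding holo_at_def
proof (intro ballI impI)
  fix c assume c: "c \<in> atlas M" "x \<in> fst c"
  then have "(snd d \<circ> chart_inv c) holo_on (snd c ` (fst d \<inter> fst c))"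
    using assms by (simp add: charts_def compatible_def)
  then show "hol_at ((\<lambda>y. snd d y $ i) \<circ> chart_inv c) (snd c x)"
    using assms c unfolding holo_on_iff o_def by blast
qed

text \<open>A chart of the maximal atlas is compatible with each atlas chart in both directions, so
  the chain rule for the identity map transports holomorphy either way.\<close>

lemma holo_at_in_chart:
  assumes M: "complex_manifold M" and c: "c \<in> charts M" "x \<in> fst c"
  shows "holo_at M f x \<longleftrightarrow> hol_at (f \<circ> chart_inv c) (snd c x)"
proof -
  have *: "hol_at (f \<circ> chart_inv c) (snd c x)"
    if c: "is_chart (top_of M) c" "x \<in> fst c" and d: "is_chart (top_of M) d" "x \<in> fst d"
      and cd: "(snd d \<circ> chart_inv c) holo_on (snd c ` (fst c \<inter> fst d))"
      and f: "hol_at (f \<circ> chart_inv d) (snd d x)" for c d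
  proof -
    have "hol_at (\<lambda>z. (snd d \<circ> (\<lambda>x. x) \<circ> chart_inv c) z $ i) (snd c x)" for i
      using cd c d unfolding holo_on_iff o_def by blast
    from chart_chain_rule(1)[OF c(1) d(1) continuous_map_id[unfolded id_def] c(2) d(2) f this]
    show ?thesis by (simp add: o_def)
  qed
  have "x \<in> points M" using c chartsD chart_domain_subset by blast
  then obtain d where d: "d \<in> atlas M" "x \<in> fst d" "is_chart (top_of M) d"
    using chart_at[OF complex_manifold_charted[OF M]] by blast
  have A: "is_chart (top_of M) e" if "e \<in> atlas M" for e
    using M that by (simp add: complex_manifold_def)
  have B: "compatible c e" if "e \<in> atlas M" for e
    using c that by (simp add: charts_def)
  show ?thesis
  proof
    assume "holo_at M f x"
    then show "hol_at (f \<circ> chart_inv c) (snd c x)"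
      using *[OF chartsD[OF c(1)] c(2) d(3,2)] d B[OF d(1)] by (auto simp: holo_at_def compatible_def Int_commute)
  next
    assume "hol_at (f \<circ> chart_inv c) (snd c x)"
    then show "holo_at M f x"
      using *[OF A _ chartsD[OF c(1)] c(2)] B by (auto simp: holo_at_def compatible_def Int_commute)
  qed
qed

lemma holo_map_hol_at:
  assumes M: "complex_manifold M" and N: "complex_manifold N" and F: "holo_map M N F"
    and c: "c \<in> charts M" "x \<in> fst c" and d: "d \<in> charts N" "F x \<in> fst d"
  shows "hol_at (\<lambda>z. (snd d \<circ> F \<circ> chart_inv c) z $ i) (snd c x)"
proof -
  have "x \<in> points M" using c chartsD chart_domain_subset by blast
  from holo_at_pullback[OF complex_manifold_charted[OF M] complex_manifold_charted[OF N] F this holo_at_coordinate[OF d]]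
  show ?thesis
    unfolding holo_at_in_chart[OF M c] by (simp add: o_def)
qed

lemma holo_map_chain_rule:
  assumes "complex_manifold M" "complex_manifold N" "holo_map M N F"
    and "c \<in> charts M" "x \<in> fst c" "d \<in> charts N" "F x \<in> fst d" "holo_at N u (F x)"
  shows "cdot (grad (u \<circ> F \<circ> chart_inv c) (snd c x)) w =
      cdot (grad (u \<circ> chart_inv d) (snd d (F x))) (jac (snd d \<circ> F \<circ> chart_inv c) (snd c x) *v w)"
  using assms holo_map_hol_at[OF assms(1-7)] holo_at_in_chart[of N d "F x" u]
  by (intro chart_chain_rule(2)[OF chartsD chartsD]) (auto simp: holo_map_def)

lemma transition_chain_rule:
  assumes M: "complex_manifold M" and "c \<in> charts M" "x \<in> fst c" "d \<in> charts M" "x \<in> fst d" "holo_at M u x"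
  shows "cdot (grad (u \<circ> chart_inv c) (snd c x)) w =
      cdot (grad (u \<circ> chart_inv d) (snd d x)) (jac (snd d \<circ> chart_inv c) (snd c x) *v w)"
  using holo_map_chain_rule[OF M M holo_map_id[OF M], of c x d u w] assms by (simp add: o_def)

lemma grad_coordinate:
  assumes "is_chart X c" "x \<in> fst c"
  shows "cdot (grad ((\<lambda>m. snd c m $ i) \<circ> chart_inv c) (snd c x)) w = w $ i"
proof -
  have o: "open (snd c ` fst c)" using assms by (simp add: is_chart_def)
  have x: "snd c x \<in> snd c ` fst c" using assms by blast
  have e: "z $ i = ((\<lambda>m. snd c m $ i) \<circ> chart_inv c) z" if "z \<in> snd c ` fst c" for z
    using that assms by auto
  have "grad ((\<lambda>m. snd c m $ i) \<circ> chart_inv c) (snd c x) = axis i 1"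
    using hol_at_cong_open(2)[OF o x e hol_at_component(1)] by (simp add: o_def)
  then show ?thesis by (simp add: cdot_def axis_def if_distrib[of "\<lambda>x. x * _"] cong: if_cong)
qed

text \<open>The chain rule is applied to the coordinate functions of \<open>c\<close> themselves:
  computed in \<open>c\<close>, their differentials just read off the entries of
  \<open>w\<close>.\<close>

lemma transition_jac_inverse:
  assumes M: "complex_manifold M" and c: "c \<in> charts M" "x \<in> fst c" and d: "d \<in> charts M" "x \<in> fst d"
  shows "jac (snd c \<circ> chart_inv d) (snd d x) *v (jac (snd d \<circ> chart_inv c) (snd c x) *v w) = w"
proof -
  have h: "hol_at (\<lambda>z. (snd c \<circ> chart_inv d) z $ i) (snd d x)" for i
    using holo_map_hol_at[OF M M holo_map_id[OF M] d c] by (simp add: o_def)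
  have J: "(jac (snd c \<circ> chart_inv d) (snd d x) *v v) $ i =
      cdot (grad ((\<lambda>m. snd c m $ i) \<circ> chart_inv d) (snd d x)) v" for i v
    using jac_works(2)[OF h] by (simp add: matrix_vector_nth_cdot o_def)
  have K: "(jac (snd c \<circ> chart_inv d) (snd d x) *v (jac (snd d \<circ> chart_inv c) (snd c x) *v w)) $ i = w $ i" for i
    unfolding J transition_chain_rule[OF M c d holo_at_coordinate[OF c], symmetric]
    by (rule grad_coordinate[OF chartsD[OF c(1)] c(2)])
  show ?thesis by (rule vec_eq_iff[THEN iffD2, OF allI[OF K]])
qed

section \<open>The foliation defined by local equations of given modulus\<close>

text \<open>A local equation of \<open>S\<close> normalised by its modulus: off \<open>S\<close>,
  the quotient of two of them has modulus one on their overlap.\<close>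

definition defining_function ::
    "('m, 'd::finite) cspace \<Rightarrow> ('m \<Rightarrow> real) \<Rightarrow> 'm set \<Rightarrow> 'm set \<Rightarrow> ('m \<Rightarrow> complex) \<Rightarrow> bool" where
  "defining_function M \<rho> S T u \<longleftrightarrow> openin (top_of M) T \<and>
     (\<forall>x\<in>T. holo_at M u x \<and> (\<forall>c\<in>charts M. x \<in> fst c \<longrightarrow> grad (u \<circ> chart_inv c) (snd c x) \<noteq> 0) \<and>
        cmod (u x) = \<rho> x \<and> (u x = 0 \<longleftrightarrow> x \<in> S))"

text \<open>Quantifying over all local equations avoids a choice; by
  \<open>kernel_distribution_eq\<close> each one already gives the whole set. Outside
  \<open>defining_domain\<close> the set is empty.\<close>

definition kernel_distribution ::
    "('m, 'd::finite) cspace \<Rightarrow> ('m \<Rightarrow> real) \<Rightarrow> 'm set \<Rightarrow> ('m, 'd) distribution" where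
  "kernel_distribution M \<rho> S c x =
     {w. \<exists>T u. defining_function M \<rho> S T u \<and> x \<in> T \<and> cdot (grad (u \<circ> chart_inv c) (snd c x)) w = 0}"

definition defining_domain ::
    "('m, 'd::finite) cspace \<Rightarrow> ('m \<Rightarrow> real) \<Rightarrow> 'm set \<Rightarrow> 'm set" where
  "defining_domain M \<rho> S = \<Union>{T. \<exists>u. defining_function M \<rho> S T u}"

lemma defining_domain_iff: "x \<in> defining_domain M \<rho> S \<longleftrightarrow> (\<exists>T u. defining_function M \<rho> S T u \<and> x \<in> T)"
  by (auto simp: defining_domain_def)

lemma defining_functionD:
  assumes "defining_function M \<rho> S T u"
  shows "openin (top_of M) T" "x \<in> T \<Longrightarrow> holo_at M u x"
    "x \<in> T \<Longrightarrow> c \<in> charts M \<Longrightarrow> x \<in> fst c \<Longrightarrow> grad (u \<circ> chart_inv c) (snd c x) \<noteq> 0"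
    "x \<in> T \<Longrightarrow> cmod (u x) = \<rho> x" "x \<in> T \<Longrightarrow> u x = 0 \<longleftrightarrow> x \<in> S"
  using assms by (auto simp: defining_function_def)

lemma defining_function_chart:
  assumes M: "complex_manifold M" and u: "defining_function M \<rho> S T u" and c: "c \<in> charts M"
  shows "open (snd c ` (T \<inter> fst c))" "z \<in> snd c ` (T \<inter> fst c) \<Longrightarrow> hol_at (u \<circ> chart_inv c) z"
proof -
  have "openin (top_of M) (T \<inter> fst c)"
    using defining_functionD(1)[OF u] chartsD[OF c] by (auto simp: is_chart_def)
  then show "open (snd c ` (T \<inter> fst c))"
    using is_chart_open_image[OF chartsD[OF c]] by blast
  show "hol_at (u \<circ> chart_inv c) z" if "z \<in> snd c ` (T \<inter> fst c)"
    using that defining_functionD(2)[OF u] holo_at_in_chart[OF M c] by blast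
qed

text \<open>Any two local equations at \<open>x\<close> have modulus \<open>\<rho>\<close> on their
  common domain, so \<open>vanishing_grad_of_equal_modulus\<close> identifies their kernels.\<close>

lemma kernel_distribution_eq:
  assumes M: "complex_manifold M" and u: "defining_function M \<rho> S T u" "x \<in> T" and c: "c \<in> charts M" "x \<in> fst c"
  shows "kernel_distribution M \<rho> S c x = {w. cdot (grad (u \<circ> chart_inv c) (snd c x)) w = 0}"
proof -
  have "cdot (grad (u \<circ> chart_inv c) (snd c x)) w = 0"
    if u': "defining_function M \<rho> S T' u'" "x \<in> T'" and w: "cdot (grad (u' \<circ> chart_inv c) (snd c x)) w = 0" for T' u' w
  proof (rule vanishing_grad_of_equal_modulus[OF _ _ _ w])
    have "open (snd c ` (T \<inter> fst c) \<inter> snd c ` (T' \<inter> fst c))"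
      using defining_function_chart(1)[OF M _ c(1)] u u' by blast
    moreover have "snd c x \<in> snd c ` (T \<inter> fst c) \<inter> snd c ` (T' \<inter> fst c)"
      using u u' c by blast
    moreover have "cmod ((u' \<circ> chart_inv c) z) = cmod ((u \<circ> chart_inv c) z)"
      if zz: "z \<in> snd c ` (T \<inter> fst c) \<inter> snd c ` (T' \<inter> fst c)" for z
    proof -
      obtain y where y: "y \<in> T" "y \<in> fst c" "z = snd c y" using zz by blast
      obtain y' where y': "y' \<in> T'" "y' \<in> fst c" "z = snd c y'" using zz by blast
      have "y = y'" using y y' is_chart_inj[OF chartsD[OF c(1)]] by (metis inj_onD)
      then show ?thesis
        using y y' defining_functionD(4)[OF u(1)] defining_functionD(4)[OF u'(1)] chartsD[OF c(1)] by simp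
    qed
    ultimately show "eventually (\<lambda>z. cmod ((u' \<circ> chart_inv c) z) = cmod ((u \<circ> chart_inv c) z)) (nhds (snd c x))"
      unfolding eventually_nhds by blast
    show "hol_at (u \<circ> chart_inv c) (snd c x)" "hol_at (u' \<circ> chart_inv c) (snd c x)"
      using defining_function_chart(2)[OF M _ c(1)] u u' c by blast+
  qed
  then show ?thesis using u by (auto simp: kernel_distribution_def)
qed

section \<open>The kernels form a regular foliation\<close>

lemma kernel_distribution_change:
  assumes M: "complex_manifold M" and x: "x \<in> defining_domain M \<rho> S"
    and c: "c \<in> charts M" "x \<in> fst c" and d: "d \<in> charts M" "x \<in> fst d"
  shows "kernel_distribution M \<rho> S c x =
    (*v) (btrans (tangent_bundle M) c d x) ` kernel_distribution M \<rho> S d x"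
proof -
  obtain T u where u: "defining_function M \<rho> S T u" "x \<in> T"
    using x by (auto simp: defining_domain_iff)
  have h: "holo_at M u x" by (rule defining_functionD(2)[OF u])
  have "w \<in> (*v) (jac (snd c \<circ> chart_inv d) (snd d x)) ` kernel_distribution M \<rho> S d x"
    if "w \<in> kernel_distribution M \<rho> S c x" for w
    using that transition_jac_inverse[OF M c d, of w] transition_chain_rule[OF M d c h, of "jac (snd d \<circ> chart_inv c) (snd c x) *v w"]
    unfolding kernel_distribution_eq[OF M u c] kernel_distribution_eq[OF M u d]
    by (intro image_eqI[of _ _ "jac (snd d \<circ> chart_inv c) (snd c x) *v w"]) simp_all
  moreover have "jac (snd c \<circ> chart_inv d) (snd d x) *v w \<in> kernel_distribution M \<rho> S c x"
    if "w \<in> kernel_distribution M \<rho> S d x" for w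
    using that transition_chain_rule[OF M d c h, of w]
    unfolding kernel_distribution_eq[OF M u c] kernel_distribution_eq[OF M u d] by simp
  ultimately show ?thesis by (auto simp: tangent_bundle_def)
qed

text \<open>Some partial derivative of the local equation is nonzero at \<open>x\<close> and stays
  so nearby. The nonconstant entries of the kernel basis are quotients by it of other partial
  derivatives, and these are holomorphic by \<open>hol_at_grad\<close>.\<close>

lemma kernel_distribution_frame:
  fixes M :: "('m, ('n::finite) option) cspace"
  assumes M: "complex_manifold M" and x: "x \<in> defining_domain M \<rho> S"
  shows "\<exists>c\<in>charts M. \<exists>T (e :: nat \<Rightarrow> 'm \<Rightarrow> complex^'n option).
        openin (top_of M) T \<and> x \<in> T \<and> T \<subseteq> defining_domain M \<rho> S \<inter> fst c \<and> (\<forall>k<CARD('n). holo_fun M T (e k)) \<and>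
        (\<forall>y\<in>T. kernel_distribution M \<rho> S c y = vec.span ((\<lambda>k. e k y) ` {..<CARD('n)}) \<and>
          vec.dim (kernel_distribution M \<rho> S c y) = CARD('n))"
proof -
  obtain T u where u: "defining_function M \<rho> S T u" "x \<in> T"
    using x by (auto simp: defining_domain_iff)
  have "x \<in> points M" using defining_functionD(1)[OF u(1)] u(2) openin_subset by blast
  then obtain c where c: "c \<in> charts M" "x \<in> fst c"
    using chart_at[OF complex_manifold_charted[OF M]] atlas_subset_charts[OF M] by (metis subsetD)
  define g where "g = u \<circ> chart_inv c"
  define B where "B = snd c ` (T \<inter> fst c)"
  have B: "open B" and hg: "\<And>z. z \<in> B \<Longrightarrow> hol_at g z"
    using defining_function_chart[OF M u(1) c(1)] by (auto simp: B_def g_def)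
  have "grad g (snd c x) \<noteq> 0"
    using defining_functionD(3)[OF u c] by (simp add: g_def)
  then obtain j where j: "grad g (snd c x) $ j \<noteq> 0" by (auto simp: vec_eq_iff)
  define B' where "B' = B \<inter> (\<lambda>z. grad g z $ j) -` (- {0})"
  have B': "open B'"
    unfolding B'_def by (rule continuous_open_preimage[OF continuous_on_grad[OF B hg] B]) auto
  define T' where "T' = {y \<in> fst c. snd c y \<in> B'}"
  have T': "openin (top_of M) T'"
    unfolding T'_def by (rule is_chart_open_vimage[OF chartsD[OF c(1)] B'])
  have T'T: "T' \<subseteq> T \<inter> fst c"
    using is_chart_inj[OF chartsD[OF c(1)]] by (auto simp: T'_def B'_def B_def inj_on_def)
  have xT': "x \<in> T'" using c u j by (auto simp: T'_def B'_def B_def)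
  \<comment> \<open>Frames are numbered by naturals below the rank, while the basis is indexed by
    the coordinates other than \<open>j\<close>. As the coordinate type is \<open>'n option\<close>,
    there are \<open>CARD('n)\<close> of these.\<close>
  obtain h where h: "bij_betw h {0..<CARD('n)} (UNIV - {j})"
    using ex_bij_betw_nat_finite[of "UNIV - {j}"] by auto
  define E where "E i z = axis i 1 - (grad g z $ i / grad g z $ j) *s axis j (1::complex)" for i z
  define e where "e k y = E (h k) (snd c y)" for k y
  have hol: "holo_fun M T' (e k)" for k
    unfolding holo_fun_def holo_on_iff
  proof (intro ballI conjI allI)
    fix d assume d: "d \<in> atlas M"
    then have dc: "d \<in> charts M" using atlas_subset_charts[OF M] by blast
    have "openin (top_of M) (fst d \<inter> T')" using T' chartsD[OF dc] by (auto simp: is_chart_def)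
    then show "open (snd d ` (fst d \<inter> T'))" using is_chart_open_image[OF chartsD[OF dc]] by blast
    fix z i assume "z \<in> snd d ` (fst d \<inter> T')"
    then obtain y where y: "y \<in> fst d" "y \<in> T'" "z = snd d y" by blast
    have yc: "y \<in> fst c" "snd c y \<in> B'" using y by (auto simp: T'_def)
    have "hol_at (\<lambda>z. grad g z $ h k * inverse (grad g z $ j)) (snd c y)"
      using yc by (intro hol_at_mult(1) hol_at_field(1)[OF hol_at_grad[OF B hg] DERIV_inverse] hol_at_grad[OF B hg])
         (auto simp: B'_def)
    then have "hol_at (\<lambda>z. grad g z $ h k * inverse (grad g z $ j) * (- axis j 1 $ i) + axis (h k) 1 $ i) (snd c y)"
      by (intro hol_at_add(1) hol_at_mult_const(1) hol_at_const(1))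
    moreover have "(\<lambda>z. grad g z $ h k * inverse (grad g z $ j) * (- axis j 1 $ i) + axis (h k) 1 $ i) = (\<lambda>z. E (h k) z $ i)"
      by (auto simp: E_def divide_inverse fun_eq_iff)
    ultimately have "hol_at (\<lambda>z. E (h k) z $ i) (snd c y)" by simp
    then have "hol_at ((\<lambda>y. e k y $ i) \<circ> chart_inv c) (snd c y)"
    proof (rule hol_at_cong_open(1)[rotated -1])
      show "open (snd c ` fst c)" using chartsD[OF c(1)] by (simp add: is_chart_def)
      show "snd c y \<in> snd c ` fst c" using yc by blast
      show "E (h k) z $ i = ((\<lambda>y. e k y $ i) \<circ> chart_inv c) z" if "z \<in> snd c ` fst c" for z
        using that chartsD[OF c(1)] by (auto simp: e_def)
    qed
    then have "holo_at M (\<lambda>y. e k y $ i) y"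
      using holo_at_in_chart[OF M c(1) yc(1)] by blast
    then show "hol_at (\<lambda>x. (e k \<circ> chart_inv d) x $ i) z"
      using d y by (auto simp: holo_at_def o_def)
  qed
  have ker: "kernel_distribution M \<rho> S c y = vec.span ((\<lambda>k. e k y) ` {..<CARD('n)}) \<and>
      vec.dim (kernel_distribution M \<rho> S c y) = CARD('n)" if "y \<in> T'" for y
  proof -
    have y: "y \<in> T" "y \<in> fst c" "grad g (snd c y) $ j \<noteq> 0"
      using that T'T by (auto simp: T'_def B'_def)
    have "(\<lambda>k. e k y) ` {..<CARD('n)} = (\<lambda>i. E i (snd c y)) ` (UNIV - {j})"
      using bij_betw_imp_surj_on[OF h] by (simp add: e_def atLeast0LessThan flip: image_image[of "\<lambda>i. E i (snd c y)" h])
    then show ?thesis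
      using kernel_eq_span[of "grad g (snd c y)" j, OF y(3)] dim_kernel[of "grad g (snd c y)" j, OF y(3)]
      unfolding kernel_distribution_eq[OF M u(1) y(1) c(1) y(2)] by (simp add: g_def E_def)
  qed
  have sub: "T' \<subseteq> defining_domain M \<rho> S \<inter> fst c"
    using T'T u by (auto simp: defining_domain_def)
  have "openin (top_of M) T' \<and> x \<in> T' \<and> T' \<subseteq> defining_domain M \<rho> S \<inter> fst c \<and> (\<forall>k<CARD('n). holo_fun M T' (e k)) \<and>
        (\<forall>y\<in>T'. kernel_distribution M \<rho> S c y = vec.span ((\<lambda>k. e k y) ` {..<CARD('n)}) \<and>
          vec.dim (kernel_distribution M \<rho> S c y) = CARD('n))"
    using T' xT' sub hol ker by metis
  then show ?thesis
    by - (rule bexI[OF _ c(1)], rule exI, rule exI, assumption)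
qed

text \<open>The differential du is closed: differentiating du(Y) = 0 along X and du(X) = 0 along Y
  expresses both terms of du([X, Y]) through the Hessian of u, and they cancel by its symmetry,
  \<open>grad_grad_commute\<close>.\<close>

lemma involutive_kernel_distribution:
  assumes M: "complex_manifold M"
  shows "involutive M (defining_domain M \<rho> S) (kernel_distribution M \<rho> S)"
  unfolding involutive_def
proof (intro ballI allI impI)
  fix c A X Y z
  assume c: "c \<in> charts M" and asm: "A \<subseteq> snd c ` (fst c \<inter> defining_domain M \<rho> S) \<and> X holo_on A \<and> Y holo_on A \<and>
    (\<forall>z\<in>A. X z \<in> kernel_distribution M \<rho> S c (chart_inv c z) \<and> Y z \<in> kernel_distribution M \<rho> S c (chart_inv c z))"
    and z: "z \<in> A"
  then obtain x where x: "x \<in> fst c" "x \<in> defining_domain M \<rho> S" "z = snd c x" by blast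
  obtain T u where u: "defining_function M \<rho> S T u" "x \<in> T"
    using x by (auto simp: defining_domain_iff)
  define g where "g = u \<circ> chart_inv c"
  define B where "B = snd c ` (T \<inter> fst c)"
  have B: "open B" and hg: "\<And>z. z \<in> B \<Longrightarrow> hol_at g z"
    using defining_function_chart[OF M u(1) c(1)] by (auto simp: B_def g_def)
  have zB: "z \<in> A \<inter> B" using z x u by (auto simp: B_def)
  have AB: "open (A \<inter> B)" using asm B by (auto simp: holo_on_def)
  have ker: "kernel_distribution M \<rho> S c (chart_inv c z) = {w. cdot (grad g z) w = 0}" if "z \<in> B" for z
    using that kernel_distribution_eq[OF M u(1) _ c] chartsD[OF c] by (auto simp: B_def g_def)
  have hgg: "hol_at (\<lambda>z. grad g z $ i) z" for i
    using zB by (intro hol_at_grad[OF B hg]) auto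
  text \<open>Differentiating \<open>du(Z) = 0\<close> in the direction \<open>v\<close>.\<close>
  have diff: "cdot (grad g z) (jac Z z *v v) = - (\<Sum>i\<in>UNIV. \<Sum>j\<in>UNIV. grad (\<lambda>z. grad g z $ i) z $ j * v $ j * Z z $ i)"
    if Z: "Z holo_on A" "\<And>z. z \<in> A \<Longrightarrow> Z z \<in> kernel_distribution M \<rho> S c (chart_inv c z)" for Z v
  proof -
    have hZ: "hol_at (\<lambda>z. Z z $ i) z" for i
      using Z(1) z by (simp add: holo_on_iff)
    have "((\<lambda>z. \<Sum>i\<in>UNIV. grad g z $ i * Z z $ i) has_derivative
        (\<lambda>h. \<Sum>i\<in>UNIV. grad g z $ i * cdot (grad (\<lambda>z. Z z $ i) z) h + cdot (grad (\<lambda>z. grad g z $ i) z) h * Z z $ i)) (at z)"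
      by (intro has_derivative_sum has_derivative_mult hol_at_derivative hgg hZ)
    moreover have "((\<lambda>z. \<Sum>i\<in>UNIV. grad g z $ i * Z z $ i) has_derivative (\<lambda>h. 0)) (at z)"
    proof (rule has_derivative_transform_within_open[OF has_derivative_const AB zB])
      show "0 = (\<Sum>i\<in>UNIV. grad g y $ i * Z y $ i)" if "y \<in> A \<inter> B" for y
        using that Z(2)[of y] ker[of y] by (simp add: cdot_def)
    qed
    ultimately have "(\<lambda>h. \<Sum>i\<in>UNIV. grad g z $ i * cdot (grad (\<lambda>z. Z z $ i) z) h + cdot (grad (\<lambda>z. grad g z $ i) z) h * Z z $ i) = (\<lambda>h. 0)"
      by (rule has_derivative_unique)
    then have "(\<Sum>i\<in>UNIV. grad g z $ i * cdot (grad (\<lambda>z. Z z $ i) z) v) + (\<Sum>i\<in>UNIV. cdot (grad (\<lambda>z. grad g z $ i) z) v * Z z $ i) = 0"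
      by (simp add: sum.distrib fun_eq_iff)
    moreover have "(\<Sum>i\<in>UNIV. grad g z $ i * cdot (grad (\<lambda>z. Z z $ i) z) v) = cdot (grad g z) (jac Z z *v v)"
      using jac_works(2)[OF hZ] by (simp add: cdot_def[of "grad g z"] matrix_vector_nth_cdot)
    ultimately show ?thesis
      by (simp add: cdot_def[of "grad (\<lambda>z. grad g z $ _) z"] sum_distrib_right eq_neg_iff_add_eq_0)
  qed
  have "cdot (grad g z) (jac Y z *v X z) = cdot (grad g z) (jac X z *v Y z)"
  proof -
    have "(\<Sum>i\<in>UNIV. \<Sum>j\<in>UNIV. grad (\<lambda>z. grad g z $ i) z $ j * X z $ j * Y z $ i)
      = (\<Sum>i\<in>UNIV. \<Sum>j\<in>UNIV. grad (\<lambda>z. grad g z $ j) z $ i * X z $ j * Y z $ i)"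
      using grad_grad_commute[OF B hg, of z] zB by simp
    also have "\<dots> = (\<Sum>j\<in>UNIV. \<Sum>i\<in>UNIV. grad (\<lambda>z. grad g z $ j) z $ i * X z $ j * Y z $ i)"
      by (rule sum.swap)
    also have "\<dots> = (\<Sum>i\<in>UNIV. \<Sum>j\<in>UNIV. grad (\<lambda>z. grad g z $ i) z $ j * Y z $ j * X z $ i)"
      by (simp add: mult_ac)
    finally show ?thesis using asm by (simp add: diff)
  qed
  then show "jac Y z *v X z - jac X z *v Y z \<in> kernel_distribution M \<rho> S c (chart_inv c z)"
    using ker zB by (simp add: cdot_diff)
qed

lemma regular_foliation_kernel_distribution:
  fixes M :: "('m, ('n::finite) option) cspace"
  assumes M: "complex_manifold M"
  shows "regular_foliation (CARD('n)) M (defining_domain M \<rho> S) (kernel_distribution M \<rho> S)"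
proof -
  have "openin (top_of M) (defining_domain M \<rho> S)"
    unfolding defining_domain_def using defining_functionD(1) by (intro openin_Union) blast
  moreover have "holo_subbundle (CARD('n)) M (defining_domain M \<rho> S) (kernel_distribution M \<rho> S)"
    unfolding holo_subbundle_def
  proof (intro conjI ballI)
    fix c d x assume "c \<in> charts M" "d \<in> charts M" "x \<in> defining_domain M \<rho> S \<inter> fst c \<inter> fst d"
    then show "kernel_distribution M \<rho> S c x = (*v) (btrans (tangent_bundle M) c d x) ` kernel_distribution M \<rho> S d x"
      by (intro kernel_distribution_change[OF M]) auto
  qed (rule kernel_distribution_frame[OF M])
  ultimately show ?thesis
    unfolding regular_foliation_def using involutive_kernel_distribution[OF M] by simp
qed

text \<open>A local equation vanishes identically on \<open>C\<close>, so tangent vectors of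
  \<open>C\<close> lie in the kernel. Equality follows by dimension, since the Jacobian of an
  immersion is injective and the kernel is a hyperplane.\<close>

lemma integral_submanifold_kernel_distribution:
  fixes M :: "('m, ('n::finite) option) cspace" and C :: "('c, 'n) cspace"
  assumes M: "complex_manifold M" and C: "connected_manifold C" and emb: "holo_embedding C M \<iota>"
    and dom: "\<iota> ` points C \<subseteq> defining_domain M \<rho> (\<iota> ` points C)"
  shows "integral_submanifold M (defining_domain M \<rho> (\<iota> ` points C)) (kernel_distribution M \<rho> (\<iota> ` points C)) C \<iota>"
proof -
  have Cm: "complex_manifold C" using C by (simp add: connected_manifold_def)
  have im: "immersion C M \<iota>" and hm: "holo_map C M \<iota>" and cont: "continuous_map (top_of C) (top_of M) \<iota>"
    using emb by (auto simp: holo_embedding_def immersion_def holo_map_def)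
  have "embedding_map (top_of C) (top_of M) \<iota>" using emb by (simp add: holo_embedding_def)
  then have inj: "inj_on \<iota> (points C)"
    by (simp add: embedding_map_def homeomorphic_imp_injective_map)
  have "kernel_distribution M \<rho> (\<iota> ` points C) c (\<iota> y) = range ((*v) (jac (snd c \<circ> \<iota> \<circ> chart_inv d) (snd d y)))"
    if c: "c \<in> charts M" "\<iota> y \<in> fst c" and d: "d \<in> charts C" "y \<in> fst d" for c d y
  proof -
    define J where "J = jac (snd c \<circ> \<iota> \<circ> chart_inv d) (snd d y)"
    have yC: "y \<in> points C" using chart_domain_subset[OF chartsD[OF d(1)]] d by blast
    then have "\<iota> y \<in> defining_domain M \<rho> (\<iota> ` points C)" using dom by blast
    then obtain T u where u: "defining_function M \<rho> (\<iota> ` points C) T u" "\<iota> y \<in> T"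
      unfolding defining_domain_iff by blast
    define a where "a = grad (u \<circ> chart_inv c) (snd c (\<iota> y))"
    have ker: "kernel_distribution M \<rho> (\<iota> ` points C) c (\<iota> y) = {w. cdot a w = 0}"
      unfolding a_def by (rule kernel_distribution_eq[OF M u c])
    have V: "openin (top_of C) {x \<in> points C. \<iota> x \<in> T}"
      by (rule openin_continuous_map_preimage[OF cont defining_functionD(1)[OF u(1)]])
    have "grad ((u \<circ> \<iota>) \<circ> chart_inv d) (snd d y) = grad ((\<lambda>_. 0) \<circ> chart_inv d) (snd d y)"
    proof (rule hol_at_chart_cong(2)[OF chartsD[OF d(1)] V _ d(2)])
      show "y \<in> {x \<in> points C. \<iota> x \<in> T}" using yC u by simp
      show "0 = (u \<circ> \<iota>) x" if "x \<in> {x \<in> points C. \<iota> x \<in> T}" for x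
        using that defining_functionD(5)[OF u(1), of "\<iota> x"] by auto
    qed (simp add: o_def)
    then have 0: "cdot a (J *v w) = 0" for w
      using holo_map_chain_rule[OF Cm M hm d c defining_functionD(2)[OF u], of w]
      by (simp add: a_def J_def o_def)
    have sub: "range ((*v) J) \<subseteq> {w. cdot a w = 0}" using 0 by auto
    have "a \<noteq> 0" using defining_functionD(3)[OF u c] by (simp add: a_def)
    then obtain j where j: "a $ j \<noteq> 0" by (auto simp: vec_eq_iff)
    have "inj ((*v) J)" using im c d by (auto simp: immersion_def J_def)
    then have "vec.dim (range ((*v) J)) = CARD('n)"
      by (metis matrix_vector_mul_linear_gen vec.dim_image_eq vec.span_UNIV vec_dim_card)
    then have "vec.dim {w. cdot a w = 0} \<le> vec.dim (range ((*v) J))"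
      using dim_kernel[OF j] by simp
    moreover have "vec.subspace {w. cdot a w = 0}"
      by (auto simp: vec.subspace_def cdot_add cdot_scale)
    moreover have "vec.subspace (range ((*v) J))"
      by (rule vec.subspace_image) simp
    ultimately have "range ((*v) J) = {w. cdot a w = 0}"
      using sub by (intro vec.subspace_dim_equal)
    then show ?thesis by (simp add: ker J_def)
  qed
  then show ?thesis
    using C im inj dom by (auto simp: integral_submanifold_def)
qed

text \<open>A competitor \<open>L\<close> is only injectively immersed and its topology may be finer
  than the induced one, so \<open>S\<close> is shown open and closed in \<open>top_of L\<close>.
  Openness rests on tangency, closedness on the continuity of the inclusion.\<close>

lemma is_leaf_kernel_distribution:
  fixes M :: "('m, ('n::finite) option) cspace" and C :: "('c, 'n) cspace"
  assumes M: "complex_manifold M" and C: "connected_manifold C" and emb: "holo_embedding C M \<iota>"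
    and dom: "\<iota> ` points C \<subseteq> defining_domain M \<rho> (\<iota> ` points C)"
  shows "is_leaf M (defining_domain M \<rho> (\<iota> ` points C)) (kernel_distribution M \<rho> (\<iota> ` points C)) C \<iota>"
proof -
  define S where "S = \<iota> ` points C"
  have "points L = S"
    if L: "integral_submanifold M (defining_domain M \<rho> S) (kernel_distribution M \<rho> S) L (\<lambda>x. x)" and SL: "S \<subseteq> points L"
    for L :: "('m, 'n) cspace"
  proof -
    have Lc: "connected_manifold L" and hm: "holo_map L M (\<lambda>x. x)" and LW: "points L \<subseteq> defining_domain M \<rho> S"
      and tan: "\<And>c d y. c \<in> charts M \<Longrightarrow> d \<in> charts L \<Longrightarrow> y \<in> fst d \<Longrightarrow> y \<in> fst c \<Longrightarrow>
        kernel_distribution M \<rho> S c y = range ((*v) (jac (snd c \<circ> (\<lambda>x. x) \<circ> chart_inv d) (snd d y)))"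
      using L by (auto simp: integral_submanifold_def immersion_def)
    have Lm: "complex_manifold L" using Lc by (simp add: connected_manifold_def)
    have cont: "continuous_map (top_of L) (top_of M) (\<lambda>x. x)" using hm by (simp add: holo_map_def)
    have "\<exists>N. openin (top_of L) N \<and> x \<in> N \<and> N \<subseteq> S" if x: "x \<in> S" for x
    proof -
      obtain T u where u: "defining_function M \<rho> S T u" "x \<in> T"
        using x SL LW by (metis defining_domain_iff subsetD)
      obtain d where d: "d \<in> atlas L" "x \<in> fst d" "is_chart (top_of L) d"
        using chart_at[OF complex_manifold_charted[OF Lm]] x SL by (metis subsetD)
      have dc: "d \<in> charts L" using d atlas_subset_charts[OF Lm] by blast
      define V where "V = {y \<in> points L. y \<in> T} \<inter> fst d"
      have V: "openin (top_of L) V"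
        unfolding V_def using openin_continuous_map_preimage[OF cont defining_functionD(1)[OF u(1)]] d(3)
        by (auto simp: is_chart_def)
      have VT: "V \<subseteq> T" "V \<subseteq> fst d" by (auto simp: V_def)
      have xV: "x \<in> V" using x SL u d by (auto simp: V_def)
      have "open (snd d ` V)" by (rule is_chart_open_image[OF d(3) V VT(2)])
      then obtain r where r: "0 < r" "ball (snd d x) r \<subseteq> snd d ` V"
        using xV open_contains_ball by blast
      \<comment> \<open>Tangent vectors of \<open>L\<close> lie in the kernel of du; by the chain
        rule, \<open>u\<close> read in a chart of \<open>L\<close> has derivative zero.\<close>
      have flat: "((u \<circ> chart_inv d) has_derivative (\<lambda>h. 0)) (at z)" if z: "z \<in> ball (snd d x) r" for z
      proof -
        obtain y where y: "y \<in> V" "z = snd d y" using r z by blast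
        have yT: "y \<in> T" "y \<in> fst d" using y VT by auto
        have "y \<in> points M" using openin_subset[OF defining_functionD(1)[OF u(1)]] yT by blast
        then obtain c where c: "c \<in> charts M" "y \<in> fst c"
          using chart_at[OF complex_manifold_charted[OF M]] atlas_subset_charts[OF M] by (metis subsetD)
        have hu: "holo_at M u y" by (rule defining_functionD(2)[OF u(1) yT(1)])
        have e: "u \<circ> (\<lambda>x. x) \<circ> chart_inv d = u \<circ> chart_inv d" by (simp add: o_def)
        have "hol_at (u \<circ> chart_inv d) z"
          using chart_chain_rule(1)[OF d(3) chartsD[OF c(1)] cont yT(2) c(2) hu[unfolded holo_at_in_chart[OF M c]]
              holo_map_hol_at[OF Lm M hm dc yT(2) c]] y by (simp only: e)
        from hol_at_derivative[OF this]
        have D: "((u \<circ> chart_inv d) has_derivative cdot (grad (u \<circ> chart_inv d) z)) (at z)" .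
        have "cdot (grad (u \<circ> chart_inv d) z) w = 0" for w
        proof -
          have "jac (snd c \<circ> (\<lambda>x. x) \<circ> chart_inv d) (snd d y) *v w \<in> {w. cdot (grad (u \<circ> chart_inv c) (snd c y)) w = 0}"
            unfolding kernel_distribution_eq[OF M u(1) yT(1) c, symmetric] tan[OF c(1) dc yT(2) c(2)] by (rule rangeI)
          then show ?thesis
            using holo_map_chain_rule[OF Lm M hm dc yT(2) c hu, of w] unfolding e y(2) by simp
        qed
        then have "cdot (grad (u \<circ> chart_inv d) z) = (\<lambda>h. 0)" by blast
        with D show ?thesis by (simp only:)
      qed
      have "\<exists>k. \<forall>z\<in>ball (snd d x) r. (u \<circ> chart_inv d) z = k"
        by (rule has_derivative_zero_constant[OF convex_ball has_derivative_at_withinI[OF flat]])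
      then obtain k where k: "\<forall>z\<in>ball (snd d x) r. (u \<circ> chart_inv d) z = k" ..
      have "u x = 0" using defining_functionD(5)[OF u] x by simp
      then have k0: "k = 0" using bspec[OF k, of "snd d x"] r d by simp
      define N where "N = {y \<in> fst d. snd d y \<in> ball (snd d x) r}"
      have "openin (top_of L) N" unfolding N_def by (rule is_chart_open_vimage[OF d(3) open_ball])
      moreover have "x \<in> N" using r d by (simp add: N_def)
      moreover have "N \<subseteq> S"
      proof
        fix y assume "y \<in> N"
        then have y: "y \<in> fst d" "snd d y \<in> ball (snd d x) r" by (auto simp: N_def)
        obtain y' where "y' \<in> V" "snd d y = snd d y'" using r(2) y(2) by blast
        then have "y \<in> T" using y VT is_chart_inj[OF d(3)] by (metis inj_onD subsetD)
        moreover have "u y = 0" using bspec[OF k y(2)] k0 d(3) y(1) by simp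
        ultimately show "y \<in> S" using defining_functionD(5)[OF u(1)] by blast
      qed
      ultimately show ?thesis by blast
    qed
    then have S_open: "openin (top_of L) S"
      by (subst openin_subopen) blast
    \<comment> \<open>Off \<open>S\<close> a local equation is nonzero, an open condition in
      \<open>M\<close> and hence in \<open>L\<close>.\<close>
    have "\<exists>N. openin (top_of L) N \<and> x \<in> N \<and> N \<subseteq> points L - S" if x: "x \<in> points L - S" for x
    proof -
      obtain T u where u: "defining_function M \<rho> S T u" "x \<in> T"
        using x LW by (metis DiffD1 defining_domain_iff subsetD)
      have "x \<in> points M" using openin_subset[OF defining_functionD(1)[OF u(1)]] u(2) by blast
      then obtain c where c: "c \<in> charts M" "x \<in> fst c"
        using chart_at[OF complex_manifold_charted[OF M]] atlas_subset_charts[OF M] by (metis subsetD)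
      define B where "B = snd c ` (T \<inter> fst c)"
      have B: "open B" and hg: "\<And>z. z \<in> B \<Longrightarrow> hol_at (u \<circ> chart_inv c) z"
        using defining_function_chart[OF M u(1) c(1)] by (auto simp: B_def)
      have "open (B \<inter> (u \<circ> chart_inv c) -` (- {0}))"
        by (rule continuous_open_preimage[OF hol_at_continuous_on[OF hg] B]) auto
      from is_chart_open_vimage[OF chartsD[OF c(1)] this]
      have o: "openin (top_of L) {y \<in> points L. y \<in> {y \<in> fst c. snd c y \<in> B \<inter> (u \<circ> chart_inv c) -` (- {0})}}"
        by (rule openin_continuous_map_preimage[OF cont])
      have "u x \<noteq> 0" using defining_functionD(5)[OF u] x by blast
      then have "x \<in> {y \<in> points L. y \<in> {y \<in> fst c. snd c y \<in> B \<inter> (u \<circ> chart_inv c) -` (- {0})}}"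
        using x c u chartsD[OF c(1)] by (simp add: B_def)
      moreover have "{y \<in> points L. y \<in> {y \<in> fst c. snd c y \<in> B \<inter> (u \<circ> chart_inv c) -` (- {0})}} \<subseteq> points L - S"
      proof
        fix y assume "y \<in> {y \<in> points L. y \<in> {y \<in> fst c. snd c y \<in> B \<inter> (u \<circ> chart_inv c) -` (- {0})}}"
        then have y: "y \<in> points L" "y \<in> fst c" "snd c y \<in> B" "u y \<noteq> 0"
          using chartsD[OF c(1)] by auto
        obtain y' where "y' \<in> T" "y' \<in> fst c" "snd c y = snd c y'" using y(3) by (auto simp: B_def)
        then have "y \<in> T" using y is_chart_inj[OF chartsD[OF c(1)]] by (metis inj_onD)
        then show "y \<in> points L - S" using y defining_functionD(5)[OF u(1)] by blast
      qed
      ultimately show ?thesis using o by blast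
    qed
    then have "openin (top_of L) (points L - S)"
      by (subst openin_subopen) blast
    then have "closedin (top_of L) S"
      using SL by (simp add: closedin_def)
    moreover have "connected_space (top_of L)" using Lc by (simp add: connected_manifold_def)
    moreover have "S \<noteq> {}" using C by (simp add: S_def connected_manifold_def)
    ultimately show ?thesis
      using S_open unfolding connected_space_clopen_in by blast
  qed
  then show ?thesis
    using integral_submanifold_kernel_distribution[OF assms] unfolding is_leaf_def S_def by blast
qed

section \<open>Local sections of locally biholomorphic maps\<close>

lemma is_chart_restrict:
  assumes c: "is_chart X c" and V: "openin X V"
  shows "is_chart (subtopology X V) (fst c \<inter> V, snd c)"
proof -
  have fc: "openin X (fst c)"
    and h: "homeomorphic_map (subtopology X (fst c)) (top_of_set (snd c ` fst c)) (snd c)"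
    using c by (auto simp: is_chart_def)
  have o: "openin X (fst c \<inter> V)" using fc V by blast
  have t: "topspace (subtopology X (fst c)) = fst c"
    using openin_subset[OF fc] by auto
  have "homeomorphic_map (subtopology (subtopology X (fst c)) (fst c \<inter> V))
      (subtopology (top_of_set (snd c ` fst c)) (snd c ` (fst c \<inter> V))) (snd c)"
    by (rule homeomorphic_map_subtopologies[OF h]) (unfold t, auto)
  moreover have "fst c \<inter> (fst c \<inter> V) = V \<inter> (fst c \<inter> V)" "snd c ` fst c \<inter> snd c ` (fst c \<inter> V) = snd c ` (fst c \<inter> V)"
    by auto
  ultimately have "homeomorphic_map (subtopology (subtopology X V) (fst c \<inter> V)) (top_of_set (snd c ` (fst c \<inter> V))) (snd c)"
    by (simp only: subtopology_subtopology)
  then show ?thesis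
    using o is_chart_open_image[OF c o] V unfolding is_chart_def by (auto simp: openin_open_subtopology)
qed

lemma charted_open_sub:
  assumes "charted M" "openin (top_of M) V"
  shows "charted (open_sub M V)"
proof -
  have "(\<Union>c\<in>atlas M. fst c \<inter> V) = points M \<inter> V"
    using assms(1) unfolding charted_def by blast
  moreover have "\<forall>c\<in>atlas M. is_chart (subtopology (top_of M) V) (fst c \<inter> V, snd c)"
    using assms(1) is_chart_restrict[OF _ assms(2)] unfolding charted_def by blast
  ultimately show ?thesis
    by (simp add: charted_def open_sub_def image_image)
qed

lemma points_open_sub: "openin (top_of M) V \<Longrightarrow> points (open_sub M V) = V"
  using openin_subset by (fastforce simp: open_sub_def)

text \<open>The point at issue is \<open>chart_inv\<close>: for a restricted chart it inverts over a
  smaller set, and the two inverses agree only on the image of that set, which is open.\<close>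

lemma holo_at_open_sub:
  assumes M: "charted M" and V: "openin (top_of M) V" and x: "x \<in> V"
  shows "holo_at (open_sub M V) f x \<longleftrightarrow> holo_at M f x"
proof -
  have *: "hol_at (f \<circ> inv_into (fst c \<inter> V) (snd c)) (snd c x) \<longleftrightarrow> hol_at (f \<circ> chart_inv c) (snd c x)"
    if c: "c \<in> atlas M" "x \<in> fst c" for c
  proof -
    have cc: "is_chart (top_of M) c" using M c by (simp add: charted_def)
    have o: "open (snd c ` (fst c \<inter> V))"
      using is_chart_open_image[OF cc, of "fst c \<inter> V"] cc V by (auto simp: is_chart_def)
    have z: "snd c x \<in> snd c ` (fst c \<inter> V)" using c x by blast
    have e: "(f \<circ> inv_into (fst c \<inter> V) (snd c)) z = (f \<circ> chart_inv c) z" if zz: "z \<in> snd c ` (fst c \<inter> V)" for z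
    proof -
      obtain y where y: "y \<in> fst c \<inter> V" "z = snd c y" using zz by blast
      have "inv_into (fst c \<inter> V) (snd c) z = y"
        unfolding y(2) by (rule inv_into_f_f[OF inj_on_subset[OF is_chart_inj[OF cc]] y(1)]) blast
      moreover have "chart_inv c z = y" using y cc by simp
      ultimately show ?thesis by simp
    qed
    show ?thesis
    proof
      show "hol_at (f \<circ> chart_inv c) (snd c x)" if "hol_at (f \<circ> inv_into (fst c \<inter> V) (snd c)) (snd c x)"
        by (rule hol_at_cong_open(1)[OF o z e that])
      show "hol_at (f \<circ> inv_into (fst c \<inter> V) (snd c)) (snd c x)" if "hol_at (f \<circ> chart_inv c) (snd c x)"
        by (rule hol_at_cong_open(1)[OF o z e[symmetric] that])
    qed
  qed
  show ?thesis
    using * x by (simp add: holo_at_def open_sub_def)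
qed

text \<open>Records a local inverse \<open>s\<close> of \<open>F\<close> through its effect on open
  sets and on \<open>holo_at\<close> in the ambient spaces, so that later arguments avoid the charts
  of nested \<open>open_sub\<close>.\<close>

definition local_section ::
    "('b, 'd::finite) cspace \<Rightarrow> ('a, 'd) cspace \<Rightarrow> ('b \<Rightarrow> 'a) \<Rightarrow> 'b set \<Rightarrow> ('a \<Rightarrow> 'b) \<Rightarrow> bool" where
  "local_section N M F V s \<longleftrightarrow> openin (top_of N) V \<and> openin (top_of M) (F ` V) \<and> (\<forall>m\<in>V. s (F m) = m) \<and>
    (\<forall>A. openin (top_of N) A \<longrightarrow> openin (top_of M) {x \<in> F ` V. s x \<in> A}) \<and>
    (\<forall>A. openin (top_of M) A \<longrightarrow> openin (top_of N) {m \<in> V. F m \<in> A}) \<and>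
    (\<forall>f. \<forall>x\<in>F ` V. holo_at N f (s x) \<longrightarrow> holo_at M (f \<circ> s) x) \<and>
    (\<forall>f. \<forall>m\<in>V. holo_at M f (F m) \<longrightarrow> holo_at N (f \<circ> F) m)"

lemma locally_biholomorphic_section:
  assumes N: "complex_manifold N" and M: "complex_manifold M" and U: "openin (top_of M) U"
    and F: "locally_biholomorphic N (open_sub M U) F" and m: "m \<in> points N"
  shows "\<exists>V s. m \<in> V \<and> local_section N M F V s"
proof -
  note Nc = complex_manifold_charted[OF N] and Mc = complex_manifold_charted[OF M]
  obtain V where V: "openin (top_of N) V" "m \<in> V" and FV: "openin (top_of (open_sub M U)) (F ` V)"
    and b: "biholomorphism (open_sub N V) (open_sub (open_sub M U) (F ` V)) F"
    using F m unfolding locally_biholomorphic_def by blast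
  have FVU: "F ` V \<subseteq> U" and FVM: "openin (top_of M) (F ` V)"
    using FV U by (auto simp: open_sub_def openin_open_subtopology)
  define N' where "N' = open_sub N V"
  define M' where "M' = open_sub (open_sub M U) (F ` V)"
  have pN: "points N' = V" unfolding N'_def by (rule points_open_sub[OF V(1)])
  have pM: "points M' = F ` V" unfolding M'_def by (rule points_open_sub[OF FV])
  have cN: "charted N'" unfolding N'_def by (rule charted_open_sub[OF Nc V(1)])
  have cM: "charted M'" unfolding M'_def by (rule charted_open_sub[OF charted_open_sub[OF Mc U] FV])
  have hN: "holo_at N' f x \<longleftrightarrow> holo_at N f x" if "x \<in> V" for f x
    unfolding N'_def by (rule holo_at_open_sub[OF Nc V(1) that])
  have hM: "holo_at M' f x \<longleftrightarrow> holo_at M f x" if "x \<in> F ` V" for f x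
    using holo_at_open_sub[OF charted_open_sub[OF Mc U] FV that] holo_at_open_sub[OF Mc U, of x] FVU that
    unfolding M'_def by blast
  have tN: "top_of N' = subtopology (top_of N) V" by (simp add: N'_def open_sub_def)
  have tM: "top_of M' = subtopology (top_of M) (F ` V)"
    using FVU by (simp add: M'_def open_sub_def subtopology_subtopology Int_absorb1)
  obtain s where hF: "holo_map N' M' F" and hs: "holo_map M' N' s" and s: "\<And>m. m \<in> V \<Longrightarrow> s (F m) = m"
    using b unfolding biholomorphism_def N'_def[symmetric] M'_def[symmetric] pN by blast
  have os: "openin (top_of M) {x \<in> F ` V. s x \<in> A}" if A: "openin (top_of N) A" for A
  proof -
    have "continuous_map (top_of M') (top_of N') s" using hs by (simp add: holo_map_def)
    moreover have "openin (top_of N') (A \<inter> V)" unfolding tN using A by (auto simp: openin_subtopology)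
    ultimately have "openin (top_of M') {x \<in> points M'. s x \<in> A \<inter> V}"
      by (rule openin_continuous_map_preimage)
    moreover have "{x \<in> points M'. s x \<in> A \<inter> V} = {x \<in> F ` V. s x \<in> A}"
      unfolding pM using s by auto
    ultimately show ?thesis
      unfolding tM using FVM by (simp add: openin_open_subtopology)
  qed
  have oF: "openin (top_of N) {m \<in> V. F m \<in> A}" if A: "openin (top_of M) A" for A
  proof -
    have "continuous_map (top_of N') (top_of M') F" using hF by (simp add: holo_map_def)
    moreover have "openin (top_of M') (A \<inter> F ` V)" unfolding tM using A by (auto simp: openin_subtopology)
    ultimately have "openin (top_of N') {x \<in> points N'. F x \<in> A \<inter> F ` V}"
      by (rule openin_continuous_map_preimage)
    moreover have "{x \<in> points N'. F x \<in> A \<inter> F ` V} = {m \<in> V. F m \<in> A}"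
      unfolding pN by auto
    ultimately show ?thesis
      unfolding tN using V(1) by (simp add: openin_open_subtopology)
  qed
  have ps: "holo_at M (f \<circ> s) x" if "x \<in> F ` V" "holo_at N f (s x)" for f x
    using holo_at_pullback[OF cM cN hs, of x f] hM[OF that(1)] hN[of "s x"] that s unfolding pM by auto
  have pF: "holo_at N (f \<circ> F) m" if "m \<in> V" "holo_at M f (F m)" for f m
    using holo_at_pullback[OF cN cM hF, of m f] hN[OF that(1)] hM[of "F m"] that unfolding pN by auto
  have "local_section N M F V s"
    unfolding local_section_def by (intro conjI V(1) FVM ballI allI impI s os oF ps pF; assumption)
  then show ?thesis using V(2) by blast
qed

lemma local_sectionD:
  assumes "local_section N M F V s"
  shows "openin (top_of N) V" "openin (top_of M) (F ` V)" "m \<in> V \<Longrightarrow> s (F m) = m"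
    "openin (top_of N) A \<Longrightarrow> openin (top_of M) {x \<in> F ` V. s x \<in> A}"
    "openin (top_of M) B \<Longrightarrow> openin (top_of N) {m \<in> V. F m \<in> B}"
    "x \<in> F ` V \<Longrightarrow> holo_at N f (s x) \<Longrightarrow> holo_at M (f \<circ> s) x"
    "m \<in> V \<Longrightarrow> holo_at M g (F m) \<Longrightarrow> holo_at N (g \<circ> F) m"
  using assms unfolding local_section_def by (simp_all del: ball_simps)

lemma local_section_restrict:
  assumes s: "local_section N M F V s" and W: "openin (top_of N) W"
  shows "local_section N M F (V \<inter> W) s"
proof -
  have e: "{x \<in> F ` (V \<inter> W). s x \<in> A} = {x \<in> F ` V. s x \<in> W \<inter> A}" for A
    using local_sectionD(3)[OF s] by auto
  have e': "F ` (V \<inter> W) = {x \<in> F ` V. s x \<in> W}"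
    using local_sectionD(3)[OF s] by auto
  have e'': "{m \<in> V \<inter> W. F m \<in> A} = W \<inter> {m \<in> V. F m \<in> A}" for A
    by auto
  show ?thesis
    unfolding local_section_def e e''
  proof (intro conjI allI ballI impI)
    show "openin (top_of N) (V \<inter> W)" using local_sectionD(1)[OF s] W by blast
    show "openin (top_of M) (F ` (V \<inter> W))" unfolding e' by (rule local_sectionD(4)[OF s W])
    show "openin (top_of M) {x \<in> F ` V. s x \<in> W \<inter> A}" if "openin (top_of N) A" for A
      using W that by (intro local_sectionD(4)[OF s]) blast
    show "openin (top_of N) (W \<inter> {m \<in> V. F m \<in> A})" if "openin (top_of M) A" for A
      using W local_sectionD(5)[OF s that] by blast
  qed (use local_sectionD(3,6,7)[OF s] in auto)
qed

text \<open>The differential of a composite is the differential of the function after a Jacobian, so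
  vanishing is inherited along \<open>F\<close> and along \<open>s\<close>. The use is
  contrapositive: nonzero differentials stay nonzero in both directions.\<close>

lemma local_section_grad:
  fixes M :: "('a, 'k::finite) cspace"
  assumes M: "complex_manifold M" and N: "complex_manifold N" and s: "local_section N M F V s" "m \<in> V"
    and c: "c \<in> charts N" "m \<in> fst c" and d: "d \<in> charts M" "F m \<in> fst d"
  shows "holo_at M f (F m) \<Longrightarrow> grad (f \<circ> chart_inv d) (snd d (F m)) = 0 \<Longrightarrow>
      grad (f \<circ> F \<circ> chart_inv c) (snd c m) = 0"
    and "holo_at N g m \<Longrightarrow> grad (g \<circ> chart_inv c) (snd c m) = 0 \<Longrightarrow>
      grad (g \<circ> s \<circ> chart_inv d) (snd d (F m)) = 0"
proof -
  have zero: "a = 0" if "\<And>w. cdot a w = 0" for a :: "complex^'k"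
    using that[of "axis _ 1"] by (simp add: vec_eq_iff)
  have oc: "openin (top_of N) (fst c)" and od: "openin (top_of M) (fst d)"
    using chartsD[OF c(1)] chartsD[OF d(1)] by (auto simp: is_chart_def)
  have sm: "s (F m) = m" using local_sectionD(3)[OF s] .
  show "grad (f \<circ> F \<circ> chart_inv c) (snd c m) = 0"
    if f: "holo_at M f (F m)" "grad (f \<circ> chart_inv d) (snd d (F m)) = 0"
  proof -
    have "openin (top_of N) (fst c \<inter> {m \<in> V. F m \<in> fst d})"
      using oc local_sectionD(5)[OF s(1) od] by blast
    moreover have "m \<in> fst c \<inter> {m \<in> V. F m \<in> fst d}" using s c d by blast
    moreover have "fst c \<inter> {m \<in> V. F m \<in> fst d} \<subseteq> fst c" "F ` (fst c \<inter> {m \<in> V. F m \<in> fst d}) \<subseteq> fst d"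
      by auto
    moreover have "hol_at (\<lambda>z. (snd d \<circ> F \<circ> chart_inv c) z $ i) (snd c m)" for i
      using local_sectionD(7)[OF s holo_at_coordinate[OF d, of i]]
      unfolding holo_at_in_chart[OF N c] by (simp add: o_def)
    ultimately have "cdot (grad (f \<circ> F \<circ> chart_inv c) (snd c m)) w = 0" for w
      using local_chart_chain_rule(2)[OF chartsD[OF c(1)] chartsD[OF d(1)], of "fst c \<inter> {m \<in> V. F m \<in> fst d}" m F f w]
        f[unfolded holo_at_in_chart[OF M d]] by simp
    then show ?thesis by (rule zero)
  qed
  show "grad (g \<circ> s \<circ> chart_inv d) (snd d (F m)) = 0"
    if g: "holo_at N g m" "grad (g \<circ> chart_inv c) (snd c m) = 0"
  proof -
    have "openin (top_of M) (fst d \<inter> {x \<in> F ` V. s x \<in> fst c})"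
      using od local_sectionD(4)[OF s(1) oc] by blast
    moreover have "F m \<in> fst d \<inter> {x \<in> F ` V. s x \<in> fst c}" using s c d sm by auto
    moreover have "fst d \<inter> {x \<in> F ` V. s x \<in> fst c} \<subseteq> fst d" "s ` (fst d \<inter> {x \<in> F ` V. s x \<in> fst c}) \<subseteq> fst c"
      by auto
    moreover have "hol_at (\<lambda>z. (snd c \<circ> s \<circ> chart_inv d) z $ i) (snd d (F m))" for i
      using local_sectionD(6)[OF s(1) imageI[OF s(2)], of "\<lambda>y. snd c y $ i"] holo_at_coordinate[OF c, of i]
      unfolding sm holo_at_in_chart[OF M d] by (simp add: o_def)
    ultimately have "cdot (grad (g \<circ> s \<circ> chart_inv d) (snd d (F m))) w = 0" for w
      using local_chart_chain_rule(2)[OF chartsD[OF d(1)] chartsD[OF c(1)], of "fst d \<inter> {x \<in> F ` V. s x \<in> fst c}" "F m" s g w]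
        g[unfolded holo_at_in_chart[OF N c]] sm by simp
    then show ?thesis by (rule zero)
  qed
qed

section \<open>The fibrewise geometric mean of the vertical coordinate\<close>

text \<open>Since \<open>cmod (t x) = 1\<close>, the transition rule for the vertical coordinates
  becomes an equality of moduli, on the whole overlap and not just along the submanifold.\<close>

lemma vertical_linearisation_modulus:
  fixes M :: "('m, ('n::finite) option) cspace" and C :: "('c, 'n) cspace"
  assumes "vertical_linearisation M C \<iota>"
  shows "\<exists>\<V>\<subseteq>adapted_charts M C \<iota>. \<iota> ` points C \<subseteq> (\<Union>c\<in>\<V>. fst c) \<and>
    (\<forall>c\<in>\<V>. \<forall>d\<in>\<V>. \<forall>m\<in>fst c \<inter> fst d. cmod (ver (snd c m)) = cmod (ver (snd d m)))"
  using assms unfolding vertical_linearisation_def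
proof (elim exE conjE, intro exI conjI ballI)
  fix \<V> c d m assume cdm: "c \<in> (\<V> :: ('m, 'n option) chart set)" "d \<in> \<V>" "m \<in> fst c \<inter> fst d"
  assume lin: "\<forall>c\<in>\<V>. \<forall>d\<in>\<V>. \<exists>(\<phi> :: complex^'n \<Rightarrow> complex^'n) \<phi>' (t :: 'm \<Rightarrow> complex).
           \<phi> holo_on (hor ` snd c ` (fst c \<inter> fst d)) \<and>
           \<phi>' holo_on (snd c ` (fst c \<inter> fst d)) \<and>
           (\<forall>z\<in>snd c ` (fst c \<inter> fst d). ver z = 0 \<longrightarrow> \<phi>' z = 0) \<and>
           locally_constant_on (top_of M) (fst c \<inter> fst d) t \<and>
           (\<forall>x\<in>fst c \<inter> fst d. cmod (t x) = 1 \<and>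
              hor (snd d x) = \<phi> (hor (snd c x)) + \<phi>' (snd c x) \<and>
              ver (snd d x) = t x * ver (snd c x)) \<and>
           (\<forall>y\<in>points C. \<iota> y \<in> fst c \<inter> fst d \<longrightarrow>
              btrans (normal_bundle M C \<iota>) d c y $ 1 $ 1 = t (\<iota> y))"
  from bspec[OF bspec[OF lin cdm(1)] cdm(2)]
  show "cmod (ver (snd c m)) = cmod (ver (snd d m))"
    using cdm(3) by (elim exE conjE) (simp add: norm_mult)
qed

text \<open>\<open>D\<close> and \<open>N\<close> stand for \<open>Chat\<close> and
  \<open>Mhat\<close>, and \<open>\<V>\<close> for the charts of the vertical linearisation;
  \<open>modulus\<close> is what \<open>vertical_linearisation_modulus\<close> provides.\<close>

locale covered_neighborhood =
  fixes M :: "('m, ('n::finite) option) cspace" and C :: "('c, 'n) cspace" and \<iota> :: "'c \<Rightarrow> 'm"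
    and D :: "('d, 'n) cspace" and p :: "'d \<Rightarrow> 'c"
    and N :: "('m \<times> 'd, 'n option) cspace" and U :: "'m set" and \<pi> :: "'m \<Rightarrow> 'c"
    and \<V> :: "('m \<times> 'd, 'n option) chart set"
  assumes M: "complex_manifold M" and N: "complex_manifold N"
    and cover: "finite_etale_cover D C p"
    and U: "openin (top_of M) U" and \<iota>U: "\<iota> ` points C \<subseteq> U"
    and \<pi>: "continuous_map (subtopology (top_of M) U) (top_of C) \<pi>"
    and \<pi>\<iota>: "\<And>x. x \<in> points C \<Longrightarrow> \<pi> (\<iota> x) = x"
    and topN: "top_of N = subtopology (prod_topology (subtopology (top_of M) U) (top_of D)) {(x, y). \<pi> x = p y}"
    and lb: "locally_biholomorphic N (open_sub M U) fst"
    and adapted: "\<V> \<subseteq> adapted_charts N D (\<lambda>y. (\<iota> (p y), y))"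
    and covering: "(\<lambda>y. (\<iota> (p y), y)) ` points D \<subseteq> (\<Union>c\<in>\<V>. fst c)"
    and modulus: "\<And>c d m. c \<in> \<V> \<Longrightarrow> d \<in> \<V> \<Longrightarrow> m \<in> fst c \<Longrightarrow> m \<in> fst d \<Longrightarrow>
      cmod (ver (snd c m)) = cmod (ver (snd d m))"
begin

text \<open>The chosen chart does not matter, by \<open>vmod_eq\<close>; at points outside all
  charts of \<open>\<V>\<close> the value is arbitrary.\<close>

definition vmod :: "'m \<times> 'd \<Rightarrow> real" where
  "vmod m = cmod (ver (snd (SOME c. c \<in> \<V> \<and> m \<in> fst c) m))"

text \<open>For \<open>x\<close> in \<open>U\<close> these are the second components of the points
  of \<open>N\<close> above \<open>x\<close>, as \<open>N\<close> is the fibre product of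
  \<open>\<pi>\<close> and \<open>p\<close>.\<close>

definition fibre :: "'m \<Rightarrow> 'd set" where
  "fibre x = {y \<in> points D. p y = \<pi> x}"

definition mean_modulus :: "'m \<Rightarrow> real" where
  "mean_modulus x = root (card (fibre x)) (\<Prod>y\<in>fibre x. vmod (x, y))"

lemma vmod_eq: "c \<in> \<V> \<Longrightarrow> m \<in> fst c \<Longrightarrow> vmod m = cmod (ver (snd c m))"
  unfolding vmod_def using someI[of "\<lambda>c. c \<in> \<V> \<and> m \<in> fst c" c] modulus by blast

lemma points_N: "(x, y) \<in> points N \<longleftrightarrow> x \<in> U \<and> y \<in> points D \<and> \<pi> x = p y"
  using openin_subset[OF U] by (auto simp: topN)

lemma \<V>_charts: "c \<in> \<V> \<Longrightarrow> c \<in> charts N"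
  using adapted by (auto simp: adapted_charts_def)

lemma p_points: "y \<in> points D \<Longrightarrow> p y \<in> points C"
  using cover by (auto simp: finite_etale_cover_def)

text \<open>The embedded copy of \<open>D\<close> is the full preimage of \<open>C\<close> in
  \<open>N\<close>: if the first component is \<open>\<iota> q\<close>, the fibre product forces
  \<open>p y = \<pi> (\<iota> q) = q\<close>. Hence the zero set of \<open>v\<close> descends to
  \<open>C\<close>.\<close>

lemma ver_zero_iff:
  assumes c: "c \<in> \<V>" and m: "m \<in> fst c"
  shows "ver (snd c m) = 0 \<longleftrightarrow> fst m \<in> \<iota> ` points C"
proof -
  obtain x y where xy: "m = (x, y)" by (cases m)
  have "m \<in> points N" using chart_domain_subset[OF chartsD[OF \<V>_charts[OF c]]] m by blast
  then have y: "y \<in> points D" "\<pi> x = p y" using points_N xy by auto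
  have "m \<in> (\<lambda>y. (\<iota> (p y), y)) ` points D \<longleftrightarrow> x \<in> \<iota> ` points C"
  proof
    show "x \<in> \<iota> ` points C" if "m \<in> (\<lambda>y. (\<iota> (p y), y)) ` points D"
      using that xy p_points by auto
    show "m \<in> (\<lambda>y. (\<iota> (p y), y)) ` points D" if x: "x \<in> \<iota> ` points C"
    proof -
      obtain q where "q \<in> points C" "x = \<iota> q" using x by blast
      then have "x = \<iota> (p y)" using y \<pi>\<iota> by metis
      then show ?thesis using xy y by blast
    qed
  qed
  then show ?thesis using adapted c m xy by (auto simp: adapted_charts_def)
qed

text \<open>Provides a sheet of \<open>N\<close> over \<open>M\<close> small enough to lie in one
  linearising chart and, in its second component, in a prescribed sheet of \<open>p\<close>.\<close>

lemma sheet_section: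
  assumes A: "openin (top_of D) A" and y: "y \<in> A"
  shows "\<exists>c V s. c \<in> \<V> \<and> (\<iota> (p y), y) \<in> V \<and> V \<subseteq> fst c \<and> snd ` V \<subseteq> A \<and> local_section N M fst V s"
proof -
  have yD: "y \<in> points D" using openin_subset[OF A] y by blast
  then obtain c where c: "c \<in> \<V>" "(\<iota> (p y), y) \<in> fst c"
    using covering by blast
  have cN: "openin (top_of N) (fst c)"
    using chartsD[OF \<V>_charts[OF c(1)]] by (simp add: is_chart_def)
  then have m: "(\<iota> (p y), y) \<in> points N" using openin_subset c by blast
  obtain V s where V: "(\<iota> (p y), y) \<in> V" "local_section N M fst V s"
    using locally_biholomorphic_section[OF N M U lb m] by blast
  have "continuous_map (top_of N) (top_of D) snd"
    unfolding topN by (intro continuous_map_from_subtopology continuous_map_snd)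
  then have "openin (top_of N) {m \<in> points N. snd m \<in> A}"
    using A by (rule openin_continuous_map_preimage)
  then have W: "openin (top_of N) (fst c \<inter> {m \<in> points N. snd m \<in> A})"
    using cN by blast
  define V' where "V' = V \<inter> (fst c \<inter> {m \<in> points N. snd m \<in> A})"
  have "local_section N M fst V' s"
    unfolding V'_def by (rule local_section_restrict[OF V(2) W])
  moreover have "(\<iota> (p y), y) \<in> V'" "snd ` V' \<subseteq> A" "V' \<subseteq> fst c"
    using V c m y by (auto simp: V'_def)
  ultimately show ?thesis
    using c(1) by metis
qed

text \<open>Reindexes the sheets of an evenly covered neighborhood by the points over
  \<open>q\<close>. The last clause is saturation: a fibre of \<open>p\<close> meeting one sheet
  lies in their union, so no point is missed when the product over a nearby fibre is taken sheet by
  sheet.\<close>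

lemma evenly_covered_sheets:
  assumes q: "q \<in> points C"
  shows "\<exists>A. finite (p -` {q} \<inter> points D) \<and> p -` {q} \<inter> points D \<noteq> {} \<and>
    (\<forall>y\<in>p -` {q} \<inter> points D. openin (top_of D) (A y) \<and> y \<in> A y \<and> inj_on p (A y)) \<and>
    (\<forall>y\<in>p -` {q} \<inter> points D. \<forall>y'\<in>p -` {q} \<inter> points D. y \<noteq> y' \<longrightarrow> A y \<inter> A y' = {}) \<and>
    (\<forall>y\<in>p -` {q} \<inter> points D. \<forall>u\<in>A y. {w \<in> points D. p w = p u} \<subseteq> (\<Union>y\<in>p -` {q} \<inter> points D. A y))"
proof -
  define I where "I = p -` {q} \<inter> points D"
  have "\<exists>W \<V>. openin (top_of C) W \<and> q \<in> W \<and> finite \<V> \<and> disjoint \<V> \<and>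
        (\<forall>V\<in>\<V>. openin (top_of D) V \<and>
           homeomorphic_map (subtopology (top_of D) V) (subtopology (top_of C) W) p) \<and>
        \<Union>\<V> = {y\<in>points D. p y \<in> W}"
    using cover q by (simp add: finite_etale_cover_def)
  then obtain W \<S> where W: "openin (top_of C) W" "q \<in> W" and fin: "finite \<S>" and dj: "disjoint \<S>"
    and oh: "\<forall>V\<in>\<S>. openin (top_of D) V \<and>
           homeomorphic_map (subtopology (top_of D) V) (subtopology (top_of C) W) p"
    and un: "\<Union>\<S> = {y \<in> points D. p y \<in> W}"
    by (elim exE conjE) (rule that)
  have o: "openin (top_of D) V"
    and h: "homeomorphic_map (subtopology (top_of D) V) (subtopology (top_of C) W) p" if "V \<in> \<S>" for V
    using oh that by simp_all
  have tW: "points C \<inter> W = W" using openin_subset[OF W(1)] by blast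
  have tV: "points D \<inter> V = V" if "V \<in> \<S>" for V using openin_subset[OF o[OF that]] by blast
  have inj: "inj_on p V" and im: "p ` V = W" if "V \<in> \<S>" for V
    using homeomorphic_imp_injective_map[OF h[OF that]] homeomorphic_imp_surjective_map[OF h[OF that]]
    by (simp_all add: tV[OF that] tW)
  have "\<exists>V\<in>\<S>. y \<in> V" if "y \<in> I" for y
    using that un W by (auto simp: I_def)
  then obtain A where A: "\<And>y. y \<in> I \<Longrightarrow> A y \<in> \<S>" "\<And>y. y \<in> I \<Longrightarrow> y \<in> A y" by metis
  have pq: "p y = q" if "y \<in> I" for y using that by (simp add: I_def)
  \<comment> \<open>One sheet cannot contain two points over \<open>q\<close>, as \<open>p\<close>
    is injective on it.\<close>
  have ne: "A y \<noteq> A y'" if "y \<in> I" "y' \<in> I" "y \<noteq> y'" for y y'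
    using inj[OF A(1)[OF that(1)]] A(2)[OF that(1)] A(2)[OF that(2)] pq that by (metis inj_onD)
  then have "inj_on A I" by (auto simp: inj_on_def)
  then have finI: "finite I" using fin A(1) by (metis finite_imageD finite_subset image_subsetI)
  have I0: "I \<noteq> {}"
  proof -
    have "q \<in> p ` points D" using cover q by (simp add: finite_etale_cover_def)
    then show ?thesis by (auto simp: I_def)
  qed
  have disj: "A y \<inter> A y' = {}" if "y \<in> I" "y' \<in> I" "y \<noteq> y'" for y y'
    using dj ne[OF that] A(1) that by (simp add: pairwise_def disjnt_def)
  have sat: "{w \<in> points D. p w = p u} \<subseteq> (\<Union>y\<in>I. A y)" if "y \<in> I" "u \<in> A y" for y u
  proof
    fix w assume w: "w \<in> {w \<in> points D. p w = p u}"
    then have "p w \<in> W" using im[OF A(1)[OF that(1)]] that by auto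
    then obtain V where V: "V \<in> \<S>" "w \<in> V" using un w by blast
    obtain y' where y': "y' \<in> V" "p y' = q" using im[OF V(1)] W(2) by (metis imageE)
    then have y'I: "y' \<in> I" using openin_subset[OF o[OF V(1)]] by (auto simp: I_def)
    \<comment> \<open>Both sets belong to the disjoint family and contain \<open>y'\<close>.\<close>
    have "A y' = V"
      using dj A[OF y'I] V(1) y'(1) by (auto simp: pairwise_def disjnt_def)
    then show "w \<in> (\<Union>y\<in>I. A y)" using V y'I by blast
  qed
  show ?thesis
    unfolding I_def[symmetric]
    by (rule exI[of _ A]) (intro conjI ballI impI finI I0 disj sat o inj A; assumption)
qed

text \<open>Each sheet over \<open>q\<close> pushes its vertical coordinate down to a function
  \<open>w y\<close> on \<open>M\<close> near \<open>\<iota> q\<close>. Their geometric mean is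
  formed upstairs, in the chart of one sheet \<open>y1\<close>, because there \<open>C\<close> is
  the coordinate hyperplane that \<open>holomorphic_geometric_mean\<close> requires; the result
  returns to \<open>M\<close> through the section of that sheet.\<close>

lemma defining_function_near:
  assumes q: "q \<in> points C"
  shows "\<iota> q \<in> defining_domain M mean_modulus (\<iota> ` points C)"
proof -
  define S where "S = \<iota> ` points C"
  define I where "I = p -` {q} \<inter> points D"
  obtain A where fin: "finite I" "I \<noteq> {}"
    and A_all: "\<forall>y\<in>I. openin (top_of D) (A y) \<and> y \<in> A y \<and> inj_on p (A y)"
    and disj_all: "\<forall>y\<in>I. \<forall>y'\<in>I. y \<noteq> y' \<longrightarrow> A y \<inter> A y' = {}"
    and sat_all: "\<forall>y\<in>I. \<forall>u\<in>A y. {w \<in> points D. p w = p u} \<subseteq> (\<Union>y\<in>I. A y)"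
    using evenly_covered_sheets[OF q] unfolding I_def[symmetric] by (elim exE conjE) (rule that)
  have A: "openin (top_of D) (A y)" "y \<in> A y" "inj_on p (A y)" if "y \<in> I" for y
    using A_all that by simp_all
  have disj: "A y \<inter> A y' = {}" if "y \<in> I" "y' \<in> I" "y \<noteq> y'" for y y'
    using disj_all that by simp
  have sat: "{w \<in> points D. p w = p u} \<subseteq> (\<Union>y\<in>I. A y)" if "y \<in> I" "u \<in> A y" for y u
    using sat_all that by simp
  have pq: "p y = q" if "y \<in> I" for y using that by (simp add: I_def)
  \<comment> \<open>Chart, domain and section are packed into one triple so that they are chosen
    together for each \<open>y\<close>.\<close>
  have "\<forall>y\<in>I. \<exists>d. fst d \<in> \<V> \<and> (\<iota> q, y) \<in> fst (snd d) \<and> fst (snd d) \<subseteq> fst (fst d) \<and> snd ` fst (snd d) \<subseteq> A y \<and>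
      local_section N M fst (fst (snd d)) (snd (snd d))"
  proof
    fix y assume y: "y \<in> I"
    obtain c V s where "c \<in> \<V>" "(\<iota> (p y), y) \<in> V" "V \<subseteq> fst c" "snd ` V \<subseteq> A y" "local_section N M fst V s"
      using sheet_section[OF A(1,2)[OF y]] by (elim exE conjE) (rule that)
    then show "\<exists>d. fst d \<in> \<V> \<and> (\<iota> q, y) \<in> fst (snd d) \<and> fst (snd d) \<subseteq> fst (fst d) \<and> snd ` fst (snd d) \<subseteq> A y \<and>
      local_section N M fst (fst (snd d)) (snd (snd d))"
      using pq[OF y] by (intro exI[of _ "(c, V, s)"]) simp
  qed
  from bchoice[OF this] obtain d where d: "\<forall>y\<in>I. fst (d y) \<in> \<V> \<and> (\<iota> q, y) \<in> fst (snd (d y)) \<and>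
      fst (snd (d y)) \<subseteq> fst (fst (d y)) \<and> snd ` fst (snd (d y)) \<subseteq> A y \<and>
      local_section N M fst (fst (snd (d y))) (snd (snd (d y)))" ..
  define c where "c y = fst (d y)" for y
  define V where "V y = fst (snd (d y))" for y
  define s where "s y = snd (snd (d y))" for y
  have c\<V>: "c y \<in> \<V>" and mV: "(\<iota> q, y) \<in> V y" and Vc: "V y \<subseteq> fst (c y)" and VA: "snd ` V y \<subseteq> A y"
    and ls: "local_section N M fst (V y) (s y)" if "y \<in> I" for y
    using bspec[OF d that] by (simp_all add: c_def V_def s_def)
  have cN: "c y \<in> charts N" if "y \<in> I" for y by (rule \<V>_charts[OF c\<V>[OF that]])
  have Vpt: "V y \<subseteq> points N" if "y \<in> I" for y by (rule openin_subset[OF local_sectionD(1)[OF ls[OF that]]])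
  define w where "w y x = ver (snd (c y) (s y x))" for y x
  \<comment> \<open>All sections are defined here; finiteness of \<open>I\<close> keeps the
    intersection open.\<close>
  define T1 where "T1 = (\<Inter>y\<in>I. fst ` V y)"
  have T1: "openin (top_of M) T1"
    unfolding T1_def by (rule openin_INT2[OF fin local_sectionD(2)[OF ls]])
  have qT1: "\<iota> q \<in> T1"
    unfolding T1_def using mV by force
  have sx: "s y x \<in> V y" "fst (s y x) = x" if "y \<in> I" "x \<in> T1" for x y
  proof -
    have "x \<in> fst ` V y" using that by (simp add: T1_def)
    then show "s y x \<in> V y" "fst (s y x) = x"
      using local_sectionD(3)[OF ls[OF that(1)]] by auto
  qed
  have w_zero: "w y x = 0 \<longleftrightarrow> x \<in> S" if "y \<in> I" "x \<in> T1" for x y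
    using ver_zero_iff[OF c\<V>[OF that(1)], of "s y x"] sx[OF that] Vc[OF that(1)]
    by (auto simp: w_def S_def)

  text \<open>The sheets through the points of \<open>I\<close> parametrise the fibres over \<open>T1\<close>.\<close>
  have mean: "mean_modulus x = root (card I) (\<Prod>y\<in>I. cmod (w y x))" if x: "x \<in> T1" for x
  proof -
    define \<eta> where "\<eta> y = snd (s y x)" for y
    have s\<eta>: "s y x = (x, \<eta> y)" if "y \<in> I" for y
      using sx[OF that x] by (simp add: \<eta>_def prod_eq_iff)
    have \<eta>A: "\<eta> y \<in> A y" if "y \<in> I" for y
      using sx(1)[OF that x] VA[OF that] by (auto simp: \<eta>_def)
    have \<eta>f: "\<eta> y \<in> fibre x" if "y \<in> I" for y
      using sx(1)[OF that x] Vpt[OF that] points_N[of x "\<eta> y"] s\<eta>[OF that] by (auto simp: fibre_def)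
    have inj: "inj_on \<eta> I"
      using \<eta>A disj by (metis disjoint_iff inj_onI)
    \<comment> \<open>Saturation puts each point of the fibre into some sheet, and injectivity of
      \<open>p\<close> there identifies it with the value of the section.\<close>
    have "fibre x \<subseteq> \<eta> ` I"
    proof
      fix u assume u: "u \<in> fibre x"
      obtain y0 where y0: "y0 \<in> I" using fin by blast
      have "u \<in> (\<Union>y\<in>I. A y)"
        using sat[OF y0 \<eta>A[OF y0]] \<eta>f[OF y0] u by (auto simp: fibre_def)
      then obtain y where y: "y \<in> I" "u \<in> A y" by blast
      have "p u = p (\<eta> y)" using u \<eta>f[OF y(1)] by (simp add: fibre_def)
      then have "u = \<eta> y" using inj_onD[OF A(3)[OF y(1)]] y(2) \<eta>A[OF y(1)] by blast
      then show "u \<in> \<eta> ` I" using y by blast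
    qed
    then have fib: "fibre x = \<eta> ` I" using \<eta>f by blast
    have "(\<Prod>u\<in>fibre x. vmod (x, u)) = (\<Prod>y\<in>I. vmod (x, \<eta> y))"
      unfolding fib by (rule prod.reindex[OF inj, unfolded o_def])
    also have "\<dots> = (\<Prod>y\<in>I. cmod (w y x))"
    proof (rule prod.cong[OF refl])
      fix y assume y: "y \<in> I"
      have "s y x \<in> fst (c y)" using sx(1)[OF y x] Vc[OF y] by blast
      then show "vmod (x, \<eta> y) = cmod (w y x)"
        using vmod_eq[OF c\<V>[OF y]] s\<eta>[OF y] by (simp add: w_def)
    qed
    finally show ?thesis
      using card_image[OF inj] by (simp add: mean_modulus_def fib)
  qed

  have hw: "holo_at M (w y) x" if "y \<in> I" "x \<in> T1" for x y
  proof -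
    have "s y x \<in> fst (c y)" using sx(1)[OF that] Vc[OF that(1)] by blast
    then have "holo_at N (\<lambda>m. snd (c y) m $ None) (s y x)"
      by (rule holo_at_coordinate[OF cN[OF that(1)]])
    moreover have "x \<in> fst ` V y" using that by (simp add: T1_def)
    ultimately have "holo_at M ((\<lambda>m. snd (c y) m $ None) \<circ> s y) x"
      by (intro local_sectionD(6)[OF ls[OF that(1)]])
    moreover have "(\<lambda>m. snd (c y) m $ None) \<circ> s y = w y" by (simp add: fun_eq_iff w_def ver_def)
    ultimately show ?thesis by simp
  qed
  obtain e where e: "e \<in> charts M" "\<iota> q \<in> fst e"
  proof -
    have "\<iota> q \<in> points M" using \<iota>U q openin_subset[OF U] by blast
    then obtain e where "e \<in> atlas M" "\<iota> q \<in> fst e"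
      using chart_at[OF complex_manifold_charted[OF M]] by blast
    then show ?thesis using that atlas_subset_charts[OF M] by blast
  qed
  \<comment> \<open>Composed with \<open>fst\<close>, the function \<open>w y\<close> is the
    vertical coordinate of its own sheet, whose gradient in its chart is
    \<open>axis None 1\<close>.\<close>
  have dw: "grad (w y \<circ> chart_inv e) (snd e (\<iota> q)) \<noteq> 0" if y: "y \<in> I" for y
  proof
    assume 0: "grad (w y \<circ> chart_inv e) (snd e (\<iota> q)) = 0"
    have mc: "(\<iota> q, y) \<in> fst (c y)" using mV[OF y] Vc[OF y] by blast
    have g0: "grad (w y \<circ> fst \<circ> chart_inv (c y)) (snd (c y) (\<iota> q, y)) = 0"
      using local_section_grad(1)[OF M N ls[OF y] mV[OF y] cN[OF y] mc e(1), of "w y"] e(2) hw[OF y qT1] 0 by simp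
    have "grad ((w y \<circ> fst) \<circ> chart_inv (c y)) (snd (c y) (\<iota> q, y)) =
        grad ((\<lambda>m. snd (c y) m $ None) \<circ> chart_inv (c y)) (snd (c y) (\<iota> q, y))"
    proof (rule hol_at_chart_cong(2)[OF chartsD[OF cN[OF y]] local_sectionD(1)[OF ls[OF y]] mV[OF y] mc])
      show "snd (c y) m $ None = (w y \<circ> fst) m" if "m \<in> V y" for m
        using local_sectionD(3)[OF ls[OF y] that] by (simp add: w_def ver_def)
      show "hol_at ((\<lambda>m. snd (c y) m $ None) \<circ> chart_inv (c y)) (snd (c y) (\<iota> q, y))"
        using holo_at_coordinate[OF cN[OF y] mc] holo_at_in_chart[OF N cN[OF y] mc] by blast
    qed
    then have "cdot 0 (axis None 1) = (axis None (1::complex) :: complex^'n option) $ None"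
      using grad_coordinate[OF chartsD[OF cN[OF y]] mc, of None "axis None 1"] g0 by simp
    then show False by simp
  qed

  \<comment> \<open>Any sheet will do: all \<open>w y\<close> are moved to its chart, including
    those that come from other sheets.\<close>
  obtain y1 where y1: "y1 \<in> I" using fin by blast
  define c1 where "c1 = c y1"
  define V1 where "V1 = V y1"
  define s1 where "s1 = s y1"
  note c1N = cN[OF y1, folded c1_def] and ls1 = ls[OF y1, folded V1_def s1_def]
    and m1V = mV[OF y1, folded V1_def] and V1c = Vc[OF y1, folded V1_def c1_def]
  have c1X: "is_chart (top_of N) c1" by (rule chartsD[OF c1N])
  have m1c: "(\<iota> q, y1) \<in> fst c1" using m1V V1c by blast
  define z0 where "z0 = snd c1 (\<iota> q, y1)"
  define g where "g y = w y \<circ> fst \<circ> chart_inv c1" for y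
  define S0 where "S0 = snd c1 ` {m \<in> V1. fst m \<in> T1}"
  have S0: "open S0" "z0 \<in> S0"
    using is_chart_open_image[OF c1X local_sectionD(5)[OF ls1 T1]] V1c m1V qT1
    by (auto simp: S0_def z0_def)
  have gz: "g y (snd c1 m) = w y (fst m)" if "m \<in> V1" for y m
    using is_chart_inv[OF c1X subsetD[OF V1c that]] by (simp add: g_def)
  have none: "snd c1 m $ None = 0 \<longleftrightarrow> fst m \<in> S" if "m \<in> V1" for m
    using ver_zero_iff[OF c\<V>[OF y1, folded c1_def] subsetD[OF V1c that]] by (simp add: ver_def S_def)
  have hg: "hol_at (g y) z" if "y \<in> I" "z \<in> S0" for y z
  proof -
    obtain m where m: "m \<in> V1" "fst m \<in> T1" "z = snd c1 m" using \<open>z \<in> S0\<close> by (auto simp: S0_def)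
    have "holo_at N (w y \<circ> fst) m" by (rule local_sectionD(7)[OF ls1 m(1) hw[OF that(1) m(2)]])
    then show ?thesis
      using holo_at_in_chart[OF N c1N] m V1c unfolding g_def by blast
  qed
  have g0: "g y z = 0" if "y \<in> I" "z \<in> S0" "z $ None = 0" for y z
  proof -
    obtain m where m: "m \<in> V1" "fst m \<in> T1" "z = snd c1 m" using \<open>z \<in> S0\<close> by (auto simp: S0_def)
    then show ?thesis using none[OF m(1)] w_zero[OF that(1) m(2)] gz[OF m(1)] that(3) by simp
  qed
  \<comment> \<open>Going up to the sheet \<open>y1\<close> and back by \<open>s1\<close> leaves
    \<open>w y\<close> unchanged on \<open>T1\<close>, so a zero gradient upstairs would contradict
    \<open>dw\<close>.\<close>
  have dg: "grad (g y) z0 \<noteq> 0" if y: "y \<in> I" for y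
  proof
    assume "grad (g y) z0 = 0"
    moreover have "holo_at N (w y \<circ> fst) (\<iota> q, y1)"
      using local_sectionD(7)[OF ls1 m1V, of "w y"] hw[OF y qT1] by simp
    ultimately have 0: "grad ((w y \<circ> fst) \<circ> s1 \<circ> chart_inv e) (snd e (\<iota> q)) = 0"
      using local_section_grad(2)[OF M N ls1 m1V c1N m1c e(1), of "w y \<circ> fst"] e(2) by (simp add: g_def z0_def)
    have "grad ((w y \<circ> fst \<circ> s1) \<circ> chart_inv e) (snd e (\<iota> q)) = grad (w y \<circ> chart_inv e) (snd e (\<iota> q))"
    proof (rule hol_at_chart_cong(2)[OF chartsD[OF e(1)] T1 qT1 e(2)])
      show "w y x = (w y \<circ> fst \<circ> s1) x" if "x \<in> T1" for x
        using sx(2)[OF y1 that] by (simp add: s1_def)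
      show "hol_at (w y \<circ> chart_inv e) (snd e (\<iota> q))"
        using hw[OF y qT1] holo_at_in_chart[OF M e] by blast
    qed
    then show False using 0 dw[OF y] by simp
  qed
  have z00: "z0 $ None = 0"
    using none[OF m1V] q by (simp add: z0_def S_def)
  have "\<exists>B u. open B \<and> z0 \<in> B \<and> B \<subseteq> S0 \<and>
    (\<forall>z\<in>B. hol_at u z \<and> grad u z \<noteq> 0 \<and> cmod (u z) ^ card I = (\<Prod>y\<in>I. cmod (g y z)) \<and>
      (u z = 0 \<longleftrightarrow> z $ None = 0))"
    by (rule holomorphic_geometric_mean[OF fin S0 z00 hg g0 dg])
  then obtain B Uf where B: "open B" "z0 \<in> B" "B \<subseteq> S0"
    and Uf_all: "\<forall>z\<in>B. hol_at Uf z \<and> grad Uf z \<noteq> 0 \<and> cmod (Uf z) ^ card I = (\<Prod>y\<in>I. cmod (g y z)) \<and>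
      (Uf z = 0 \<longleftrightarrow> z $ None = 0)"
    by (elim exE conjE) (rule that)
  have hU: "hol_at Uf z" and dU: "grad Uf z \<noteq> 0"
    and mU: "cmod (Uf z) ^ card I = (\<Prod>y\<in>I. cmod (g y z))" and zU: "Uf z = 0 \<longleftrightarrow> z $ None = 0"
    if "z \<in> B" for z
    using bspec[OF Uf_all that] by simp_all
  define u where "u = (Uf \<circ> snd c1) \<circ> s1"
  define O1 where "O1 = {m \<in> fst c1. snd c1 m \<in> B}"
  have O1: "openin (top_of N) O1" unfolding O1_def by (rule is_chart_open_vimage[OF c1X B(1)])
  define T where "T = {x \<in> fst ` V1. s1 x \<in> O1} \<inter> T1"
  have T: "openin (top_of M) T"
    unfolding T_def using local_sectionD(4)[OF ls1 O1] T1 by blast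
  have "s1 (\<iota> q) = (\<iota> q, y1)" using local_sectionD(3)[OF ls1 m1V] by simp
  then have qT: "\<iota> q \<in> T"
    using qT1 m1V m1c B(2) by (force simp: T_def O1_def z0_def)
  have Uc: "Uf z = ((Uf \<circ> snd c1) \<circ> chart_inv c1) z" if "z \<in> snd c1 ` fst c1" for z
    using that c1X by auto
  have oc1: "open (snd c1 ` fst c1)" using c1X by (simp add: is_chart_def)
  have "defining_function M mean_modulus S T u"
    unfolding defining_function_def
  proof (intro conjI ballI T impI)
    fix x assume x: "x \<in> T"
    define m where "m = s1 x"
    have xT1: "x \<in> T1" using x by (simp add: T_def)
    have m: "m \<in> V1" "fst m = x" "m \<in> fst c1" "snd c1 m \<in> B"
      using sx[OF y1 xT1] x by (auto simp: T_def m_def s1_def V1_def O1_def)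
    have zc: "snd c1 m \<in> snd c1 ` fst c1" using m by blast
    note Uloc = hol_at_cong_open[OF oc1 zc Uc hU[OF m(4)]]
    have hN: "holo_at N (Uf \<circ> snd c1) m"
      unfolding holo_at_in_chart[OF N c1N m(3)] by (rule Uloc(1))
    have "x \<in> fst ` V1" using m by blast
    then show hu: "holo_at M u x"
      unfolding u_def using hN by (intro local_sectionD(6)[OF ls1]) (simp_all add: m_def)
    show "grad (u \<circ> chart_inv d) (snd d x) \<noteq> 0" if d: "d \<in> charts M" "x \<in> fst d" for d
    proof
      assume "grad (u \<circ> chart_inv d) (snd d x) = 0"
      then have 0: "grad ((u \<circ> fst) \<circ> chart_inv c1) (snd c1 m) = 0"
        using local_section_grad(1)[OF M N ls1 m(1) c1N m(3) d(1), of u] d(2) hu m(2) by simp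
      have "grad ((u \<circ> fst) \<circ> chart_inv c1) (snd c1 m) = grad ((Uf \<circ> snd c1) \<circ> chart_inv c1) (snd c1 m)"
      proof (rule hol_at_chart_cong(2)[OF c1X local_sectionD(1)[OF ls1] m(1,3) _ Uloc(1)])
        show "(Uf \<circ> snd c1) m' = (u \<circ> fst) m'" if "m' \<in> V1" for m'
          using local_sectionD(3)[OF ls1 that] by (simp add: u_def)
      qed
      then show False using 0 dU[OF m(4)] Uloc(2) by simp
    qed
    have um: "u x = Uf (snd c1 m)" by (simp add: u_def m_def)
    have "cmod (u x) ^ card I = (\<Prod>y\<in>I. cmod (w y x))"
      unfolding um mU[OF m(4)] gz[OF m(1)] m(2) ..
    \<comment> \<open>\<open>I\<close> is nonempty, so \<open>card I\<close> is positive and the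
      real root undoes the power.\<close>
    then show "cmod (u x) = mean_modulus x"
      unfolding mean[OF xT1] using fin by (metis card_gt_0_iff norm_ge_zero real_root_power_cancel)
    show "u x = 0 \<longleftrightarrow> x \<in> S"
      unfolding um zU[OF m(4)] none[OF m(1)] m(2) ..
  qed
  then show ?thesis
    using qT unfolding defining_domain_iff S_def by blast
qed

end

theorem theorem1p4:
  fixes M :: "('m, ('n::finite) option) cspace"
    and C :: "('c, 'n) cspace"
    and \<iota> :: "'c \<Rightarrow> 'm"
    and Chat :: "('d, 'n) cspace"
    and p :: "'d \<Rightarrow> 'c"
    and Mhat :: "('m \<times> 'd, 'n option) cspace"
    and \<iota>hat :: "'d \<Rightarrow> 'm \<times> 'd"
  defines "\<iota>hat \<equiv> \<lambda>y. (\<iota> (p y), y)"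
  assumes "connected_manifold C" and "complex_manifold M" and "holo_embedding C M \<iota>"
    and "only_constant_functions C"
    and "hermitian_flat C (normal_bundle M C \<iota>)"
    and "connected_manifold Chat" and "finite_galois_cover Chat C p"
    and "induced_neighborhood M C \<iota> Chat p Mhat"
    and "vertical_linearisation Mhat Chat \<iota>hat"
    and "cotangent_sequence_splits Mhat Chat \<iota>hat"
    and "\<And>k::nat. k \<ge> 1 \<Longrightarrow>
           H0_vanishes Chat (line_power (conormal_bundle Mhat Chat \<iota>hat) k)"
    and "\<And>k::nat. k \<ge> 1 \<Longrightarrow>
           H1_vanishes Chat (line_power (conormal_bundle Mhat Chat \<iota>hat) k)"
    and "\<And>k::nat. k \<ge> 1 \<Longrightarrow>
           H0_vanishes Chat
             (tensor_line (cotangent_bundle Chat) (line_power (conormal_bundle Mhat Chat \<iota>hat) k))"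
    and "\<And>k::nat. k \<ge> 1 \<Longrightarrow>
           H1_vanishes Chat
             (tensor_line (cotangent_bundle Chat) (line_power (conormal_bundle Mhat Chat \<iota>hat) k))"
    and "H0_vanishes Chat (tensor_line (cotangent_bundle Chat) (normal_bundle Mhat Chat \<iota>hat))"
  shows "\<exists>W F. \<iota> ` points C \<subseteq> W \<and> regular_foliation (CARD('n)) M W F \<and> is_leaf M W F C \<iota>"
proof -
  have M: "complex_manifold M" and C: "connected_manifold C" and emb: "holo_embedding C M \<iota>"
    by fact+
  have cover: "finite_etale_cover Chat C p"
    using \<open>finite_galois_cover Chat C p\<close> by (simp add: finite_galois_cover_def)
  obtain U \<pi> where U: "openin (top_of M) U" and \<iota>U: "\<iota> ` points C \<subseteq> U" and sm: "smooth_map (open_sub M U) C \<pi>"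
    and \<pi>\<iota>: "\<forall>x\<in>points C. \<pi> (\<iota> x) = x"
    and top: "top_of Mhat = subtopology (prod_topology (subtopology (top_of M) U) (top_of Chat)) {(x, y). \<pi> x = p y}"
    and N: "complex_manifold Mhat" and lb: "locally_biholomorphic Mhat (open_sub M U) fst"
    using \<open>induced_neighborhood M C \<iota> Chat p Mhat\<close> unfolding induced_neighborhood_def
    by (elim exE conjE) (rule that)
  have \<pi>: "continuous_map (subtopology (top_of M) U) (top_of C) \<pi>"
    using sm by (simp add: smooth_map_def open_sub_def)
  obtain \<V> where \<V>: "\<V> \<subseteq> adapted_charts Mhat Chat \<iota>hat" "\<iota>hat ` points Chat \<subseteq> (\<Union>c\<in>\<V>. fst c)"
    and modulus: "\<forall>c\<in>\<V>. \<forall>d\<in>\<V>. \<forall>m\<in>fst c \<inter> fst d. cmod (ver (snd c m)) = cmod (ver (snd d m))"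
    using vertical_linearisation_modulus[OF \<open>vertical_linearisation Mhat Chat \<iota>hat\<close>]
    by (elim exE conjE) (rule that)
  interpret covered_neighborhood M C \<iota> Chat p Mhat U \<pi> \<V>
  proof
    show "\<pi> (\<iota> x) = x" if "x \<in> points C" for x using \<pi>\<iota> that by blast
    show "\<V> \<subseteq> adapted_charts Mhat Chat (\<lambda>y. (\<iota> (p y), y))"
      "(\<lambda>y. (\<iota> (p y), y)) ` points Chat \<subseteq> (\<Union>c\<in>\<V>. fst c)"
      using \<V> by (simp_all only: \<iota>hat_def)
    show "cmod (ver (snd c m)) = cmod (ver (snd d m))"
      if "c \<in> \<V>" "d \<in> \<V>" "m \<in> fst c" "m \<in> fst d" for c d m
      using modulus that by blast
  qed (fact M N cover U \<iota>U \<pi> top lb)+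
  \<comment> \<open>The witness for \<open>W\<close> is the union of the domains of all local
    equations of modulus \<open>mean_modulus\<close>, and \<open>F\<close> is the distribution of
    their kernels.\<close>
  have "\<iota> ` points C \<subseteq> defining_domain M mean_modulus (\<iota> ` points C)"
    using defining_function_near by blast
  then show ?thesis
    using regular_foliation_kernel_distribution[OF M, of mean_modulus "\<iota> ` points C"]
      is_leaf_kernel_distribution[OF M C emb] by blast
qed

end
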